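(* Let $A$ be a $C^*$-algebra (not necessarily unital or commutative), let $E$ be a Hilbert $C^*$-module over $A$, and let $B=\{x\in E:\|x\|<1\}$ be its open unit ball. For every $c\in B$ and every $x\in B$ the element $\mathbf{1}+\langle c,x\rangle$ is invertible, and the map $$g_c(x):=c+(\mathrm{Id}-c\otimes c^* )^{1/2}\Big(x.\big[(\mathbf{1}+\langle c,x\rangle)^{-1}(\mathbf{1}-|c|^2)^{1/2}\big]\Big),\qquad x\in B,$$ is a holomorphic automorphism of $B$. Moreover, every holomorphic automorphism $h$ of $B$ can be represented in the form $h=L\circ g_c$ for some surjective linear isometry $L$ of $E$ and some $c\in E$ with $\|c\|<1$.
   Context: Let $A$ be a $C^*$-algebra. An inner product $A$-module is a complex vector space $E$ with maps $E\times A\to E$, $(x,a)\mapsto x.a$, and $E\times E\to A$, $(x,y)\mapsto\langle x,y\rangle$, such that: $E$ is a right $A$-module with $\lambda(x.a)=(\lambda x).a=x.(\lambda a)$ for $\lambda\in\mathbb{C}$, $x\in E$, $a\in A$; and for all $x,y,z\in E$, $\alpha,\beta\in\mathbb{C}$, $a\in A$: $\langle x,\alpha y+\beta z\rangle=\alpha\langle x,y\rangle+\beta\langle x,z\rangle$; $\langle x,y.a\rangle=\langle x,y\rangle a$; $\langle y,x\rangle=\langle x,y\rangle^*$; $\langle x,x\rangle\ge 0$, and $\langle x,x\rangle=0$ implies $x=0$. (So the inner product is linear in the second variable and conjugate linear in the first.) Then $\|x\|:=\|\langle x,x\rangle\|_A^{1/2}$ is a norm on $E$; $E$ is called a Hilbert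 $C^*$-module over $A$ if it is complete in this norm. Write $|x|:=\langle x,x\rangle^{1/2}\in A$. $\mathbf{1}$ denotes the unit of $A$ if $A$ is unital, and otherwise the unit of the unitization of $A$, which acts on $E$ by $x.(a+\lambda\mathbf{1})=x.a+\lambda x$; invertibility, inverses and square roots of elements such as $\mathbf{1}+\langle c,x\rangle$ and $\mathbf{1}-|c|^2$ are taken in this unital $C^*$-algebra. An $A$-linear map $f:E\to E$ is adjointable if there is an $A$-linear map $f^*:E\to E$ with $\langle f(x),y\rangle=\langle x,f^*(y)\rangle$ for all $x,y\in E$. The adjointable maps form a $C^*$-algebra $\mathcal{A}(E)$ in the operator norm, with unit the identity operator $\mathrm{Id}$. For $c\in E$, $c\otimes c^*\in\mathcal{A}(E)$ is the self-adjoint operator $(c\otimes c^* )(z)=c.\langle c,z\rangle$. For $\|c\|<1$, $(\mathrm{Id}-c\otimes c^* )^{1/2}$ is the positive square root in $\mathcal{A}(E)$ and $(\mathbf{1}-|c|^2)^{1/2}$ is the positive square root in the (unitized) $C^*$-algebra $A$. A holomorphic automorphism of $B$ is a biholomorphic bijection of $B$ onto itself. *)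

theory Defs
  imports "HOL-Analysis.Analysis" "HOL-Algebra.Module"
begin

section \<open>Complex Banach spaces and \<open>C\<^sup>*\<close>-algebras\<close>

class scaleC = scaleR +
  fixes scaleC :: "complex \<Rightarrow> 'a \<Rightarrow> 'a"  (infixr \<open>*\<^sub>C\<close> 75)

class complex_vector = real_vector + scaleC +
  assumes scaleC_add_right: "k *\<^sub>C (x + y) = k *\<^sub>C x + k *\<^sub>C y"
    and scaleC_add_left: "(k + l) *\<^sub>C x = k *\<^sub>C x + l *\<^sub>C x"
    and scaleC_scaleC: "k *\<^sub>C l *\<^sub>C x = (k * l) *\<^sub>C x"
    and scaleR_scaleC: "r *\<^sub>R x = complex_of_real r *\<^sub>C x"

class complex_banach = complex_vector + banach +
  assumes norm_scaleC: "norm (k *\<^sub>C x) = cmod k * norm x"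

text \<open>The class \<open>real_normed_algebra\<close> requires neither a unit nor commutativity,
  and it contains the zero algebra.\<close>

class cstar_algebra = complex_banach + real_normed_algebra +
  fixes star :: "'a \<Rightarrow> 'a"
  assumes mult_scaleC_left: "(k *\<^sub>C x) * y = k *\<^sub>C (x * y)"
    and mult_scaleC_right: "x * (k *\<^sub>C y) = k *\<^sub>C (x * y)"
    and star_star: "star (star x) = x"
    and star_add: "star (x + y) = star x + star y"
    and star_scaleC: "star (k *\<^sub>C x) = cnj k *\<^sub>C star x"
    and star_mult: "star (x * y) = star y * star x"
    and cstar_identity: "norm (star x * x) = (norm x)\<^sup>2"


section \<open>Spectrum, positivity and square roots in a unital \<open>*\<close>-algebra\<close>

text \<open>The two unital \<open>C\<^sup>*\<close>-algebras that occur, the unitization of \<open>A\<close> and the algebra of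
  adjointable maps, are records with an explicit carrier.  Spectrum, positivity and square
  roots do not involve the norm, so the records do not carry one.\<close>

record 'x star_algebra = "(complex, 'x) module" +
  invol :: "'x \<Rightarrow> 'x"

definition spectrum :: "('x, 'm) star_algebra_scheme \<Rightarrow> 'x \<Rightarrow> complex set" where
  "spectrum R a = {k. k \<odot>\<^bsub>R\<^esub> \<one>\<^bsub>R\<^esub> \<ominus>\<^bsub>R\<^esub> a \<notin> Units R}"

definition positive :: "('x, 'm) star_algebra_scheme \<Rightarrow> 'x \<Rightarrow> bool" where
  "positive R a \<longleftrightarrow> a \<in> carrier R \<and> invol R a = a \<and> spectrum R a \<subseteq> \<real>\<^sub>\<ge>\<^sub>0"

definition pos_sqrt :: "('x, 'm) star_algebra_scheme \<Rightarrow> 'x \<Rightarrow> 'x" where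
  "pos_sqrt R a = (THE s. positive R s \<and> s \<otimes>\<^bsub>R\<^esub> s = a)"


section \<open>The unitization\<close>

definition is_unit_element :: "'a::cstar_algebra \<Rightarrow> bool" where
  "is_unit_element e \<longleftrightarrow> (\<forall>a. e * a = a \<and> a * e = a)"

definition unital :: "'a::cstar_algebra itself \<Rightarrow> bool" where
  "unital _ \<longleftrightarrow> (\<exists>e::'a. is_unit_element e)"

text \<open>A pair \<open>(a, k)\<close> stands for \<open>a + k\<one>\<close>.  If \<open>A\<close> is unital then the algebra below is \<open>A\<close>
  itself, embedded as \<open>A \<times> {0}\<close> and with the unit of \<open>A\<close>; no second unit is adjoined.\<close>

definition unitization :: "('a::cstar_algebra \<times> complex) star_algebra" where
  "unitization =
    \<lparr> carrier = (if unital TYPE('a) then UNIV \<times> {0} else UNIV),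
      mult = (\<lambda>(a, k) (b, l). (a * b + l *\<^sub>C a + k *\<^sub>C b, k * l)),
      one = (if unital TYPE('a) then (THE e. is_unit_element e, 0) else (0, 1)),
      zero = (0, 0),
      add = (\<lambda>(a, k) (b, l). (a + b, k + l)),
      smult = (\<lambda>l (a, k). (l *\<^sub>C a, l * k)),
      invol = (\<lambda>(a, k). (star a, cnj k)) \<rparr>"

definition emb :: "'a::cstar_algebra \<Rightarrow> 'a \<times> complex" where
  "emb a = (a, 0)"

definition unitized_act ::
  "('e::complex_vector \<Rightarrow> 'a::cstar_algebra \<Rightarrow> 'e) \<Rightarrow> 'e \<Rightarrow> 'a \<times> complex \<Rightarrow> 'e" where
  "unitized_act act x = (\<lambda>(a, k). act x a + k *\<^sub>C x)"


section \<open>Hilbert \<open>C\<^sup>*\<close>-modules\<close>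

locale inner_product_module =
  fixes act :: "'e::complex_vector \<Rightarrow> 'a::cstar_algebra \<Rightarrow> 'e"
    and ip :: "'e \<Rightarrow> 'e \<Rightarrow> 'a"
  assumes act_add_left: "act (x + y) a = act x a + act y a"
    and act_add_right: "act x (a + b) = act x a + act x b"
    and act_mult: "act x (a * b) = act (act x a) b"
    and scaleC_act: "k *\<^sub>C act x a = act (k *\<^sub>C x) a"
    and act_scaleC: "act (k *\<^sub>C x) a = act x (k *\<^sub>C a)"
    and ip_linear: "ip x (k *\<^sub>C y + l *\<^sub>C z) = k *\<^sub>C ip x y + l *\<^sub>C ip x z"
    and ip_act: "ip x (act y a) = ip x y * a"
    and ip_star: "ip y x = star (ip x y)"
    and ip_positive: "positive unitization (emb (ip x x))"
    and ip_definite: "ip x x = 0 \<Longrightarrow> x = 0"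

text \<open>Completeness is part of the class \<open>complex_banach\<close>.\<close>

locale hilbert_module = inner_product_module act ip
  for act :: "'e::complex_banach \<Rightarrow> 'a::cstar_algebra \<Rightarrow> 'e" and ip +
  assumes norm_eq: "norm x = sqrt (norm (ip x x))"

definition modulus :: "('e \<Rightarrow> 'e \<Rightarrow> 'a::cstar_algebra) \<Rightarrow> 'e \<Rightarrow> 'a \<times> complex" where
  "modulus ip x = pos_sqrt unitization (emb (ip x x))"


section \<open>Adjointable maps\<close>

definition complex_linear :: "('e::complex_vector \<Rightarrow> 'e) \<Rightarrow> bool" where
  "complex_linear f \<longleftrightarrow> (\<forall>x y. f (x + y) = f x + f y) \<and> (\<forall>k x. f (k *\<^sub>C x) = k *\<^sub>C f x)"

definition module_linear ::
  "('e::complex_vector \<Rightarrow> 'a \<Rightarrow> 'e) \<Rightarrow> ('e \<Rightarrow> 'e) \<Rightarrow> bool" where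
  "module_linear act f \<longleftrightarrow> complex_linear f \<and> (\<forall>x a. f (act x a) = act (f x) a)"

definition is_adjoint ::
  "('e::complex_vector \<Rightarrow> 'a \<Rightarrow> 'e) \<Rightarrow> ('e \<Rightarrow> 'e \<Rightarrow> 'a) \<Rightarrow> ('e \<Rightarrow> 'e) \<Rightarrow> ('e \<Rightarrow> 'e) \<Rightarrow> bool" where
  "is_adjoint act ip f g \<longleftrightarrow> module_linear act g \<and> (\<forall>x y. ip (f x) y = ip x (g y))"

definition adjointable ::
  "('e::complex_vector \<Rightarrow> 'a \<Rightarrow> 'e) \<Rightarrow> ('e \<Rightarrow> 'e \<Rightarrow> 'a) \<Rightarrow> ('e \<Rightarrow> 'e) \<Rightarrow> bool" where
  "adjointable act ip f \<longleftrightarrow> module_linear act f \<and> (\<exists>g. is_adjoint act ip f g)"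

definition adjointable_algebra ::
  "('e::complex_vector \<Rightarrow> 'a \<Rightarrow> 'e) \<Rightarrow> ('e \<Rightarrow> 'e \<Rightarrow> 'a) \<Rightarrow> ('e \<Rightarrow> 'e) star_algebra" where
  "adjointable_algebra act ip =
    \<lparr> carrier = {f. adjointable act ip f},
      mult = (\<circ>),
      one = id,
      zero = (\<lambda>x. 0),
      add = (\<lambda>f g x. f x + g x),
      smult = (\<lambda>k f x. k *\<^sub>C f x),
      invol = (\<lambda>f. THE g. is_adjoint act ip f g) \<rparr>"

text \<open>The operator \<open>c \<otimes> c\<^sup>*\<close>.\<close>

definition rank_one ::
  "('e \<Rightarrow> 'a \<Rightarrow> 'e) \<Rightarrow> ('e \<Rightarrow> 'e \<Rightarrow> 'a) \<Rightarrow> 'e \<Rightarrow> 'e \<Rightarrow> 'e" where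
  "rank_one act ip c z = act c (ip c z)"


section \<open>Holomorphic automorphisms and the maps \<open>g\<^sub>c\<close>\<close>

text \<open>Complex Frechet differentiability on an open set.\<close>

definition holomorphic_map_on :: "('e::complex_banach \<Rightarrow> 'e) \<Rightarrow> 'e set \<Rightarrow> bool" where
  "holomorphic_map_on f U \<longleftrightarrow> (\<forall>x\<in>U. \<exists>D. (f has_derivative D) (at x) \<and> complex_linear D)"

definition holomorphic_automorphism :: "'e::complex_banach set \<Rightarrow> ('e \<Rightarrow> 'e) \<Rightarrow> bool" where
  "holomorphic_automorphism U h \<longleftrightarrow>
     bij_betw h U U \<and> holomorphic_map_on h U \<and> holomorphic_map_on (inv_into U h) U"

definition moebius_map ::
  "('e::complex_banach \<Rightarrow> 'a::cstar_algebra \<Rightarrow> 'e) \<Rightarrow> ('e \<Rightarrow> 'e \<Rightarrow> 'a) \<Rightarrow> 'e \<Rightarrow> 'e \<Rightarrow> 'e" where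
  "moebius_map act ip c x =
    (let U = unitization; L = adjointable_algebra act ip in
      c + pos_sqrt L (\<one>\<^bsub>L\<^esub> \<ominus>\<^bsub>L\<^esub> rank_one act ip c)
            (unitized_act act x
              (inv\<^bsub>U\<^esub> (\<one>\<^bsub>U\<^esub> \<oplus>\<^bsub>U\<^esub> emb (ip c x))
                \<otimes>\<^bsub>U\<^esub> pos_sqrt U (\<one>\<^bsub>U\<^esub> \<ominus>\<^bsub>U\<^esub> modulus ip c [^]\<^bsub>U\<^esub> (2::nat)))))"

definition surjective_linear_isometry :: "('e::complex_banach \<Rightarrow> 'e) \<Rightarrow> bool" where
  "surjective_linear_isometry L \<longleftrightarrow> complex_linear L \<and> (\<forall>x. norm (L x) = norm x) \<and> surj L"

end

theory Submission
  imports Defs "HOL-Complex_Analysis.Conformal_Mappings"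
begin

text \<open>
  \<^bold>\<open>The maps \<open>g\<^sub>c\<close>.\<close>  Write \<open>s = (\<one> - |c|\<^sup>2)\<^sup>1\<^sup>/\<^sup>2\<close>, \<open>S = (Id - c c\<^sup>*)\<^sup>1\<^sup>/\<^sup>2\<close> and \<open>q = (\<one> + \<langle>c, x\<rangle>)\<^sup>-\<^sup>1\<close>, so that
  \<open>g\<^sub>c(x) = c + S (x.(q s))\<close>.  The relations \<open>S\<^sup>2 = Id - c c\<^sup>*\<close> and \<open>S c = c.s\<close> imply, by expanding inner products
  (\<open>moebius_defect_identities\<close>),
  \<open>\<one> - \<langle>g\<^sub>c(x), g\<^sub>c(x)\<rangle> = (q s)\<^sup>* (\<one> - \<langle>x, x\<rangle>) (q s)\<close> and \<open>\<one> - \<langle>c, g\<^sub>c(x)\<rangle> = s q s\<close>.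
  As \<open>q s\<close> is invertible, the first identity shows that \<open>g\<^sub>c\<close> maps the ball into itself (\<open>norm_moebius\<close>); the second
  one shows that \<open>g\<^sub>-\<^sub>c\<close> is the inverse of \<open>g\<^sub>c\<close> (\<open>moebius_inverse\<close>).  The operator \<open>S\<close> has the closed form
  \<open>Id - c (\<one> + s)\<^sup>-\<^sup>1 c\<^sup>*\<close>, from which the two relations and the spectrum of \<open>S\<close> can be read off
  (\<open>defect_op_props\<close>, \<open>defect_op_eq_pos_sqrt\<close>).

  Square roots are unique positive solutions, where positivity is a condition on the spectrum.  Therefore one needs
  in the unitization of \<open>A\<close> and in the algebra of adjointable maps that elements with nonnegative spectrum are the
  squares of self-adjoint elements (\<open>psd_iff_spectrum\<close>) and that roots are unique (\<open>psd_sqrt_unique\<close>).  The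
  Cauchy--Schwarz inequality and the estimate of \<open>g\<^sub>c(x)\<close> also use the positivity of elements \<open>z\<^sup>*z\<close>
  (\<open>psd_star_mult\<close>).  These facts are proved once, for a closed \<open>C\<^sup>*\<close>-subalgebra of a Banach algebra, without
  functional calculus and without the spectral radius formula: the root of \<open>1 - b\<close> with \<open>norm b \<le> 1\<close> is the limit of
  an iteration, and norms are controlled by \<open>(norm y)\<^sup>2 \<le> norm (y\<^sup>2 + z\<^sup>2)\<close> for commuting self-adjoint elements.  The
  unitization is represented on \<open>A\<close> by left multiplications, the adjointable maps act on \<open>E\<close>.

  \<^bold>\<open>All automorphisms.\<close>  For an automorphism \<open>h\<close> and \<open>c = - h\<^sup>-\<^sup>1(0)\<close> the automorphism \<open>h \<circ> g\<^sub>-\<^sub>c\<close> fixes \<open>0\<close>.  By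
  Cartan's theorem it is the restriction of a surjective linear isometry \<open>L\<close> (\<open>automorphism_fixing_zero_is_linear\<close>), and
  \<open>h = L \<circ> g\<^sub>c\<close>.  The core is Cartan's uniqueness theorem (\<open>Cartan_uniqueness\<close>): a holomorphic self-map \<open>f\<close> of the ball with
  \<open>f 0 = 0\<close> and derivative \<open>id\<close> at \<open>0\<close> is the identity.  Instead of comparing homogeneous Taylor terms of the iterates
  of \<open>f\<close>, one considers their averages \<open>F\<^sub>n\<close>.  These are again self-maps of the ball with derivative \<open>id\<close>, and the
  Schwarz lemma shows that such maps shrink distances near \<open>0\<close> at most by a factor of \<open>2\<close>, for every \<open>n\<close>; since
  \<open>F\<^sub>n (f x) - F\<^sub>n x = (f\<^sup>n x - x) / n\<close> tends to \<open>0\<close>, it follows that \<open>f x = x\<close>.  One-variable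
  function theory becomes applicable through norming functionals, which come from a Hahn--Banach argument.
\<close>

section \<open>Positivity and square roots in a unital \<open>C\<^sup>*\<close>-algebra\<close>

lemma scaleC_one [simp]: "1 *\<^sub>C x = (x::'a::complex_vector)"
  using scaleR_scaleC[of 1 x] by simp

lemma scaleC_zero_left [simp]: "0 *\<^sub>C x = (0::'a::complex_vector)"
  using scaleR_scaleC[of 0 x] by simp

lemma scaleC_zero_right [simp]: "k *\<^sub>C 0 = (0::'a::complex_vector)"
  using scaleC_add_right[of k 0 0] by simp

lemma scaleC_minus_right: "k *\<^sub>C (- x) = - (k *\<^sub>C (x::'a::complex_vector))"
  using scaleC_add_right[of k x "-x"] by (simp add: eq_neg_iff_add_eq_0 add.commute)

lemma scaleC_minus_left: "(- k) *\<^sub>C x = - (k *\<^sub>C (x::'a::complex_vector))"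
  using scaleC_add_left[of k "-k" x] by (simp add: eq_neg_iff_add_eq_0 add.commute)

lemma scaleC_diff_right: "k *\<^sub>C (x - y) = k *\<^sub>C x - k *\<^sub>C (y::'a::complex_vector)"
  using scaleC_add_right[of k x "-y"] by (simp add: scaleC_minus_right)

lemma scaleC_diff_left: "(k - l) *\<^sub>C x = k *\<^sub>C x - l *\<^sub>C (x::'a::complex_vector)"
  using scaleC_add_left[of k "-l" x] by (simp add: scaleC_minus_left)

lemma scaleC_scaleR_commute: "k *\<^sub>C (r *\<^sub>R x) = r *\<^sub>R (k *\<^sub>C (x::'a::complex_vector))"
  by (simp add: scaleR_scaleC scaleC_scaleC mult.commute)

lemma bounded_linear_scaleC_right: "bounded_linear (\<lambda>x::'a::complex_banach. k *\<^sub>C x)"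
  by (rule bounded_linear_intro[where K="cmod k"])
    (simp_all add: scaleC_add_right scaleC_scaleR_commute norm_scaleC mult.commute)

lemma bounded_linear_scaleC_left: "bounded_linear (\<lambda>k. k *\<^sub>C (x::'a::complex_banach))"
proof (rule bounded_linear_intro[where K="norm x"])
  fix r :: real and k :: complex
  show "(r *\<^sub>R k) *\<^sub>C x = r *\<^sub>R k *\<^sub>C x"
    by (simp add: scaleR_scaleC scaleC_scaleC scaleR_conv_of_real)
qed (simp_all add: scaleC_add_left norm_scaleC)

text \<open>The unit is only required to have norm at most \<open>1\<close>, and \<open>0 = 1\<close> is not excluded: the
  operators on the zero space have to be covered.\<close>

class complex_banach_algebra_1 = complex_banach + real_normed_algebra + monoid_mult +
  assumes scaleC_mult_left: "(k *\<^sub>C x) * y = k *\<^sub>C (x * y)"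
    and scaleC_mult_right: "x * (k *\<^sub>C y) = k *\<^sub>C (x * y)"
    and norm_one_le: "norm 1 \<le> 1"

lemma norm_scaleR_one_le: "0 \<le> t \<Longrightarrow> norm (t *\<^sub>R (1::'u::complex_banach_algebra_1)) \<le> t"
  by (simp add: mult_left_le norm_one_le)

definition invertible_in :: "'u::monoid_mult set \<Rightarrow> 'u \<Rightarrow> bool" where
  "invertible_in C x \<longleftrightarrow> (\<exists>y\<in>C. x * y = 1 \<and> y * x = 1)"

text \<open>If \<open>y = (b + y\<^sup>2) / 2\<close> then \<open>(1 - y)\<^sup>2 = 1 - b\<close>.  The fixed point iteration below, started at \<open>0\<close>,
  therefore computes \<open>1 - (1 - b)\<^sup>1\<^sup>/\<^sup>2\<close>.  Its terms are polynomials in \<open>b\<close> with nonnegative coefficients, so that for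
  \<open>norm b \<le> 1\<close> everything is dominated by the real iteration with \<open>b = 1\<close>, which increases and is bounded
  by \<open>1\<close>.  This gives convergence on the closed unit ball without estimating binomial coefficients.\<close>

primrec sqrt_iter :: "'a::real_algebra \<Rightarrow> nat \<Rightarrow> 'a" where
  "sqrt_iter b 0 = 0"
| "sqrt_iter b (Suc n) = (1/2) *\<^sub>R (b + sqrt_iter b n * sqrt_iter b n)"

lemma sqrt_iter_commute:
  assumes "z * b = b * z"
  shows "z * sqrt_iter b n = sqrt_iter b n * z"
proof (induction n)
  case (Suc n)
  have "z * (sqrt_iter b n * sqrt_iter b n) = sqrt_iter b n * sqrt_iter b n * z"
    by (metis Suc mult.assoc)
  then show ?case using assms by (simp add: algebra_simps)
qed simp

lemma real_sqrt_iter_bounds: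
  "0 \<le> sqrt_iter (1::real) n" "sqrt_iter (1::real) n \<le> 1"
  "sqrt_iter (1::real) n \<le> sqrt_iter 1 (Suc n)"
proof -
  have 1: "0 \<le> sqrt_iter (1::real) n \<and> sqrt_iter (1::real) n \<le> 1" for n
  proof (induction n)
    case (Suc n)
    then have "sqrt_iter (1::real) n * sqrt_iter 1 n \<le> 1 * 1"
      by (intro mult_mono) auto
    then show ?case using Suc by simp
  qed simp
  then show "0 \<le> sqrt_iter (1::real) n" "sqrt_iter (1::real) n \<le> 1" by auto
  have "0 \<le> (1 - sqrt_iter (1::real) n)^2" by simp
  then show "sqrt_iter (1::real) n \<le> sqrt_iter 1 (Suc n)"
    by (simp add: power2_eq_square algebra_simps)
qed

lemma norm_sqrt_iter:
  fixes b :: "'a::real_normed_algebra"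
  assumes "norm b \<le> 1"
  shows "norm (sqrt_iter b n) \<le> sqrt_iter 1 n"
proof (induction n)
  case (Suc n)
  have "norm (sqrt_iter b n * sqrt_iter b n) \<le> sqrt_iter 1 n * sqrt_iter 1 n"
    by (rule order_trans[OF norm_mult_ineq]) (intro mult_mono Suc; simp add: real_sqrt_iter_bounds)
  then have "norm (b + sqrt_iter b n * sqrt_iter b n) \<le> 1 + sqrt_iter 1 n * sqrt_iter 1 n"
    using norm_triangle_ineq[of b "sqrt_iter b n * sqrt_iter b n"] assms by linarith
  then show ?case by simp
qed simp

lemma norm_sqrt_iter_step:
  fixes b :: "'a::real_normed_algebra"
  assumes "norm b \<le> 1"
  shows "norm (sqrt_iter b (Suc n) - sqrt_iter b n) \<le> sqrt_iter 1 (Suc n) - sqrt_iter 1 n"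
proof (induction n)
  case 0
  then show ?case using assms by simp
next
  case (Suc n)
  let ?x = "sqrt_iter b (Suc n)" and ?y = "sqrt_iter b n"
  let ?r = "sqrt_iter (1::real) (Suc n)" and ?s = "sqrt_iter (1::real) n"
  have diff_squares: "x * x - y * y = (x - y) * (x + y)" if "x * y = y * x" for x y :: 'a
    by (simp add: algebra_simps that)
  have c: "?x * ?y = ?y * ?x"
    by (intro sqrt_iter_commute sqrt_iter_commute[symmetric]) simp
  have "sqrt_iter b (Suc (Suc n)) - ?x = (1/2) *\<^sub>R (?x * ?x - ?y * ?y)"
    by (subst (1 2) sqrt_iter.simps(2)) (simp only: scaleR_diff_right[symmetric] add_diff_cancel_left)
  also have "?x * ?x - ?y * ?y = (?x - ?y) * (?x + ?y)"
    by (rule diff_squares[OF c])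
  finally have e: "sqrt_iter b (Suc (Suc n)) - ?x = (1/2) *\<^sub>R ((?x - ?y) * (?x + ?y))" .
  have "norm ((?x - ?y) * (?x + ?y)) \<le> (?r - ?s) * (?r + ?s)"
  proof (rule order_trans[OF norm_mult_ineq], rule mult_mono)
    show "norm (?x + ?y) \<le> ?r + ?s"
      using norm_triangle_ineq[of ?x ?y] norm_sqrt_iter[OF assms, of "Suc n"] norm_sqrt_iter[OF assms, of n]
      by linarith
    show "0 \<le> ?r - ?s" using real_sqrt_iter_bounds(3)[of n] by linarith
  qed (use Suc in auto)
  then have "norm (sqrt_iter b (Suc (Suc n)) - ?x) \<le> (1/2) * ((?r - ?s) * (?r + ?s))"
    unfolding e by simp
  also have "\<dots> = sqrt_iter 1 (Suc (Suc n)) - ?r"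
    by (simp add: field_simps)
  finally show ?case .
qed

lemma sqrt_iter_convergent:
  fixes b :: "'a::{real_normed_algebra,banach}"
  assumes "norm b \<le> 1"
  shows "convergent (sqrt_iter b)"
proof -
  have mono: "sqrt_iter (1::real) m \<le> sqrt_iter 1 n" if "m \<le> n" for m n
    using that by (rule lift_Suc_mono_le[rotated]) (rule real_sqrt_iter_bounds(3))
  have "convergent (sqrt_iter (1::real))"
    by (rule Bseq_mono_convergent)
      (auto intro!: BseqI'[of _ 1] simp: real_sqrt_iter_bounds mono)
  then have "Cauchy (sqrt_iter (1::real))" by (rule convergent_Cauchy)
  have dd: "norm (sqrt_iter b n - sqrt_iter b m) \<le> sqrt_iter 1 n - sqrt_iter 1 m" if "m \<le> n" for m n
    using that
  proof (induction n rule: dec_induct)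
    case (step n)
    have "norm (sqrt_iter b (Suc n) - sqrt_iter b m)
        \<le> norm (sqrt_iter b (Suc n) - sqrt_iter b n) + norm (sqrt_iter b n - sqrt_iter b m)"
      using norm_triangle_ineq[of "sqrt_iter b (Suc n) - sqrt_iter b n" "sqrt_iter b n - sqrt_iter b m"] by simp
    then show ?case using step.IH norm_sqrt_iter_step[OF assms, of n] by linarith
  qed simp
  have "Cauchy (sqrt_iter b)"
  proof (rule metric_CauchyI)
    fix e :: real assume "e > 0"
    with \<open>Cauchy (sqrt_iter (1::real))\<close> obtain N where
      N: "\<And>m n. m \<ge> N \<Longrightarrow> n \<ge> N \<Longrightarrow> dist (sqrt_iter (1::real) m) (sqrt_iter 1 n) < e"
      using metric_CauchyD by blast
    have "dist (sqrt_iter b m) (sqrt_iter b n) < e" if "m \<ge> N" "n \<ge> N" for m n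
    proof (cases "m \<le> n")
      case True
      then show ?thesis using dd[OF True] N[OF that] mono[OF True]
        by (simp add: dist_norm norm_minus_commute abs_if split: if_splits)
    next
      case False
      then have "n \<le> m" by simp
      then show ?thesis using dd[OF \<open>n \<le> m\<close>] N[OF that] mono[OF \<open>n \<le> m\<close>]
        by (simp add: dist_norm norm_minus_commute abs_if split: if_splits)
    qed
    then show "\<exists>M. \<forall>m\<ge>M. \<forall>n\<ge>M. dist (sqrt_iter b m) (sqrt_iter b n) < e" by blast
  qed
  then show ?thesis by (rule Cauchy_convergent)
qed

text \<open>A unital \<open>C\<^sup>*\<close>-algebra is presented as a closed subalgebra of a Banach algebra, with an involution
  that is defined on the subalgebra only.  In both applications the surrounding algebra consists of all bounded
  operators on a Banach space; it has no involution, but its type makes ring normalisation available.  The inequality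
  \<open>cstar_le\<close> already forces the involution to be isometric and hence the \<open>C\<^sup>*\<close>-identity.\<close>

locale unital_cstar =
  fixes C :: "'u::complex_banach_algebra_1 set" and st :: "'u \<Rightarrow> 'u"
  assumes closed_C: "closed C"
    and one_C: "1 \<in> C"
    and add_C: "x \<in> C \<Longrightarrow> y \<in> C \<Longrightarrow> x + y \<in> C"
    and mult_C: "x \<in> C \<Longrightarrow> y \<in> C \<Longrightarrow> x * y \<in> C"
    and scaleC_C: "x \<in> C \<Longrightarrow> k *\<^sub>C x \<in> C"
    and st_C: "x \<in> C \<Longrightarrow> st x \<in> C"
    and st_st: "x \<in> C \<Longrightarrow> st (st x) = x"
    and st_add: "x \<in> C \<Longrightarrow> y \<in> C \<Longrightarrow> st (x + y) = st x + st y"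
    and st_scaleC: "x \<in> C \<Longrightarrow> st (k *\<^sub>C x) = cnj k *\<^sub>C st x"
    and st_mult: "x \<in> C \<Longrightarrow> y \<in> C \<Longrightarrow> st (x * y) = st y * st x"
    and cstar_le: "x \<in> C \<Longrightarrow> (norm x)\<^sup>2 \<le> norm (st x * x)"
begin

lemma scaleR_C: "x \<in> C \<Longrightarrow> r *\<^sub>R x \<in> C"
  by (simp add: scaleR_scaleC scaleC_C)

lemma zero_C: "0 \<in> C"
  using scaleC_C[OF one_C, of 0] by simp

lemma uminus_C: "x \<in> C \<Longrightarrow> - x \<in> C"
  using scaleR_C[of x "-1"] by simp

lemma diff_C: "x \<in> C \<Longrightarrow> y \<in> C \<Longrightarrow> x - y \<in> C"
  using add_C[of x "-y"] uminus_C[of y] by simp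

lemmas C_intros = one_C zero_C add_C mult_C scaleC_C st_C scaleR_C uminus_C diff_C

lemma st_scaleR: "x \<in> C \<Longrightarrow> st (r *\<^sub>R x) = r *\<^sub>R st x"
  by (simp add: scaleR_scaleC st_scaleC)

lemma st_minus: "x \<in> C \<Longrightarrow> st (- x) = - st x"
  using st_scaleR[of x "-1"] by simp

lemma st_diff: "x \<in> C \<Longrightarrow> y \<in> C \<Longrightarrow> st (x - y) = st x - st y"
  using st_add[of x "-y"] by (simp add: C_intros st_minus)

lemma st_one: "st 1 = 1"
  by (metis mult_1_right one_C st_C st_mult st_st)

lemma st_zero: "st 0 = 0"
  using st_scaleR[OF one_C, of 0] by simp

lemma norm_st: assumes "x \<in> C" shows "norm (st x) = norm x"
proof -
  have "norm x \<le> norm (st x)" if "x \<in> C" for x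
  proof (cases "norm x = 0")
    case False
    have "norm x * norm x \<le> norm (st x) * norm x"
      using cstar_le[OF that] norm_mult_ineq[of "st x" x] by (simp add: power2_eq_square)
    then show ?thesis using False by simp
  qed auto
  from this[OF assms] this[OF st_C[OF assms]] show ?thesis
    by (simp add: st_st assms)
qed

lemma cstar_eq: "x \<in> C \<Longrightarrow> norm (st x * x) = (norm x)\<^sup>2"
  using cstar_le[of x] norm_mult_ineq[of "st x" x] by (simp add: norm_st power2_eq_square)

definition sa :: "'u \<Rightarrow> bool" where "sa x \<longleftrightarrow> x \<in> C \<and> st x = x"

lemma sa_C: "sa x \<Longrightarrow> x \<in> C" by (simp add: sa_def)

lemma sa_intros:
  "sa 1" "sa 0" "sa x \<Longrightarrow> sa y \<Longrightarrow> sa (x + y)" "sa x \<Longrightarrow> sa y \<Longrightarrow> sa (x - y)"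
  "sa x \<Longrightarrow> sa (r *\<^sub>R x)" "sa x \<Longrightarrow> sa (- x)"
  "sa x \<Longrightarrow> sa y \<Longrightarrow> x * y = y * x \<Longrightarrow> sa (x * y)"
  by (auto simp: sa_def C_intros st_one st_zero st_add st_diff st_scaleR st_minus st_mult)

lemma sa_square: "sa x \<Longrightarrow> sa (x * x)"
  by (simp add: sa_intros)

lemma norm_sa_square: "sa x \<Longrightarrow> norm (x * x) = (norm x)\<^sup>2"
  using cstar_eq[of x] by (simp add: sa_def)

text \<open>The element \<open>u = y + \<i>z\<close> satisfies \<open>u\<^sup>*u = y\<^sup>2 + z\<^sup>2\<close> because \<open>y\<close> and \<open>z\<close> commute, and \<open>y\<close> is its real part.
  This estimate is the substitute for the spectral radius formula in everything that follows.\<close>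

lemma norm_le_sum_squares:
  assumes y: "sa y" and z: "sa z" and yz: "y * z = z * y"
  shows "(norm y)\<^sup>2 \<le> norm (y * y + z * z)"
proof -
  define u where "u = y + \<i> *\<^sub>C z"
  have yC: "y \<in> C" and zC: "z \<in> C" and sty: "st y = y" and stz: "st z = z"
    using y z by (auto simp: sa_def)
  have uC: "u \<in> C" by (simp add: u_def yC zC C_intros)
  have stu: "st u = y - \<i> *\<^sub>C z"
    by (simp add: u_def st_add st_scaleC yC zC C_intros sty stz scaleC_minus_left)
  have uu: "st u * u = y * y + z * z"
    unfolding stu unfolding u_def
    by (simp add: algebra_simps scaleC_mult_left scaleC_mult_right yz scaleC_scaleC scaleC_minus_left
        scaleC_diff_right)
  have "y = (1/2) *\<^sub>R (u + st u)"
    unfolding stu unfolding u_def by (simp add: scaleR_2[symmetric])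
  then have "norm y \<le> (1/2) * (norm u + norm (st u))"
    by (metis norm_scaleR norm_triangle_ineq abs_of_nonneg divide_nonneg_nonneg zero_le_one
        zero_le_numeral mult_left_mono)
  then have "norm y \<le> norm u" by (simp add: norm_st uC)
  then have "(norm y)\<^sup>2 \<le> (norm u)\<^sup>2" by (simp add: power_mono)
  then show ?thesis using cstar_eq[OF uC] uu by simp
qed

text \<open>The equation \<open>z = b + b z\<close> has a solution in the closed subalgebra by the contraction principle, and
  \<open>1 + z\<close> is then a right inverse; a left inverse arises in the same way.\<close>

lemma invertible_one_minus:
  assumes b: "b \<in> C" and nb: "norm b < 1"
  shows "invertible_in C (1 - b)"
proof -
  have ex: "\<exists>z\<in>C. z = b + L z" if L: "linear L" "\<And>z. norm (L z) \<le> norm b * norm z" "\<And>z. z \<in> C \<Longrightarrow> L z \<in> C" for L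
  proof -
    have "\<exists>!z\<in>C. b + L z = z"
    proof (rule Banach_fix[where c="norm b"])
      show "complete C" using closed_C complete_eq_closed by blast
      show "(\<lambda>z. b + L z) ` C \<subseteq> C" using b L by (auto simp: C_intros)
      show "dist (b + L x) (b + L y) \<le> norm b * dist x y" if "x \<in> C" "y \<in> C" for x y
        using L(2)[of "x - y"] by (simp add: dist_norm linear_diff[OF L(1)])
    qed (use nb zero_C in auto)
    then show ?thesis by metis
  qed
  obtain z where z: "z \<in> C" "z = b + b * z"
    using ex[of "\<lambda>z. b * z"] b
    by (auto simp: norm_mult_ineq mult_C bounded_linear.linear[OF bounded_linear_mult_right])
  obtain z' where z': "z' \<in> C" "z' = b + z' * b"
  proof -
    have "norm (z * b) \<le> norm b * norm z" for z using norm_mult_ineq[of z b] by (simp add: mult.commute)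
    then show ?thesis using that ex[of "\<lambda>z. z * b"] b
    by (auto simp: mult_C bounded_linear.linear[OF bounded_linear_mult_left])
  qed
  have 1: "(1 - b) * (1 + z) = 1"
    using z(2) by (simp add: algebra_simps) 
  have 2: "(1 + z') * (1 - b) = 1"
    using z'(2) by (simp add: algebra_simps) 
  have "1 + z = 1 + z'" using 1 2 by (metis mult.assoc mult_1_left mult_1_right)
  then show ?thesis unfolding invertible_in_def using 1 2 z(1) by (metis add_C one_C)
qed

lemma invertible_scaleR_iff:
  assumes "x \<in> C" "r \<noteq> 0"
  shows "invertible_in C (r *\<^sub>R x) \<longleftrightarrow> invertible_in C x"
proof -
  have 1: "invertible_in C (r *\<^sub>R x)" if "invertible_in C x" "r \<noteq> 0" for x r
  proof -
    obtain y where "y \<in> C" "x * y = 1" "y * x = 1" using \<open>invertible_in C x\<close> unfolding invertible_in_def by blast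
    then show ?thesis unfolding invertible_in_def using \<open>r \<noteq> 0\<close>
      by (intro bexI[of _ "(1/r) *\<^sub>R y"]) (auto simp: scaleR_C)
  qed
  show ?thesis using 1[of x r] 1[of "r *\<^sub>R x" "1/r"] assms by auto
qed

lemma invertible_scaleR_one_minus:
  assumes "b \<in> C" "norm b < t"
  shows "invertible_in C (t *\<^sub>R 1 - b)"
proof -
  have t: "t > 0" using assms(2) norm_ge_zero[of b] by linarith
  have "invertible_in C (1 - (1/t) *\<^sub>R b)"
    using assms t by (intro invertible_one_minus) (auto simp: scaleR_C)
  then have "invertible_in C (t *\<^sub>R (1 - (1/t) *\<^sub>R b))"
    using t assms by (subst invertible_scaleR_iff) (auto simp: C_intros)
  then show ?thesis using t by (simp add: algebra_simps)
qed

lemma invertible_mult: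
  assumes "invertible_in C x" "invertible_in C y"
  shows "invertible_in C (x * y)"
proof -
  obtain x' y' where "x' \<in> C" "x * x' = 1" "x' * x = 1" "y' \<in> C" "y * y' = 1" "y' * y = 1"
    using assms unfolding invertible_in_def by blast
  then have "x * y * (y' * x') = 1" "y' * x' * (x * y) = 1" "y' * x' \<in> C"
    by (auto simp: mult_C) (metis mult.assoc mult_1_right mult_1_left)+
  then show ?thesis unfolding invertible_in_def by blast
qed

lemma invertible_factor:
  assumes "x \<in> C" "y \<in> C" "x * y = y * x" "invertible_in C (x * y)"
  shows "invertible_in C x"
proof -
  obtain n where n: "n \<in> C" "x * y * n = 1" "n * (x * y) = 1" using assms unfolding invertible_in_def by blast
  then have "x * (y * n) = 1" "(n * y) * x = 1" using assms(3) by (metis mult.assoc)+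
  moreover from this have "y * n = n * y" by (metis mult.assoc mult_1_left mult_1_right)
  ultimately show ?thesis unfolding invertible_in_def using n(1) assms by (metis mult_C)
qed

lemma sqrt_near_one:
  assumes b: "sa b" and nb: "norm b \<le> 1"
  obtains y where "sa y" "norm y \<le> 1" "(1 - y) * (1 - y) = 1 - b" "\<And>z. z * b = b * z \<Longrightarrow> z * y = y * z"
proof -
  obtain y where lim: "sqrt_iter b \<longlonglongrightarrow> y" using sqrt_iter_convergent[OF nb] convergent_def by blast
  have sai: "sa (sqrt_iter b n)" for n
    by (induction n) (auto simp: b sa_intros)
  have yC: "y \<in> C"
    by (rule closed_sequentially[OF closed_C]) (use sai lim in \<open>auto simp: sa_def\<close>)
  have "(\<lambda>n. norm (sqrt_iter b n - st y)) \<longlonglongrightarrow> 0"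
  proof -
    have "norm (sqrt_iter b n - st y) = norm (sqrt_iter b n - y)" for n
      using norm_st[of "sqrt_iter b n - y"] sai[of n] yC by (simp add: sa_def st_diff diff_C)
    then show ?thesis using lim by (simp add: tendsto_norm_zero LIM_zero)
  qed
  then have "sqrt_iter b \<longlonglongrightarrow> st y" using LIM_zero_cancel tendsto_norm_zero_iff by blast
  then have "sa y" using lim LIMSEQ_unique yC by (auto simp: sa_def)
  moreover have "norm y \<le> 1"
    using norm_sqrt_iter[OF nb] real_sqrt_iter_bounds(2) order_trans
    by (intro LIMSEQ_le_const2[OF tendsto_norm[OF lim]]) blast
  moreover have "y = (1/2) *\<^sub>R (b + y * y)"
  proof -
    have "(\<lambda>n. sqrt_iter b (Suc n)) \<longlonglongrightarrow> (1/2) *\<^sub>R (b + y * y)"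
      unfolding sqrt_iter.simps by (intro tendsto_intros lim)
    then show ?thesis using LIMSEQ_Suc[OF lim] LIMSEQ_unique by blast
  qed
  then have "2 *\<^sub>R y = b + y * y" by (metis scaleR_scaleR scaleR_one mult_2 field_sum_of_halves times_divide_eq_right mult_1_right)
  then have "y + y - y * y = b" by (simp add: scaleR_2)
  then have "(1 - y) * (1 - y) = 1 - b" by (auto simp add: algebra_simps)
  moreover have "z * y = y * z" if "z * b = b * z" for z
  proof (rule LIMSEQ_unique)
    show "(\<lambda>n. z * sqrt_iter b n) \<longlonglongrightarrow> z * y" by (intro tendsto_intros lim)
    show "(\<lambda>n. z * sqrt_iter b n) \<longlonglongrightarrow> y * z" unfolding sqrt_iter_commute[OF that] by (intro tendsto_intros lim)
  qed
  ultimately show ?thesis using that by blast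
qed

text \<open>Positive elements are introduced as squares of self-adjoint elements; the characterisation by the
  spectrum is the lemma \<open>psd_iff_spectrum\<close>.\<close>

definition psd :: "'u \<Rightarrow> bool" where "psd x \<longleftrightarrow> (\<exists>y. sa y \<and> x = y * y)"

lemma psd_square: "sa y \<Longrightarrow> psd (y * y)" by (auto simp: psd_def)

lemma psd_sa: "psd x \<Longrightarrow> sa x" by (auto simp: psd_def sa_square)

lemma psd_C: "psd x \<Longrightarrow> x \<in> C" by (auto dest: psd_sa sa_C)

lemma psd_zero: "psd 0" using psd_square[OF sa_intros(2)] by simp

lemma psd_one: "psd 1" using psd_square[OF sa_intros(1)] by simp

lemma psd_scaleR: assumes "psd x" "r \<ge> 0" shows "psd (r *\<^sub>R x)"
proof -
  obtain y where y: "sa y" "x = y * y" using assms by (auto simp: psd_def)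
  have "r *\<^sub>R x = (sqrt r *\<^sub>R y) * (sqrt r *\<^sub>R y)" using assms by (simp add: y)
  then show ?thesis using psd_square[OF sa_intros(5)[OF y(1)]] by metis
qed

lemma sqrt_of_norm_shift_le:
  assumes x: "sa x" and n: "norm (t *\<^sub>R 1 - x) \<le> t" and t: "t > 0"
  obtains y where "sa y" "norm (sqrt t *\<^sub>R 1 - y) \<le> sqrt t" "y * y = x" "\<And>z. z * x = x * z \<Longrightarrow> z * y = y * z"
proof -
  define b where "b = 1 - (1/t) *\<^sub>R x"
  have b: "sa b" by (simp add: b_def sa_intros x)
  have "b = (1/t) *\<^sub>R (t *\<^sub>R 1 - x)" using t by (simp add: b_def algebra_simps)
  then have "norm b = (1/t) * norm (t *\<^sub>R 1 - x)" using t by simp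
  then have nb: "norm b \<le> 1" using n t by simp
  obtain v where v: "sa v" "norm v \<le> 1" "(1 - v) * (1 - v) = 1 - b" "\<And>z. z * b = b * z \<Longrightarrow> z * v = v * z"
    using sqrt_near_one[OF b nb] by blast
  define y where "y = sqrt t *\<^sub>R (1 - v)"
  have "sa y" by (simp add: y_def sa_intros v)
  moreover have "norm (sqrt t *\<^sub>R 1 - y) \<le> sqrt t"
  proof -
    have "sqrt t *\<^sub>R 1 - y = sqrt t *\<^sub>R v" by (simp add: y_def algebra_simps)
    then have "norm (sqrt t *\<^sub>R 1 - y) = sqrt t * norm v" using t by simp
    then show ?thesis using v(2) t by (simp add: mult_left_le)
  qed
  moreover have "y * y = x"
  proof -
    have "y * y = t *\<^sub>R ((1 - v) * (1 - v))" using t by (simp add: y_def)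
    then show ?thesis unfolding v(3) b_def using t by simp
  qed
  moreover have "z * y = y * z" if "z * x = x * z" for z
  proof -
    have "z * v = v * z" by (rule v(4)) (simp add: b_def algebra_simps that)
    then show ?thesis by (simp add: y_def algebra_simps)
  qed
  ultimately show ?thesis using that by blast
qed

lemma psd_of_norm_shift_le: assumes "sa x" "norm (t *\<^sub>R 1 - x) \<le> t" shows "psd x"
proof (cases "t > 0")
  case True
  then show ?thesis using sqrt_of_norm_shift_le[OF assms] by (metis psd_square)
next
  case False
  then have "t = 0" "norm (t *\<^sub>R 1 - x) = 0" using assms(2) norm_ge_zero[of "t *\<^sub>R 1 - x"] by linarith+
  then show ?thesis using psd_zero by simp
qed

text \<open>Together with \<open>psd_of_norm_shift_le\<close> this describes positivity by the inequality \<open>norm (t - x) \<le> t\<close>,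
  which is visibly stable under sums and limits.  If \<open>x = y\<^sup>2\<close> and \<open>t - x = z\<^sup>2\<close>, then \<open>y\<close> and \<open>z\<close> commute, as \<open>z\<close> is
  a limit of polynomials in \<open>x\<close>, and \<open>y\<^sup>2 + z\<^sup>2 = t\<close> bounds \<open>z\<^sup>2\<close>.\<close>

lemma norm_shift_le_of_psd: assumes "psd x" "norm x \<le> t" shows "norm (t *\<^sub>R 1 - x) \<le> t"
proof (cases "t > 0")
  case True
  obtain y where y: "sa y" "x = y * y" using assms by (auto simp: psd_def)
  have t1: "norm (t *\<^sub>R 1 - (t *\<^sub>R 1 - x)) \<le> t" using assms by simp
  obtain z where z: "sa z" "z * z = t *\<^sub>R 1 - x" "\<And>w. w * (t *\<^sub>R 1 - x) = (t *\<^sub>R 1 - x) * w \<Longrightarrow> w * z = z * w"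
    using sqrt_of_norm_shift_le[OF _ t1 True] sa_intros psd_sa[OF assms(1)] by metis
  have "y * z = z * y" by (rule z(3)) (simp add: y algebra_simps)
  then have "(norm z)\<^sup>2 \<le> norm (z * z + y * y)" by (intro norm_le_sum_squares y z) simp
  also have "z * z + y * y = t *\<^sub>R 1" by (simp add: z(2) y)
  also have "norm (t *\<^sub>R (1::'u)) \<le> t" using True by (intro norm_scaleR_one_le) simp
  finally have "norm (z * z) \<le> t" using z(1) by (simp add: norm_sa_square)
  then show ?thesis by (simp add: z(2))
next
  case False
  then have "t = 0" "norm x = 0" using assms(2) norm_ge_zero[of x] by linarith+
  then show ?thesis by simp
qed

lemma psd_add: assumes "psd x" "psd y" shows "psd (x + y)"
proof (rule psd_of_norm_shift_le)
  show "sa (x + y)" by (intro sa_intros psd_sa assms)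
  have "norm (((norm x) *\<^sub>R 1 - x) + ((norm y) *\<^sub>R 1 - y)) \<le> norm x + norm y"
    by (intro norm_triangle_mono norm_shift_le_of_psd assms order_refl)
  then show "norm ((norm x + norm y) *\<^sub>R 1 - (x + y)) \<le> norm x + norm y"
    by (simp add: algebra_simps)
qed

lemma psd_scaleR_one: "r \<ge> 0 \<Longrightarrow> psd (r *\<^sub>R 1)"
  by (simp add: psd_scaleR psd_one)

lemma psd_sqrt:
  assumes "psd x"
  obtains y where "psd y" "y * y = x" "\<And>z. z * x = x * z \<Longrightarrow> z * y = y * z"
proof -
  have "norm ((norm x + 1) *\<^sub>R 1 - x) \<le> norm x + 1" by (intro norm_shift_le_of_psd assms) simp
  then obtain y where y: "sa y" "norm (sqrt (norm x + 1) *\<^sub>R 1 - y) \<le> sqrt (norm x + 1)" "y * y = x"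
      "\<And>z. z * x = x * z \<Longrightarrow> z * y = y * z"
    using sqrt_of_norm_shift_le[OF psd_sa[OF assms], of "norm x + 1"]
    by (metis norm_ge_zero add_nonneg_pos zero_less_one)
  then show ?thesis using that psd_of_norm_shift_le by blast
qed

lemma psd_norm_minus: assumes "sa x" "norm x \<le> t" shows "psd (t *\<^sub>R 1 - x)" 
  by (rule psd_of_norm_shift_le[where t=t]) (use assms in \<open>auto simp: sa_intros\<close>)

lemma norm_le_norm_add_psd:
  assumes "psd x" "psd y" "x * y = y * x" shows "norm x \<le> norm (x + y)"
proof -
  obtain a where a: "psd a" "a * a = x" "\<And>z. z * x = x * z \<Longrightarrow> z * a = a * z" using psd_sqrt[OF assms(1)] by blast
  obtain b where b: "psd b" "b * b = y" "\<And>z. z * y = y * z \<Longrightarrow> z * b = b * z" using psd_sqrt[OF assms(2)] by blast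
  have "a * b = b * a" using a(3)[of y] b(3)[of a] assms(3) by simp
  then have "(norm a)\<^sup>2 \<le> norm (a * a + b * b)" by (intro norm_le_sum_squares psd_sa a(1) b(1))
  then show ?thesis using norm_sa_square[OF psd_sa[OF a(1)]] a(2) b(2) by simp
qed

lemma psd_antisym: assumes "psd x" "psd (- x)" shows "x = 0"
  using norm_le_norm_add_psd[OF assms] by simp

lemma norm_le_of_psd_diff: assumes "psd x" "psd (t *\<^sub>R 1 - x)" "t \<ge> 0" shows "norm x \<le> t"
proof -
  have "norm x \<le> norm (t *\<^sub>R (1::'u))" using norm_le_norm_add_psd[OF assms(1,2)] by (simp add: algebra_simps)
  also have "\<dots> \<le> t" using assms by (intro norm_scaleR_one_le)
  finally show ?thesis .
qed

lemma psd_limit: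
  assumes "sa a" "\<And>e. e > 0 \<Longrightarrow> psd (a + e *\<^sub>R 1)"
  shows "psd a"
proof (rule psd_of_norm_shift_le[OF assms(1)])
  show "norm ((norm a + 1) *\<^sub>R 1 - a) \<le> norm a + 1"
  proof (rule field_le_epsilon)
    fix e :: real assume "e > 0"
    define d where "d = min e 1"
    have d: "d > 0" "d \<le> 1" "d \<le> e" using \<open>e > 0\<close> by (auto simp: d_def)
    have nd: "norm (d *\<^sub>R (1::'u)) \<le> d" using d by (intro norm_scaleR_one_le) simp
    have "norm (a + d *\<^sub>R 1) \<le> norm a + 1"
      using norm_triangle_ineq[of a "d *\<^sub>R 1"] nd d by linarith
    then have "norm ((norm a + 1) *\<^sub>R 1 - (a + d *\<^sub>R 1)) \<le> norm a + 1"
      by (intro norm_shift_le_of_psd assms d)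
    then have "norm ((norm a + 1) *\<^sub>R 1 - (a + d *\<^sub>R 1) + d *\<^sub>R 1) \<le> norm a + 1 + e"
      using nd d by (intro norm_triangle_mono) linarith+
    then show "norm ((norm a + 1) *\<^sub>R 1 - a) \<le> norm a + 1 + e" by (simp add: algebra_simps)
  qed
qed

lemma sa_inverse:
  assumes "sa x" "n \<in> C" "x * n = 1" "n * x = 1" shows "sa n"
proof -
  have "st n * x = 1" using st_mult[of x n] assms st_one by (auto simp: sa_def)
  then have "st n = n" using assms by (metis mult.assoc mult_1_left mult_1_right)
  then show ?thesis using assms by (simp add: sa_def)
qed

text \<open>An invertible positive element is bounded away from \<open>0\<close>: its inverse \<open>n\<close> is positive and bounded by
  some \<open>m\<close>, and multiplying \<open>m - n \<ge> 0\<close> by \<open>x\<close> gives \<open>m x \<ge> 1\<close>.\<close>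

lemma psd_invertible_lower_bound:
  assumes x: "psd x" and inv: "invertible_in C x"
  obtains d where "d > 0" "psd (x - d *\<^sub>R 1)"
proof -
  obtain y where y: "psd y" "y * y = x" using psd_sqrt[OF x] by blast
  obtain n where n: "n \<in> C" "x * n = 1" "n * x = 1" using inv by (auto simp: invertible_in_def)
  have san: "sa n" by (rule sa_inverse[OF psd_sa[OF x] n])
  have yx: "y * x = x * y" by (simp add: y(2)[symmetric] mult.assoc)
  have yn: "y * n = n * y"
  proof -
    have "y * n = n * (x * y) * n" using n by (simp add: mult.assoc[symmetric])
    also have "\<dots> = n * (y * x) * n" by (simp add: yx)
    also have "\<dots> = n * y" using n by (simp add: mult.assoc)
    finally show ?thesis .
  qed
  define m where "m = norm n + 1"
  have m: "m > 0" by (simp add: m_def add_nonneg_pos)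
  have "psd (m *\<^sub>R 1 - n)" by (rule psd_norm_minus[OF san]) (simp add: m_def)
  then obtain z where z: "psd z" "z * z = m *\<^sub>R 1 - n" "\<And>w. w * (m *\<^sub>R 1 - n) = (m *\<^sub>R 1 - n) * w \<Longrightarrow> w * z = z * w"
    using psd_sqrt by blast
  have yz: "y * z = z * y" by (rule z(3)) (simp add: algebra_simps yn)
  have "(y * z) * (y * z) = (y * y) * (z * z)" by (metis yz mult.assoc)
  also have "\<dots> = m *\<^sub>R x - 1" by (simp add: y z(2) algebra_simps n)
  finally have "psd (m *\<^sub>R x - 1)" using psd_square[of "y * z"] yz y(1) z(1) psd_sa sa_intros(7) by metis
  then have "psd ((1/m) *\<^sub>R (m *\<^sub>R x - 1))" using m by (intro psd_scaleR) auto
  then have "psd (x - (1/m) *\<^sub>R 1)" using m by (simp add: algebra_simps)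
  then show ?thesis using that[of "1/m"] m by simp
qed

text \<open>Consider the least \<open>k\<^sub>0 \<ge> 0\<close> for which \<open>a + k\<^sub>0\<close> is positive.  If it were not \<open>0\<close> then
  \<open>a + k\<^sub>0\<close> would be invertible and positive, hence bounded away from \<open>0\<close>, and \<open>k\<^sub>0\<close> could be decreased.\<close>

lemma psd_if_shifts_invertible:
  assumes a: "sa a" and inv: "\<And>k. k > 0 \<Longrightarrow> invertible_in C (a + k *\<^sub>R 1)"
  shows "psd a"
proof -
  define K where "K = {k. k \<ge> 0 \<and> psd (a + k *\<^sub>R 1)}"
  have nK: "norm a \<in> K" using psd_norm_minus[of "-a" "norm a"] a by (simp add: K_def sa_intros add.commute)
  have bdd: "bdd_below K" by (auto simp: K_def bdd_below_def)
  define k0 where "k0 = Inf K"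
  have k0: "k0 \<ge> 0" unfolding k0_def
  proof (rule cInf_greatest)
    show "K \<noteq> {}" using nK by blast
  qed (simp add: K_def)
  have up: "psd (a + k *\<^sub>R 1)" if k: "k > k0" for k
  proof -
    obtain k' where k': "k' \<in> K" "k' < k" using k cInf_lessD[of K k] nK unfolding k0_def by blast
    have "psd (a + k' *\<^sub>R 1 + (k - k') *\<^sub>R 1)" by (rule psd_add[OF _ psd_scaleR_one]) (use k' in \<open>auto simp: K_def\<close>)
    then show ?thesis by (simp add: algebra_simps)
  qed
  have p0: "psd (a + k0 *\<^sub>R 1)"
  proof (rule psd_limit)
    show "psd (a + k0 *\<^sub>R 1 + e *\<^sub>R 1)" if "e > 0" for e using up[of "k0 + e"] that by (simp add: algebra_simps)
  qed (simp add: sa_intros a)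
  have "k0 = 0"
  proof (rule ccontr)
    assume "k0 \<noteq> 0"
    then have pos: "k0 > 0" using k0 by simp
    then obtain d where d: "d > 0" "psd (a + k0 *\<^sub>R 1 - d *\<^sub>R 1)"
      using psd_invertible_lower_bound[OF p0 inv] by blast
    define e where "e = min d k0"
    have e: "e > 0" "e \<le> d" "e \<le> k0" using d pos by (auto simp: e_def)
    have "psd (a + k0 *\<^sub>R 1 - d *\<^sub>R 1 + (d - e) *\<^sub>R 1)" by (rule psd_add[OF _ psd_scaleR_one]) (use d e in auto)
    then have "k0 - e \<in> K" using e by (simp add: K_def algebra_simps)
    then have "k0 \<le> k0 - e" unfolding k0_def using bdd cInf_lower by blast
    then show False using e by simp
  qed
  then show ?thesis using p0 by simp
qed

lemma psd_shift_invertible: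
  assumes "psd a" "k > 0" shows "invertible_in C (a + k *\<^sub>R 1)"
proof -
  have "invertible_in C ((norm a + k) *\<^sub>R 1 - (norm a *\<^sub>R 1 - a))"
    using norm_shift_le_of_psd[OF assms(1), of "norm a"] assms psd_C[OF assms(1)]
    by (intro invertible_scaleR_one_minus) (auto simp: C_intros)
  then show ?thesis by (simp add: algebra_simps)
qed

text \<open>For non-real \<open>k\<close> and \<open>x = a - Re k\<close> one has \<open>(k - a) (cnj k - a) = x\<^sup>2 + (Im k)\<^sup>2\<close>, which is invertible
  since \<open>x\<^sup>2\<close> is positive.\<close>

lemma psd_resolvent:
  assumes a: "psd a" and k: "k \<notin> \<real>\<^sub>\<ge>\<^sub>0" shows "invertible_in C (k *\<^sub>C 1 - a)"
proof (cases "Im k = 0")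
  case True
  then have r: "Re k < 0" and k: "k = of_real (Re k)" using k by (auto simp: complex_nonneg_Reals_iff complex_eq_iff)
  have "invertible_in C (a + (- Re k) *\<^sub>R 1)" using a r by (intro psd_shift_invertible) auto
  then have "invertible_in C ((-1) *\<^sub>R (a + (- Re k) *\<^sub>R 1))"
    using psd_C[OF a] by (subst invertible_scaleR_iff) (auto simp: C_intros)
  moreover have "k *\<^sub>C 1 = Re k *\<^sub>R (1::'u)" using k scaleR_scaleC by metis
  ultimately show ?thesis by simp
next
  case False
  define x where "x = a - Re k *\<^sub>R 1"
  have sax: "sa x" by (simp add: x_def sa_intros psd_sa[OF a])
  have aC: "a \<in> C" by (rule psd_C[OF a])
  have "invertible_in C (x * x + (Im k)\<^sup>2 *\<^sub>R 1)"
    using False by (intro psd_shift_invertible psd_square sax) auto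
  also have "x * x + (Im k)\<^sup>2 *\<^sub>R 1 = (k *\<^sub>C 1 - a) * (cnj k *\<^sub>C 1 - a)"
  proof -
    have kx: "k *\<^sub>C 1 = Re k *\<^sub>R (1::'u) + Im k *\<^sub>R \<i> *\<^sub>C 1" for k
      by (subst (1) complex_eq) (simp add: scaleC_add_left scaleR_scaleC scaleC_scaleC mult.commute)
    have 1: "k *\<^sub>C 1 - a = Im k *\<^sub>R \<i> *\<^sub>C 1 - x" by (simp add: x_def kx[of k])
    have 2: "cnj k *\<^sub>C 1 - a = - (Im k *\<^sub>R \<i> *\<^sub>C 1) - x" by (simp add: x_def kx[of "cnj k"])
    show ?thesis unfolding 1 2
      by (simp add: algebra_simps scaleC_mult_left scaleC_mult_right scaleC_scaleC scaleC_minus_left power2_eq_square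
          scaleC_scaleR_commute scaleC_diff_right)
  qed
  finally show ?thesis
    by (rule invertible_factor[rotated 3]) (auto simp: C_intros aC algebra_simps scaleC_mult_left scaleC_mult_right scaleC_scaleC mult.commute scaleC_diff_right)
qed

lemma psd_iff_spectrum:
  "psd a \<longleftrightarrow> sa a \<and> (\<forall>k. k \<notin> \<real>\<^sub>\<ge>\<^sub>0 \<longrightarrow> invertible_in C (k *\<^sub>C 1 - a))"
proof
  assume R: "sa a \<and> (\<forall>k. k \<notin> \<real>\<^sub>\<ge>\<^sub>0 \<longrightarrow> invertible_in C (k *\<^sub>C 1 - a))"
  show "psd a"
  proof (rule psd_if_shifts_invertible)
    show "sa a" using R by simp
    fix k :: real assume "k > 0"
    then have "invertible_in C ((- of_real k) *\<^sub>C 1 - a)" using R by (auto simp: complex_nonneg_Reals_iff)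
    then have "invertible_in C ((-1) *\<^sub>R ((- of_real k) *\<^sub>C 1 - a))"
      using R by (subst invertible_scaleR_iff) (auto simp: C_intros sa_def)
    then show "invertible_in C (a + k *\<^sub>R 1)" by (simp add: scaleR_scaleC scaleC_minus_left add.commute)
  qed
qed (auto simp: psd_resolvent psd_sa)

text \<open>Since \<open>c\<^sup>*c + c c\<^sup>*\<close> is twice the sum of the squares of the real and the imaginary part of \<open>c\<close>,
  negativity of \<open>c\<^sup>*c\<close> makes \<open>c c\<^sup>*\<close> positive.  But \<open>c c\<^sup>*\<close> and \<open>c\<^sup>*c\<close> have the same nonzero spectrum, so \<open>c\<^sup>*c\<close> is
  positive as well.\<close>

lemma zero_if_star_mult_negative:
  assumes c: "c \<in> C" and n: "psd (- (st c * c))" shows "c = 0"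
proof -
  define x where "x = (1/2) *\<^sub>R (c + st c)"
  define y where "y = (1/2) *\<^sub>R \<i> *\<^sub>C (st c - c)"
  have sx: "sa x" by (simp add: sa_def x_def C_intros c st_scaleR st_add st_st add.commute)
  have sy: "sa y" by (simp add: sa_def y_def C_intros c st_scaleR st_scaleC st_diff st_st scaleC_minus_left scaleC_diff_right)
  have e: "c * st c = 2 *\<^sub>R (x * x + y * y) + - (st c * c)"
  proof -
    have "x * x = (1/4) *\<^sub>R ((c + st c) * (c + st c))" by (simp add: x_def)
    moreover have "y * y = - ((1/4) *\<^sub>R ((st c - c) * (st c - c)))"
      by (simp add: y_def scaleC_mult_left scaleC_mult_right scaleC_scaleR_commute scaleC_scaleC scaleC_minus_left)
    moreover have "(c + st c) * (c + st c) - (st c - c) * (st c - c) = 2 *\<^sub>R (c * st c + st c * c)"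
      by (simp add: algebra_simps scaleR_2)
    ultimately have "x * x + y * y = (1/4) *\<^sub>R (2 *\<^sub>R (c * st c + st c * c))"
      by (metis add_uminus_conv_diff scaleR_diff_right)
    then show ?thesis by simp
  qed
  have p: "psd (c * st c)" unfolding e by (intro psd_add psd_scaleR psd_square sx sy n) simp
  have sa: "sa (st c * c)" by (simp add: sa_def C_intros c st_mult st_st)
  have "psd (st c * c)"
  proof (rule psd_if_shifts_invertible[OF sa])
    fix k :: real assume k: "k > 0"
    obtain v where v: "v \<in> C" "(c * st c + k *\<^sub>R 1) * v = 1" "v * (c * st c + k *\<^sub>R 1) = 1"
      using psd_shift_invertible[OF p k] by (auto simp: invertible_in_def)
    define X where "X = st c * v * c"
    define W where "W = st c * c"
    define w where "w = (1/k) *\<^sub>R (1 - X)"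
    have cv: "c * (st c * v) = 1 - k *\<^sub>R v" "v * (c * st c) = 1 - k *\<^sub>R v"
      using v(2,3) by (auto simp: algebra_simps)
    have "W * X = st c * (c * (st c * v)) * c" by (simp add: W_def X_def mult.assoc)
    also have "\<dots> = W - k *\<^sub>R X" unfolding cv by (simp add: algebra_simps W_def X_def)
    finally have WX: "W * X = W - k *\<^sub>R X" .
    have "(W + k *\<^sub>R 1) * w = (1/k) *\<^sub>R (W - W * X + k *\<^sub>R 1 - k *\<^sub>R X)"
      by (simp add: w_def algebra_simps)
    then have 1: "(W + k *\<^sub>R 1) * w = 1" using k by (simp add: WX)
    have "X * W = st c * (v * (c * st c)) * c" by (simp add: W_def X_def mult.assoc)
    also have "\<dots> = W - k *\<^sub>R X" unfolding cv by (simp add: algebra_simps W_def X_def)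
    finally have XW: "X * W = W - k *\<^sub>R X" .
    have "w * (W + k *\<^sub>R 1) = (1/k) *\<^sub>R (W - X * W + k *\<^sub>R 1 - k *\<^sub>R X)"
      by (simp add: w_def algebra_simps)
    then have 2: "w * (W + k *\<^sub>R 1) = 1" using k by (simp add: XW)
    show "invertible_in C (st c * c + k *\<^sub>R 1)"
      unfolding invertible_in_def using 1 2
      by (intro bexI[of _ w]) (auto simp: w_def W_def X_def C_intros c v)
  qed
  then have "st c * c = 0" using psd_antisym n by blast
  then show ?thesis using cstar_eq[OF c] by simp
qed

text \<open>Put \<open>w = z\<^sup>*z\<close>, \<open>m = (w\<^sup>2)\<^sup>1\<^sup>/\<^sup>2\<close> and \<open>v = m - w\<close>, twice the negative part of \<open>w\<close>.  Then \<open>w v = - m v\<close>, hence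
  \<open>(z v)\<^sup>*(z v) = v w v = - v m v \<le> 0\<close> and \<open>z v = 0\<close> by the preceding lemma.  It follows that \<open>v = 0\<close>, that is, \<open>w = m\<close>.\<close>

lemma psd_star_mult: assumes z: "z \<in> C" shows "psd (st z * z)"
proof -
  define w where "w = st z * z"
  have w: "sa w" by (simp add: sa_def w_def C_intros z st_mult st_st)
  obtain m where m: "psd m" "m * m = w * w" "\<And>v. v * (w * w) = w * w * v \<Longrightarrow> v * m = m * v"
    using psd_sqrt[OF psd_square[OF w]] by blast
  have wm: "w * m = m * w" by (rule m(3)) (simp add: mult.assoc)
  obtain r where r: "psd r" "r * r = m" "\<And>v. v * m = m * v \<Longrightarrow> v * r = r * v" using psd_sqrt[OF m(1)] by blast
  have wr: "w * r = r * w" by (rule r(3)[OF wm])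
  have rm: "r * m = m * r" by (simp add: r(2)[symmetric] mult.assoc)
  define v where "v = m - w"
  have v: "sa v" by (simp add: v_def sa_intros psd_sa m(1) w)
  have rv: "r * v = v * r" by (simp add: v_def algebra_simps wr rm)
  have wv: "w * v = - (m * v)" by (simp add: v_def algebra_simps m(2) wm)
  define c where "c = z * v"
  have cC: "c \<in> C" using v z by (simp add: c_def sa_def C_intros)
  have "st c * c = v * w * v" using v z by (simp add: c_def sa_def st_mult w_def mult.assoc C_intros)
  also have "\<dots> = - (v * m * v)" using wv by (simp add: mult.assoc)
  also have "v * m * v = (r * v) * (r * v)"
    by (metis r(2) rv mult.assoc)
  finally have "- (st c * c) = (r * v) * (r * v)" by simp
  then have "psd (- (st c * c))" using psd_square[of "r * v"] rv r(1) v psd_sa sa_intros(7) by metis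
  then have "c = 0" by (rule zero_if_star_mult_negative[OF cC])
  then have "w * v = 0" by (simp add: w_def c_def mult.assoc)
  then have "m * v = 0" using wv by simp
  then have "v * v = 0" using \<open>w * v = 0\<close> by (simp add: v_def algebra_simps)
  then have "v = 0" using norm_sa_square[OF v] by simp
  then have "w = m" by (simp add: v_def)
  then show ?thesis using m(1) by (simp add: w_def)
qed

lemma psd_conj: assumes "psd x" "b \<in> C" shows "psd (st b * x * b)"
proof -
  obtain y where y: "sa y" "x = y * y" using assms by (auto simp: psd_def)
  have "psd (st (y * b) * (y * b))" using y assms by (intro psd_star_mult) (auto simp: C_intros sa_def)
  then show ?thesis using y assms by (simp add: st_mult sa_def mult.assoc)
qed

text \<open>The root \<open>r\<close> obtained from the iteration commutes with any other root \<open>s\<close>, because \<open>s\<close> commutes with \<open>s\<^sup>2\<close>.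
  With \<open>u = r - s\<close>, \<open>r = a\<^sup>2\<close> and \<open>s = b\<^sup>2\<close> everything commutes, and \<open>(a u)\<^sup>2 + (b u)\<^sup>2 = u (r\<^sup>2 - s\<^sup>2) = 0\<close>
  makes both squares vanish.\<close>

lemma psd_sqrt_unique:
  assumes s: "psd s" and t: "psd t" and st: "s * s = t * t" shows "s = t"
proof -
  obtain r where r: "psd r" "r * r = s * s" "\<And>z. z * (s * s) = s * s * z \<Longrightarrow> z * r = r * z"
    using psd_sqrt[OF psd_square[OF psd_sa[OF s]]] by blast
  have "r = s" if s: "psd s" and rs: "r * r = s * s" "r * s = s * r" for s
  proof -
    obtain a where a: "psd a" "a * a = r" "\<And>z. z * r = r * z \<Longrightarrow> z * a = a * z" using psd_sqrt[OF r(1)] by blast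
    obtain b where b: "psd b" "b * b = s" "\<And>z. z * s = s * z \<Longrightarrow> z * b = b * z" using psd_sqrt[OF s] by blast
    define u where "u = r - s"
    have u: "sa u" by (simp add: u_def sa_intros psd_sa r s)
    have ua: "u * a = a * u" by (rule a(3)) (simp add: u_def algebra_simps rs)
    have ub: "u * b = b * u" by (rule b(3)) (simp add: u_def algebra_simps rs)
    have "s * a = a * s" by (rule a(3)) (simp add: rs)
    then have ab: "a * b = b * a" by (intro b(3)) simp
    have sau: "sa (a * u)" "sa (b * u)" using ua ub u a(1) b(1) psd_sa sa_intros(7) by metis+
    have square_mult: "(x * y) * (x * y) = (x * x) * (y * y)" if "y * x = x * y" for x y :: 'u
      by (metis that mult.assoc)
    have "(r + s) * u = 0" by (simp add: u_def algebra_simps rs)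
    then have "r * (u * u) + s * (u * u) = 0" by (metis distrib_right mult.assoc mult_zero_left)
    then have z: "(a * u) * (a * u) + (b * u) * (b * u) = 0"
      by (simp add: square_mult[OF ua] square_mult[OF ub] a(2) b(2))
    have "(a * u) * (b * u) = a * (u * b) * u" by (simp add: mult.assoc)
    also have "\<dots> = (a * b) * (u * u)" by (simp add: ub mult.assoc)
    finally have abu: "(a * u) * (b * u) = (a * b) * (u * u)" .
    have "(b * u) * (a * u) = b * (u * a) * u" by (simp add: mult.assoc)
    also have "\<dots> = (b * a) * (u * u)" by (simp add: ua mult.assoc)
    finally have "(a * u) * (b * u) = (b * u) * (a * u)" using abu ab by simp
    then have "a * u = 0" "b * u = 0"
      using norm_le_sum_squares[OF sau] norm_le_sum_squares[OF sau(2,1)] z by (simp_all add: add.commute)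
    then have "r * u = 0" "s * u = 0" using a(2) b(2) by (metis mult.assoc mult_zero_right)+
    then have "u * u = 0" by (simp add: u_def algebra_simps)
    then have "u = 0" using norm_sa_square[OF u] by simp
    then show ?thesis by (simp add: u_def)
  qed
  moreover have "r * s = s * r" using r(3)[of s] by (simp add: mult.assoc)
  moreover have "r * t = t * r" using r(3)[of t] by (simp add: st mult.assoc)
  ultimately show ?thesis using s t r(2) st by metis
qed

end

section \<open>Bounded complex linear operators and represented \<open>*\<close>-algebras\<close>

text \<open>A type of its own, rather than bounded linear maps with composition, so that the operators form an
  instance of the Banach algebra class.\<close>

typedef (overloaded) 'x bop = "{f :: 'x::complex_banach \<Rightarrow>\<^sub>L 'x. \<forall>k x. blinfun_apply f (k *\<^sub>C x) = k *\<^sub>C blinfun_apply f x}"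
  morphisms blinfun_of_bop Abs_bop
  by (rule exI[of _ 0]) simp

setup_lifting type_definition_bop

instantiation bop :: (complex_banach) real_normed_vector
begin

lift_definition plus_bop :: "'a bop \<Rightarrow> 'a bop \<Rightarrow> 'a bop" is "(+)"
  by (simp add: blinfun.bilinear_simps scaleC_add_right)
lift_definition minus_bop :: "'a bop \<Rightarrow> 'a bop \<Rightarrow> 'a bop" is "(-)"
  by (simp add: blinfun.bilinear_simps scaleC_diff_right)
lift_definition uminus_bop :: "'a bop \<Rightarrow> 'a bop" is "uminus"
  by (simp add: blinfun.bilinear_simps scaleC_minus_right)
lift_definition zero_bop :: "'a bop" is "0" by simp
lift_definition scaleR_bop :: "real \<Rightarrow> 'a bop \<Rightarrow> 'a bop" is "scaleR"
  by (simp add: blinfun.bilinear_simps scaleC_scaleR_commute)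
lift_definition norm_bop :: "'a bop \<Rightarrow> real" is "norm" .

definition dist_bop :: "'a bop \<Rightarrow> 'a bop \<Rightarrow> real" where "dist_bop x y = norm (x - y)"
definition sgn_bop :: "'a bop \<Rightarrow> 'a bop" where "sgn_bop x = inverse (norm x) *\<^sub>R x"
definition [code del]:
  "(uniformity :: ('a bop \<times> 'a bop) filter) = (INF e\<in>{0 <..}. principal {(x, y). dist x y < e})"
definition open_bop :: "'a bop set \<Rightarrow> bool"
  where [code del]: "open_bop S = (\<forall>x\<in>S. \<forall>\<^sub>F (x', y) in uniformity. x' = x \<longrightarrow> y \<in> S)"

lemma bop_eqI: "(\<And>x. blinfun_apply (blinfun_of_bop f) x = blinfun_apply (blinfun_of_bop g) x) \<Longrightarrow> f = g"
  by (metis blinfun_eqI blinfun_of_bop_inject)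

lemmas bop_rep_eqs = plus_bop.rep_eq minus_bop.rep_eq uminus_bop.rep_eq zero_bop.rep_eq
  scaleR_bop.rep_eq blinfun.bilinear_simps

instance
proof
  fix x y z :: "'a bop" and a b :: real
  show "x + y + z = x + (y + z)" "x + y = y + x" "0 + x = x" "- x + x = 0" "x - y = x + - y"
    by (rule bop_eqI; simp add: bop_rep_eqs)+
  show "a *\<^sub>R (x + y) = a *\<^sub>R x + a *\<^sub>R y" "(a + b) *\<^sub>R x = a *\<^sub>R x + b *\<^sub>R x" "a *\<^sub>R b *\<^sub>R x = (a * b) *\<^sub>R x" "1 *\<^sub>R x = x"
    by (rule bop_eqI; simp add: bop_rep_eqs algebra_simps)+
  show "dist x y = norm (x - y)" "sgn x = inverse (norm x) *\<^sub>R x"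
    "(uniformity :: ('a bop \<times> 'a bop) filter) = (INF e\<in>{0 <..}. principal {(x, y). dist x y < e})"
    by (simp_all add: dist_bop_def sgn_bop_def uniformity_bop_def)
  show "open U = (\<forall>x\<in>U. \<forall>\<^sub>F (x', y) in uniformity. x' = x \<longrightarrow> y \<in> U)" for U :: "'a bop set"
    by (simp add: open_bop_def)
  show "(norm x = 0) = (x = 0)"
    by (simp add: norm_bop.rep_eq zero_bop.rep_eq[symmetric] blinfun_of_bop_inject)
  show "norm (x + y) \<le> norm x + norm y" "norm (a *\<^sub>R x) = \<bar>a\<bar> * norm x"
    by (simp_all add: norm_bop.rep_eq bop_rep_eqs norm_triangle_ineq)
qed

end

lemma blinfun_of_bop_scaleC: "blinfun_apply (blinfun_of_bop f) (k *\<^sub>C x) = k *\<^sub>C blinfun_apply (blinfun_of_bop f) x"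
  using blinfun_of_bop[of f] by simp

instance bop :: (complex_banach) banach
proof
  fix X :: "nat \<Rightarrow> 'a bop"
  assume "Cauchy X"
  have d: "dist (X m) (X n) = dist (blinfun_of_bop (X m)) (blinfun_of_bop (X n))" for m n
    by (simp add: dist_bop_def dist_norm norm_bop.rep_eq minus_bop.rep_eq)
  have "Cauchy (\<lambda>n. blinfun_of_bop (X n))" using \<open>Cauchy X\<close> unfolding Cauchy_def d .
  then obtain L where L: "(\<lambda>n. blinfun_of_bop (X n)) \<longlonglongrightarrow> L" using Cauchy_convergent convergent_def by blast
  have "blinfun_apply L (k *\<^sub>C x) = k *\<^sub>C blinfun_apply L x" for k x
  proof (rule LIMSEQ_unique)
    show "(\<lambda>n. blinfun_apply (blinfun_of_bop (X n)) (k *\<^sub>C x)) \<longlonglongrightarrow> blinfun_apply L (k *\<^sub>C x)"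
      by (intro tendsto_intros L)
    show "(\<lambda>n. blinfun_apply (blinfun_of_bop (X n)) (k *\<^sub>C x)) \<longlonglongrightarrow> k *\<^sub>C blinfun_apply L x"
      unfolding blinfun_of_bop_scaleC
      by (intro bounded_linear.tendsto[OF bounded_linear_scaleC_right] tendsto_intros L)
  qed
  then have r: "blinfun_of_bop (Abs_bop L) = L" by (simp add: Abs_bop_inverse)
  have "dist (X n) (Abs_bop L) = dist (blinfun_of_bop (X n)) L" for n
    by (simp add: dist_bop_def dist_norm norm_bop.rep_eq minus_bop.rep_eq r)
  then have "X \<longlonglongrightarrow> Abs_bop L" using L unfolding tendsto_iff by simp
  then show "convergent X" using convergent_def by blast
qed

instantiation bop :: (complex_banach) complex_banach_algebra_1
begin

lift_definition one_bop :: "'a bop" is "id_blinfun" by simp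
lift_definition times_bop :: "'a bop \<Rightarrow> 'a bop \<Rightarrow> 'a bop" is "(o\<^sub>L)" by simp
lift_definition scaleC_bop :: "complex \<Rightarrow> 'a bop \<Rightarrow> 'a bop"
  is "\<lambda>k f. Blinfun (\<lambda>x. k *\<^sub>C blinfun_apply f x)"
  by (subst (1 2) bounded_linear_Blinfun_apply)
    (auto intro: bounded_linear_compose[OF bounded_linear_scaleC_right] blinfun.bounded_linear_right
      simp: scaleC_scaleC mult.commute)

lemma scaleC_bop_apply:
  "blinfun_apply (blinfun_of_bop (k *\<^sub>C f)) x = k *\<^sub>C blinfun_apply (blinfun_of_bop f) x"
  unfolding scaleC_bop.rep_eq
  by (subst bounded_linear_Blinfun_apply)
    (auto intro: bounded_linear_compose[OF bounded_linear_scaleC_right] blinfun.bounded_linear_right)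

lemmas bop_algebra_rep_eqs = bop_rep_eqs one_bop.rep_eq times_bop.rep_eq scaleC_bop_apply blinfun_apply_blinfun_compose

lemma norm_scaleC_bop: "norm (k *\<^sub>C f) = cmod k * norm (f :: 'a bop)"
proof -
  have le: "norm (k *\<^sub>C f) \<le> cmod k * norm f" for k and f :: "'a bop"
    unfolding norm_bop.rep_eq
  proof (rule norm_blinfun_bound)
    show "norm (blinfun_apply (blinfun_of_bop (k *\<^sub>C f)) x) \<le> cmod k * norm (blinfun_of_bop f) * norm x" for x
      using norm_blinfun[of "blinfun_of_bop f" x]
      by (simp add: scaleC_bop_apply norm_scaleC mult.assoc mult_left_mono)
  qed simp
  show ?thesis
  proof (cases "k = 0")
    case False
    have "f = inverse k *\<^sub>C k *\<^sub>C f" by (rule bop_eqI) (simp add: scaleC_bop_apply scaleC_scaleC False)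
    then have "norm f \<le> cmod (inverse k) * norm (k *\<^sub>C f)" using le[of "inverse k" "k *\<^sub>C f"] by simp
    then have "cmod k * norm f \<le> norm (k *\<^sub>C f)" using False by (simp add: norm_inverse norm_divide field_simps)
    then show ?thesis using le[of k f] by simp
  next
    case True
    then show ?thesis using le[of k f] norm_blinfun by (simp add: norm_bop.rep_eq antisym)
  qed
qed

instance
proof
  fix x y z :: "'a bop" and a b :: real and k l :: complex
  show "k *\<^sub>C (x + y) = k *\<^sub>C x + k *\<^sub>C y" "(k + l) *\<^sub>C x = k *\<^sub>C x + l *\<^sub>C x" "k *\<^sub>C l *\<^sub>C x = (k * l) *\<^sub>C x"
    "a *\<^sub>R x = complex_of_real a *\<^sub>C x"
    by (rule bop_eqI; simp add: bop_algebra_rep_eqs scaleC_add_right scaleC_add_left scaleC_scaleC scaleR_scaleC)+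
  show "x * y * z = x * (y * z)" "(x + y) * z = x * z + y * z" "x * (y + z) = x * y + x * z" "1 * x = x" "x * 1 = x"
    "(a *\<^sub>R x) * y = a *\<^sub>R (x * y)" "x * (a *\<^sub>R y) = a *\<^sub>R (x * y)"
    "(k *\<^sub>C x) * y = k *\<^sub>C (x * y)" "x * (k *\<^sub>C y) = k *\<^sub>C (x * y)"
    by (rule bop_eqI; simp add: bop_algebra_rep_eqs blinfun_of_bop_scaleC)+
  show "norm (x * y) \<le> norm x * norm y"
    by (simp add: norm_bop.rep_eq bop_algebra_rep_eqs norm_blinfun_compose)
  show "norm (k *\<^sub>C x) = cmod k * norm x" by (rule norm_scaleC_bop)
  show "norm (1 :: 'a bop) \<le> 1"
    by (simp add: norm_bop.rep_eq one_bop.rep_eq norm_blinfun_id_le)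
qed

end

abbreviation bop_apply :: "'x::complex_banach bop \<Rightarrow> 'x \<Rightarrow> 'x" where
  "bop_apply f \<equiv> blinfun_apply (blinfun_of_bop f)"

lemma bop_apply_simps:
  "bop_apply (f + g) x = bop_apply f x + bop_apply g x"
  "bop_apply (f - g) x = bop_apply f x - bop_apply g x"
  "bop_apply (f * g) x = bop_apply f (bop_apply g x)"
  "bop_apply (k *\<^sub>C f) x = k *\<^sub>C bop_apply f x"
  "bop_apply 1 x = x" "bop_apply 0 x = 0"
  by (simp_all add: bop_algebra_rep_eqs)

lemma norm_bop_apply_le: "norm (bop_apply f x) \<le> norm f * norm x"
  unfolding norm_bop.rep_eq by (rule norm_blinfun)

lemma norm_bop_le: "0 \<le> b \<Longrightarrow> (\<And>x. norm (bop_apply f x) \<le> b * norm x) \<Longrightarrow> norm f \<le> b"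
  unfolding norm_bop.rep_eq by (rule norm_blinfun_bound)

lemma bop_apply_Abs:
  assumes "bounded_linear f" "\<And>k x. f (k *\<^sub>C x) = k *\<^sub>C f x"
  shows "bop_apply (Abs_bop (Blinfun f)) = f"
  using assms by (simp add: Abs_bop_inverse bounded_linear_Blinfun_apply)

lemma tendsto_bop_apply: "(F \<longlongrightarrow> f) A \<Longrightarrow> ((\<lambda>n. bop_apply (F n) x) \<longlongrightarrow> bop_apply f x) A"
proof -
  assume "(F \<longlongrightarrow> f) A"
  then have "((\<lambda>n. norm (F n - f) * norm x) \<longlongrightarrow> 0) A"
    by (intro tendsto_mult_left_zero tendsto_norm_zero LIM_zero)
  then have "((\<lambda>n. bop_apply (F n) x - bop_apply f x) \<longlongrightarrow> 0) A"
    by (rule Lim_null_comparison[rotated])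
      (simp add: bop_apply_simps(2)[symmetric] norm_bop_apply_le del: bop_apply_simps(2))
  then show ?thesis by (rule LIM_zero_cancel)
qed

text \<open>A record \<open>R\<close> without a norm is identified with a closed \<open>C\<^sup>*\<close>-subalgebra of a Banach algebra.  The
  lemmas \<open>positive_iff\<close>, \<open>pos_sqrt_eqI\<close> and \<open>pos_sqrt_rep\<close> below transport the positivity and the square roots of \<open>R\<close>,
  which are defined by the spectrum and by a definite description.\<close>

locale cstar_rep =
  fixes R :: "'r star_algebra" (structure) and rep :: "'r \<Rightarrow> 'u::complex_banach_algebra_1"
  assumes inj_rep: "inj_on rep (carrier R)"
    and closed_rep: "closed (rep ` carrier R)"
    and carrier_intros:
      "\<zero> \<in> carrier R" "\<one> \<in> carrier R"
      "x \<in> carrier R \<Longrightarrow> y \<in> carrier R \<Longrightarrow> x \<oplus> y \<in> carrier R"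
      "x \<in> carrier R \<Longrightarrow> y \<in> carrier R \<Longrightarrow> x \<otimes> y \<in> carrier R"
      "x \<in> carrier R \<Longrightarrow> k \<odot> x \<in> carrier R"
      "x \<in> carrier R \<Longrightarrow> invol R x \<in> carrier R"
    and rep_hom:
      "rep \<zero> = 0" "rep \<one> = 1"
      "x \<in> carrier R \<Longrightarrow> y \<in> carrier R \<Longrightarrow> rep (x \<oplus> y) = rep x + rep y"
      "x \<in> carrier R \<Longrightarrow> y \<in> carrier R \<Longrightarrow> rep (x \<otimes> y) = rep x * rep y"
      "x \<in> carrier R \<Longrightarrow> rep (k \<odot> x) = k *\<^sub>C rep x"
    and invol:
      "x \<in> carrier R \<Longrightarrow> invol R (invol R x) = x"
      "x \<in> carrier R \<Longrightarrow> y \<in> carrier R \<Longrightarrow> invol R (x \<oplus> y) = invol R x \<oplus> invol R y"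
      "x \<in> carrier R \<Longrightarrow> y \<in> carrier R \<Longrightarrow> invol R (x \<otimes> y) = invol R y \<otimes> invol R x"
      "x \<in> carrier R \<Longrightarrow> invol R (k \<odot> x) = cnj k \<odot> invol R x"
    and cstar_rep: "x \<in> carrier R \<Longrightarrow> (norm (rep x))\<^sup>2 \<le> norm (rep (invol R x) * rep x)"
begin

definition unrep :: "'u \<Rightarrow> 'r" where "unrep = inv_into (carrier R) rep"

definition rep_star :: "'u \<Rightarrow> 'u" where "rep_star u = rep (invol R (unrep u))"

lemma unrep_rep: "x \<in> carrier R \<Longrightarrow> unrep (rep x) = x"
  by (simp add: unrep_def inj_rep)

lemma rep_unrep: "u \<in> rep ` carrier R \<Longrightarrow> rep (unrep u) = u" "u \<in> rep ` carrier R \<Longrightarrow> unrep u \<in> carrier R"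
  by (auto simp: unrep_rep)

lemma rep_eq_iff: "x \<in> carrier R \<Longrightarrow> y \<in> carrier R \<Longrightarrow> rep x = rep y \<longleftrightarrow> x = y"
  by (meson inj_onD inj_rep)

lemma rep_star_rep: "x \<in> carrier R \<Longrightarrow> rep_star (rep x) = rep (invol R x)"
  by (simp add: rep_star_def unrep_rep)

sublocale unital_cstar "rep ` carrier R" rep_star
proof
  show "closed (rep ` carrier R)" by (rule closed_rep)
  show "1 \<in> rep ` carrier R" using rep_hom(2) carrier_intros(2) by (metis imageI)
  fix u v and k :: complex
  assume "u \<in> rep ` carrier R"
  then obtain x where x: "x \<in> carrier R" "u = rep x" by auto
  show "k *\<^sub>C u \<in> rep ` carrier R" using x by (metis rep_hom(5) carrier_intros(5) imageI)
  show "rep_star u \<in> rep ` carrier R" using x by (simp add: rep_star_rep carrier_intros)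
  show "rep_star (rep_star u) = u" using x by (simp add: rep_star_rep carrier_intros invol)
  show "rep_star (k *\<^sub>C u) = cnj k *\<^sub>C rep_star u"
    using x by (simp add: rep_star_rep carrier_intros invol rep_hom flip: rep_hom(5))
  show "(norm u)\<^sup>2 \<le> norm (rep_star u * u)" using x by (simp add: rep_star_rep cstar_rep)
  assume "v \<in> rep ` carrier R"
  then obtain y where y: "y \<in> carrier R" "v = rep y" by auto
  show "u + v \<in> rep ` carrier R" using x y by (metis rep_hom(3) carrier_intros(3) imageI)
  show "u * v \<in> rep ` carrier R" using x y by (metis rep_hom(4) carrier_intros(4) imageI)
  show "rep_star (u + v) = rep_star u + rep_star v"
    using rep_star_rep[of "x \<oplus> y"] x y by (simp add: rep_star_rep carrier_intros invol rep_hom)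
  show "rep_star (u * v) = rep_star v * rep_star u"
    using rep_star_rep[of "x \<otimes> y"] x y by (simp add: rep_star_rep carrier_intros invol rep_hom)
qed

lemma rep_mem: "x \<in> carrier R \<Longrightarrow> rep x \<in> rep ` carrier R" by simp

lemma a_inv_eq: assumes y: "y \<in> carrier R" shows "\<ominus> y = (-1) \<odot> y"
  unfolding a_inv_def m_inv_def
proof (rule the_equality)
  have m: "rep ((-1) \<odot> y) = - rep y" using y by (simp add: rep_hom scaleC_minus_left)
  have "y \<oplus> ((-1) \<odot> y) = \<zero>" "((-1) \<odot> y) \<oplus> y = \<zero>"
    using y by (subst rep_eq_iff[symmetric]; simp add: carrier_intros rep_hom(1,3) m)+
  then show "(-1) \<odot> y \<in> carrier (add_monoid R) \<and> y \<otimes>\<^bsub>add_monoid R\<^esub> ((-1) \<odot> y) = \<one>\<^bsub>add_monoid R\<^esub> \<and>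
    ((-1) \<odot> y) \<otimes>\<^bsub>add_monoid R\<^esub> y = \<one>\<^bsub>add_monoid R\<^esub>"
    using y by (simp add: carrier_intros)
  fix z assume "z \<in> carrier (add_monoid R) \<and> y \<otimes>\<^bsub>add_monoid R\<^esub> z = \<one>\<^bsub>add_monoid R\<^esub> \<and> z \<otimes>\<^bsub>add_monoid R\<^esub> y = \<one>\<^bsub>add_monoid R\<^esub>"
  then have z: "z \<in> carrier R" "y \<oplus> z = \<zero>" by auto
  then have "rep y + rep z = 0" using y by (metis rep_hom(1,3))
  then have "rep z = - rep y" by (simp add: eq_neg_iff_add_eq_0 add.commute)
  then have "rep z = rep ((-1) \<odot> y)" by (simp only: m)
  then show "z = (-1) \<odot> y" using z y by (simp add: rep_eq_iff carrier_intros)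
qed

lemma minus_closed: "x \<in> carrier R \<Longrightarrow> y \<in> carrier R \<Longrightarrow> x \<ominus> y \<in> carrier R"
  by (simp add: a_minus_def a_inv_eq carrier_intros)

lemma rep_minus: "x \<in> carrier R \<Longrightarrow> y \<in> carrier R \<Longrightarrow> rep (x \<ominus> y) = rep x - rep y"
  by (simp add: a_minus_def a_inv_eq carrier_intros rep_hom scaleC_minus_left)

lemma Units_iff: "x \<in> Units R \<longleftrightarrow> x \<in> carrier R \<and> invertible_in (rep ` carrier R) (rep x)"
proof -
  have "(y \<otimes> x = \<one>) \<longleftrightarrow> rep y * rep x = 1" if "x \<in> carrier R" "y \<in> carrier R" for x y
    using that rep_eq_iff[of "y \<otimes> x" "\<one>"] by (simp add: carrier_intros rep_hom)
  then show ?thesis by (auto simp: Units_def invertible_in_def)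
qed

lemma inv_rep:
  assumes "x \<in> Units R"
  shows "inv x \<in> carrier R" "rep (inv x) * rep x = 1" "rep x * rep (inv x) = 1"
proof -
  obtain y where x: "x \<in> carrier R" and y: "y \<in> carrier R" "y \<otimes> x = \<one>" "x \<otimes> y = \<one>" using assms by (auto simp: Units_def)
  have ry: "rep y * rep x = 1" "rep x * rep y = 1" using x y by (metis rep_hom(2,4))+
  have "inv x = y" unfolding m_inv_def
  proof (rule the_equality)
    fix z assume z: "z \<in> carrier R \<and> x \<otimes> z = \<one> \<and> z \<otimes> x = \<one>"
    then have "rep x * rep z = 1" using x by (metis rep_hom(2,4))
    then have "rep z = rep y" using ry by (metis mult.assoc mult_1_left mult_1_right)
    then show "z = y" using z y by (simp add: rep_eq_iff)
  qed (use y in auto)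
  then show "inv x \<in> carrier R" "rep (inv x) * rep x = 1" "rep x * rep (inv x) = 1"
    using y ry by auto
qed

lemma positive_iff: "positive R x \<longleftrightarrow> x \<in> carrier R \<and> psd (rep x)"
proof (cases "x \<in> carrier R")
  case True
  have "k \<in> spectrum R x \<longleftrightarrow> \<not> invertible_in (rep ` carrier R) (k *\<^sub>C 1 - rep x)" for k
    using True by (simp add: spectrum_def Units_iff minus_closed carrier_intros rep_minus rep_hom)
  then have "spectrum R x \<subseteq> \<real>\<^sub>\<ge>\<^sub>0 \<longleftrightarrow> (\<forall>k. k \<notin> \<real>\<^sub>\<ge>\<^sub>0 \<longrightarrow> invertible_in (rep ` carrier R) (k *\<^sub>C 1 - rep x))"
    by blast
  moreover have "invol R x = x \<longleftrightarrow> sa (rep x)"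
    using True by (simp add: sa_def rep_star_rep rep_eq_iff carrier_intros)
  ultimately show ?thesis using True by (simp add: positive_def psd_iff_spectrum)
qed (simp add: positive_def)

lemma pos_sqrt_eqI:
  assumes "positive R s" "s \<otimes> s = a" shows "pos_sqrt R a = s"
  unfolding pos_sqrt_def
proof (rule the_equality)
  fix t assume t: "positive R t \<and> t \<otimes> t = a"
  then have "rep t * rep t = rep s * rep s" using assms by (metis positive_iff rep_hom(4))
  then have "rep t = rep s" using psd_sqrt_unique t assms positive_iff by blast
  then show "t = s" using t assms by (simp add: rep_eq_iff positive_iff)
qed (use assms in auto)

lemma pos_sqrt_rep:
  assumes a: "a \<in> carrier R" "psd (rep a)"
  shows "pos_sqrt R a \<in> carrier R" "psd (rep (pos_sqrt R a))" "rep (pos_sqrt R a) * rep (pos_sqrt R a) = rep a"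
    "pos_sqrt R a \<otimes> pos_sqrt R a = a"
proof -
  obtain u where u: "psd u" "u * u = rep a" using psd_sqrt[OF a(2)] by blast
  define s where "s = unrep u"
  have s: "s \<in> carrier R" "rep s = u" using rep_unrep[OF psd_C[OF u(1)]] by (auto simp: s_def)
  have ss: "s \<otimes> s = a" using s u(2) a by (subst rep_eq_iff[symmetric]) (auto simp: carrier_intros rep_hom)
  have "positive R s" using s u by (simp add: positive_iff)
  then have "pos_sqrt R a = s" using ss by (rule pos_sqrt_eqI)
  then show "pos_sqrt R a \<in> carrier R" "psd (rep (pos_sqrt R a))" "rep (pos_sqrt R a) * rep (pos_sqrt R a) = rep a"
    "pos_sqrt R a \<otimes> pos_sqrt R a = a" using s u ss by auto
qed

end

section \<open>The unitization and the Cauchy--Schwarz inequality\<close>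

lemma norm_star: "norm (star x) = norm (x::'a::cstar_algebra)"
proof -
  have "norm x \<le> norm (star x)" for x :: 'a
  proof (cases "norm x = 0")
    case False
    have "norm x * norm x \<le> norm (star x) * norm x"
      using norm_mult_ineq[of "star x" x] by (simp add: power2_eq_square cstar_identity)
    then show ?thesis using False by simp
  qed auto
  from this[of x] this[of "star x"] show ?thesis by (simp add: star_star)
qed

definition left_mult :: "'a::cstar_algebra \<Rightarrow> 'a bop" where
  "left_mult a = Abs_bop (Blinfun ((*) a))"

lemma left_mult_apply [simp]: "bop_apply (left_mult a) b = a * b"
  unfolding left_mult_def by (subst bop_apply_Abs) (auto intro: bounded_linear_mult_right simp: mult_scaleC_right)

lemma left_mult_simps:
  "left_mult (a + b) = left_mult a + left_mult b"
  "left_mult (a - b) = left_mult a - left_mult b"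
  "left_mult (a * b) = left_mult a * left_mult b"
  "left_mult (k *\<^sub>C a) = k *\<^sub>C left_mult a"
  "left_mult 0 = 0"
  by (rule bop_eqI; simp add: bop_apply_simps algebra_simps mult_scaleC_left)+

lemma norm_left_mult: "norm (left_mult a) = norm a"
proof (rule antisym)
  show "norm (left_mult a) \<le> norm a" by (rule norm_bop_le) (auto simp: norm_mult_ineq)
  have "(norm a)\<^sup>2 = norm (a * star a)" using cstar_identity[of "star a"] by (simp add: star_star norm_star)
  also have "\<dots> \<le> norm (left_mult a) * norm a" using norm_bop_apply_le[of "left_mult a" "star a"] by (simp add: norm_star)
  finally show "norm a \<le> norm (left_mult a)" by (cases "norm a = 0") (auto simp: power2_eq_square)
qed

lemma inj_left_mult: "left_mult a = left_mult b \<longleftrightarrow> a = b"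
  by (metis left_mult_simps(2) norm_left_mult norm_eq_zero right_minus_eq)

lemma bounded_linear_left_mult: "bounded_linear left_mult"
  by (rule bounded_linear_intro[where K=1])
    (auto simp: left_mult_simps norm_left_mult scaleR_scaleC)

lemma closed_range_left_mult: "closed (range (left_mult :: 'a::cstar_algebra \<Rightarrow> _))"
proof -
  have "complete (range (left_mult :: 'a \<Rightarrow> _))"
    by (rule complete_isometric_image[of 1]) (auto simp: bounded_linear_left_mult norm_left_mult complete_UNIV)
  then show ?thesis by (rule complete_imp_closed)
qed

lemma unit_element_eq: "is_unit_element e \<Longrightarrow> (THE e. is_unit_element e) = e"
  by (rule the_equality) (assumption, metis is_unit_element_def)

lemma left_mult_unit: "is_unit_element e \<Longrightarrow> left_mult e = 1"
  by (rule bop_eqI) (simp add: is_unit_element_def bop_apply_simps)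

lemma unital_if_left_mult_one: assumes "left_mult (a::'a::cstar_algebra) = 1" shows "unital TYPE('a)"
proof -
  have l: "a * b = b" for b by (metis assms bop_apply_simps(5) left_mult_apply)
  have r: "b * star a = b" for b using l[of "star b"] by (metis star_mult star_star)
  have "a = star a" using l r by metis
  then have "is_unit_element a" using l r by (simp add: is_unit_element_def)
  then show ?thesis by (auto simp: unital_def)
qed

text \<open>\<open>a + k\<one>\<close> acts on \<open>A\<close> by left multiplication.  The operator norm of this action is the
  \<open>C\<^sup>*\<close>-norm of the unitization.\<close>

definition unitization_rep :: "'a::cstar_algebra \<times> complex \<Rightarrow> 'a bop" where
  "unitization_rep q = left_mult (fst q) + snd q *\<^sub>C 1"

text \<open>If \<open>A\<close> has no unit, the identity operator has a positive distance from the closed space of left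
  multiplications.  The bound makes the representation injective and its range closed.\<close>

lemma unitization_rep_lower_bound:
  assumes "\<not> unital TYPE('a::cstar_algebra)"
  obtains e where "e > 0" "\<And>q::'a \<times> complex. e * norm q \<le> norm (unitization_rep q)"
proof -
  let ?V = "range (left_mult :: 'a \<Rightarrow> _)"
  have "1 \<notin> ?V"
  proof
    assume "1 \<in> ?V"
    then obtain a :: 'a where "left_mult a = 1" by (metis imageE)
    then show False using unital_if_left_mult_one assms by blast
  qed
  then obtain d where d: "d > 0" "\<And>v. v \<in> ?V \<Longrightarrow> d \<le> dist 1 v"
  proof -
    have "open (- ?V)" by (rule open_Compl[OF closed_range_left_mult])
    then obtain d where "d > 0" "ball 1 d \<subseteq> - ?V" using \<open>1 \<notin> ?V\<close> open_contains_ball by blast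
    then have "d \<le> dist 1 v" if "v \<in> ?V" for v using that by (metis ComplD mem_ball not_le subsetD)
    then show ?thesis using that \<open>d > 0\<close> by blast
  qed
  have 1: "d * cmod k \<le> norm (left_mult (a::'a) + k *\<^sub>C 1)" for a k
  proof (cases "k = 0")
    case False
    have "d \<le> norm (1 - left_mult (- (inverse k *\<^sub>C a)))" using d(2) by (auto simp: dist_norm)
    also have "1 - left_mult (- (inverse k *\<^sub>C a)) = inverse k *\<^sub>C (left_mult a + k *\<^sub>C 1)"
      using False left_mult_simps(2)[of 0 "inverse k *\<^sub>C a"]
      by (simp add: left_mult_simps scaleC_add_right scaleC_scaleC)
    also have "norm \<dots> = norm (left_mult a + k *\<^sub>C 1) / cmod k" by (simp add: norm_scaleC norm_divide norm_inverse field_simps)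
    finally show ?thesis using False by (simp add: field_simps)
  qed simp
  have 2: "norm a \<le> norm (left_mult (a::'a) + k *\<^sub>C 1) + cmod k" for a k
  proof -
    have "norm (left_mult a) \<le> norm (left_mult a + k *\<^sub>C 1) + norm (k *\<^sub>C (1::'a bop))"
      using norm_triangle_ineq4[of "left_mult a + k *\<^sub>C 1" "k *\<^sub>C 1"] by simp
    also have "norm (k *\<^sub>C (1::'a bop)) \<le> cmod k" by (simp add: norm_scaleC mult_left_le norm_one_le)
    finally show ?thesis by (simp add: norm_left_mult)
  qed
  show ?thesis
  proof (rule that[of "1 / (1 + 2 / d)"])
    show "1 / (1 + 2 / d) > 0" using d by (simp add: add_pos_pos)
    fix q :: "'a \<times> complex"
    obtain a k where q: "q = (a, k)" by fastforce
    let ?N = "norm (left_mult a + k *\<^sub>C 1)"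
    have "norm q \<le> norm a + cmod k" unfolding q by (rule norm_Pair_le)
    also have "\<dots> \<le> ?N + 2 * cmod k" using 2[of a k] by simp
    also have "cmod k \<le> ?N / d" using 1[of k a] d by (simp add: field_simps)
    finally have "norm q \<le> (1 + 2 / d) * ?N" by (simp add: algebra_simps)
    then show "1 / (1 + 2 / d) * norm q \<le> norm (unitization_rep q)"
      using d by (simp add: unitization_rep_def q divide_le_eq mult.commute add_pos_pos)
  qed
qed

lemma bounded_linear_unitization_rep: "bounded_linear (unitization_rep :: 'a::cstar_algebra \<times> complex \<Rightarrow> _)"
  unfolding unitization_rep_def
  by (intro bounded_linear_add bounded_linear_compose[OF bounded_linear_left_mult]
      bounded_linear_compose[OF bounded_linear_scaleC_left] bounded_linear_fst bounded_linear_snd)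

lemma carrier_unitization: "carrier (unitization :: ('a::cstar_algebra \<times> complex) star_algebra) = (if unital TYPE('a) then UNIV \<times> {0} else UNIV)"
  by (simp add: unitization_def)

lemma norm_unitization_rep_square:
  "(norm (unitization_rep (a, k)))\<^sup>2 \<le> norm (unitization_rep (star a, cnj k) * unitization_rep (a, k))"
proof -
  let ?T = "unitization_rep (a, k)" and ?S = "unitization_rep (star a, cnj k)"
  have "norm ?T \<le> sqrt (norm (?S * ?T))"
  proof (rule norm_bop_le)
    fix b
    have "star (bop_apply ?T b) * bop_apply ?T b = star b * bop_apply (?S * ?T) b"
      by (simp add: unitization_rep_def bop_apply_simps star_add star_mult star_scaleC algebra_simps
          mult_scaleC_left mult_scaleC_right scaleC_scaleC mult.commute scaleC_add_right)
    then have "(norm (bop_apply ?T b))\<^sup>2 = norm (star b * bop_apply (?S * ?T) b)" by (simp only: cstar_identity[symmetric])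
    also have "\<dots> \<le> norm (star b) * (norm (?S * ?T) * norm b)"
      by (rule order_trans[OF norm_mult_ineq mult_left_mono[OF norm_bop_apply_le norm_ge_zero]])
    also have "\<dots> = (sqrt (norm (?S * ?T)) * norm b)\<^sup>2" by (simp add: norm_star power2_eq_square)
    finally show "norm (bop_apply ?T b) \<le> sqrt (norm (?S * ?T)) * norm b"
      by (rule power2_le_imp_le) simp
  qed simp
  then have "(norm ?T)\<^sup>2 \<le> (sqrt (norm (?S * ?T)))\<^sup>2" by (rule power_mono) simp
  then show ?thesis by simp
qed

text \<open>For unital \<open>A\<close> only the pairs \<open>(a, 0)\<close> occur and the range consists of the left multiplications alone;
  otherwise the lower bound above applies.\<close>

interpretation uz: cstar_rep "unitization :: ('a::cstar_algebra \<times> complex) star_algebra" unitization_rep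
proof
  let ?R = "unitization :: ('a \<times> complex) star_algebra"
  have eq: "\<And>x y. mult ?R x y = (fst x * fst y + snd y *\<^sub>C fst x + snd x *\<^sub>C fst y, snd x * snd y)"
    "\<And>x y. add ?R x y = (fst x + fst y, snd x + snd y)" "zero ?R = (0, 0)"
    "\<And>x k. smult ?R k x = (k *\<^sub>C fst x, k * snd x)" "\<And>x. invol ?R x = (star (fst x), cnj (snd x))"
    by (auto simp: unitization_def split: prod.splits)
  have one: "one ?R = (if unital TYPE('a) then (THE e. is_unit_element e, 0) else (0, 1))"
    by (simp add: unitization_def)
  show "inj_on unitization_rep (carrier ?R)"
  proof (cases "unital TYPE('a)")
    case True
    then show ?thesis by (auto simp: inj_on_def carrier_unitization unitization_rep_def inj_left_mult)
  next
    case False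
    then obtain e where e: "e > 0" "\<And>q::'a \<times> complex. e * norm q \<le> norm (unitization_rep q)"
      using unitization_rep_lower_bound by blast
    show ?thesis
    proof (rule inj_onI)
      fix x y :: "'a \<times> complex" assume "unitization_rep x = unitization_rep y"
      then have "unitization_rep (x - y) = 0"
        by (simp add: linear_diff[OF bounded_linear.linear[OF bounded_linear_unitization_rep]])
      then have "e * norm (x - y) \<le> 0" using e(2)[of "x - y"] by simp
      then show "x = y" using e(1) by (simp add: mult_le_0_iff)
    qed
  qed
  show "closed (unitization_rep ` carrier ?R)"
  proof (cases "unital TYPE('a)")
    case True
    then have "unitization_rep ` carrier ?R = range left_mult"
      by (auto simp: carrier_unitization unitization_rep_def image_def)
    then show ?thesis using closed_range_left_mult by simp
  next
    case False
    then obtain e where e: "e > 0" "\<And>q::'a \<times> complex. e * norm q \<le> norm (unitization_rep q)"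
      using unitization_rep_lower_bound by blast
    have "complete (range (unitization_rep :: 'a \<times> complex \<Rightarrow> _))"
      by (rule complete_isometric_image[OF e(1)]) (auto simp: bounded_linear_unitization_rep e complete_UNIV)
    then show ?thesis using False by (simp add: carrier_unitization complete_imp_closed)
  qed
  show "unitization_rep \<one>\<^bsub>?R\<^esub> = 1"
    by (auto simp: one unitization_rep_def left_mult_simps unital_def unit_element_eq left_mult_unit)
  fix x y :: "'a \<times> complex" and k :: complex
  show "\<zero>\<^bsub>?R\<^esub> \<in> carrier ?R" "\<one>\<^bsub>?R\<^esub> \<in> carrier ?R" "unitization_rep \<zero>\<^bsub>?R\<^esub> = 0"
    by (auto simp: eq one carrier_unitization unitization_rep_def left_mult_simps)
  assume x: "x \<in> carrier ?R"
  show "k \<odot>\<^bsub>?R\<^esub> x \<in> carrier ?R" "invol ?R x \<in> carrier ?R" using x by (auto simp: eq carrier_unitization split: if_splits)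
  show "invol ?R (invol ?R x) = x" by (simp add: eq star_star)
  show "invol ?R (k \<odot>\<^bsub>?R\<^esub> x) = cnj k \<odot>\<^bsub>?R\<^esub> invol ?R x" by (simp add: eq star_scaleC)
  show "unitization_rep (k \<odot>\<^bsub>?R\<^esub> x) = k *\<^sub>C unitization_rep x"
    by (simp add: eq unitization_rep_def left_mult_simps scaleC_add_right scaleC_scaleC)
  show "(norm (unitization_rep x))\<^sup>2 \<le> norm (unitization_rep (invol ?R x) * unitization_rep x)"
    using norm_unitization_rep_square[of "fst x" "snd x"] by (simp add: eq)
  assume y: "y \<in> carrier ?R"
  show "x \<oplus>\<^bsub>?R\<^esub> y \<in> carrier ?R" "x \<otimes>\<^bsub>?R\<^esub> y \<in> carrier ?R" using x y by (auto simp: eq carrier_unitization split: if_splits)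
  show "unitization_rep (x \<oplus>\<^bsub>?R\<^esub> y) = unitization_rep x + unitization_rep y"
    by (simp add: eq unitization_rep_def left_mult_simps scaleC_add_left)
  show "unitization_rep (x \<otimes>\<^bsub>?R\<^esub> y) = unitization_rep x * unitization_rep y"
    by (simp add: eq unitization_rep_def left_mult_simps scaleC_mult_left scaleC_mult_right algebra_simps scaleC_scaleC scaleC_add_right)
  show "invol ?R (x \<oplus>\<^bsub>?R\<^esub> y) = invol ?R x \<oplus>\<^bsub>?R\<^esub> invol ?R y" by (simp add: eq star_add)
  show "invol ?R (x \<otimes>\<^bsub>?R\<^esub> y) = invol ?R y \<otimes>\<^bsub>?R\<^esub> invol ?R x"
    by (simp add: eq star_add star_mult star_scaleC algebra_simps)
qed

abbreviation Atilde :: "'a::cstar_algebra bop set" where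
  "Atilde \<equiv> unitization_rep ` carrier unitization"

abbreviation adj :: "'a::cstar_algebra bop \<Rightarrow> 'a bop" where "adj \<equiv> uz.rep_star"

lemma emb_carrier: "emb a \<in> carrier unitization"
  by (simp add: emb_def carrier_unitization)

lemma unitization_rep_emb [simp]: "unitization_rep (emb a) = left_mult a"
  by (simp add: unitization_rep_def emb_def)

lemma left_mult_mem: "left_mult a \<in> Atilde"
  using uz.rep_mem[OF emb_carrier[of a]] by simp

lemma adj_left_mult: "adj (left_mult a) = left_mult (star a)"
proof -
  have "invol unitization (emb a) = emb (star a)" by (simp add: emb_def unitization_def)
  then show ?thesis using uz.rep_star_rep[OF emb_carrier[of a]] by (simp only: unitization_rep_emb)
qed

lemmas Atilde_intros = uz.C_intros left_mult_mem

context inner_product_module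
begin

lemma ip_add_right: "ip x (y + z) = ip x y + ip x z"
  using ip_linear[of x 1 y 1 z] by simp

lemma ip_scaleC_right: "ip x (k *\<^sub>C y) = k *\<^sub>C ip x y"
  using ip_linear[of x k y 0 y] by simp

lemma ip_diff_right: "ip x (y - z) = ip x y - ip x z"
  using ip_linear[of x 1 y "-1" z] by (simp add: scaleC_minus_left)

lemma ip_add_left: "ip (x + y) z = ip x z + ip y z"
  using ip_star by (metis ip_add_right star_add)

lemma ip_scaleC_left: "ip (k *\<^sub>C x) z = cnj k *\<^sub>C ip x z"
  using ip_star by (metis ip_scaleC_right star_scaleC)

lemma ip_eqI: assumes "\<And>z. ip z x = ip z y" shows "x = y"
  using ip_definite[of "x - y"] assms by (simp add: ip_diff_right)

text \<open>The inner product, as an operator on \<open>A\<close>: together with \<open>uact\<close> below, the module structure over the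
  unitization is expressed inside one associative algebra.\<close>

definition lip :: "'e \<Rightarrow> 'e \<Rightarrow> 'a bop" where "lip x y = left_mult (ip x y)"

definition uact :: "'e \<Rightarrow> 'a bop \<Rightarrow> 'e" where "uact x w = unitized_act act x (uz.unrep w)"

lemma lip_eqI: assumes "\<And>z. lip z x = lip z y" shows "x = y"
  using assms by (intro ip_eqI) (simp add: lip_def inj_left_mult)

lemma lip_mem: "lip x y \<in> Atilde"
  by (simp add: lip_def left_mult_mem)

lemma lip_simps:
  "lip x (y + z) = lip x y + lip x z" "lip x (k *\<^sub>C y) = k *\<^sub>C lip x y" "lip x (y - z) = lip x y - lip x z"
  "lip (x + y) z = lip x z + lip y z" "lip (k *\<^sub>C x) z = cnj k *\<^sub>C lip x z" 
  by (simp_all add: lip_def ip_add_right ip_add_left ip_scaleC_right ip_scaleC_left ip_diff_right left_mult_simps)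

lemma adj_lip: "adj (lip x y) = lip y x"
  unfolding lip_def adj_left_mult using ip_star[of y x] by simp

lemma psd_lip: "uz.psd (lip x x)"
  using ip_positive[of x] by (simp add: uz.positive_iff lip_def)

lemma lip_unitized_act: "lip x (unitized_act act y q) = lip x y * unitization_rep q"
  by (cases q) (simp add: lip_def unitized_act_def ip_add_right ip_act ip_scaleC_right left_mult_simps
    unitization_rep_def algebra_simps scaleC_mult_right)

lemma lip_uact: "w \<in> Atilde \<Longrightarrow> lip x (uact y w) = lip x y * w"
  unfolding uact_def lip_unitized_act by (simp add: uz.rep_unrep(1))

lemma lip_uact_left: "w \<in> Atilde \<Longrightarrow> lip (uact x w) y = adj w * lip x y"
  using adj_lip lip_uact lip_mem uz.st_mult by metis

lemma unitized_act_uact: "q \<in> carrier unitization \<Longrightarrow> unitized_act act x q = uact x (unitization_rep q)"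
  by (simp add: uact_def uz.unrep_rep)

lemma uact_simps:
  "v \<in> Atilde \<Longrightarrow> w \<in> Atilde \<Longrightarrow> uact x (v * w) = uact (uact x v) w"
  "v \<in> Atilde \<Longrightarrow> w \<in> Atilde \<Longrightarrow> uact x (v + w) = uact x v + uact x w"
  "v \<in> Atilde \<Longrightarrow> w \<in> Atilde \<Longrightarrow> uact x (v - w) = uact x v - uact x w"
  "w \<in> Atilde \<Longrightarrow> uact (x + y) w = uact x w + uact y w"
  "w \<in> Atilde \<Longrightarrow> uact (x - y) w = uact x w - uact y w"
  "w \<in> Atilde \<Longrightarrow> uact (k *\<^sub>C x) w = k *\<^sub>C uact x w"
  "w \<in> Atilde \<Longrightarrow> uact x (k *\<^sub>C w) = k *\<^sub>C uact x w"
  "uact x 1 = x"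
  by (rule lip_eqI; simp add: lip_uact lip_simps Atilde_intros algebra_simps scaleC_mult_left scaleC_mult_right)+

lemma act_uact: "act x a = uact x (left_mult a)"
  by (rule lip_eqI) (simp add: lip_uact left_mult_mem, simp add: lip_def ip_act left_mult_simps)

end

context hilbert_module
begin

lemma norm_square: "(norm x)\<^sup>2 = norm (lip x x)"
  by (simp add: norm_eq lip_def norm_left_mult)

text \<open>For \<open>b = \<langle>x, y\<rangle>\<close> and \<open>t = norm x\<^sup>-\<^sup>2\<close> the vector \<open>z = y - t x.b\<close> satisfies
  \<open>0 \<le> \<langle>z, z\<rangle> \<le> \<langle>y, y\<rangle> - t b\<^sup>*b\<close>, because \<open>b\<^sup>*\<langle>x, x\<rangle>b \<le> (norm x)\<^sup>2 b\<^sup>*b\<close>.\<close>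

lemma norm_lip: "norm (lip x y) \<le> norm x * norm y"
proof (cases "x = 0")
  case True
  then show ?thesis using lip_simps(5)[of 0 x y] by simp
next
  case False
  define M where "M = (norm x)\<^sup>2"
  have M: "M > 0" using False by (simp add: M_def)
  define t where "t = 1 / M"
  have t: "t > 0" "t * M = 1" using M by (auto simp: t_def)
  define b where "b = lip x y"
  have bC: "b \<in> Atilde" by (simp add: b_def lip_mem)
  define z where "z = y - t *\<^sub>R uact x b"
  have ab: "adj b = lip y x" by (simp add: b_def adj_lip)
  have lz: "lip z z = lip y y - t *\<^sub>R (adj b * b) - t *\<^sub>R (adj b * b) + (t * t) *\<^sub>R (adj b * lip x x * b)"
  proof -
    have l: "lip (u - v) w = lip u w - lip v w" for u v w
      using lip_simps(4)[of "u - v" v w] by simp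
    have r: "lip u (a *\<^sub>R v) = a *\<^sub>R lip u v" "lip (a *\<^sub>R u) v = a *\<^sub>R lip u v" for a u v
      by (simp_all add: scaleR_scaleC lip_simps)
    show ?thesis unfolding z_def
      by (simp add: l r lip_simps lip_uact lip_uact_left bC algebra_simps ab flip: b_def)
  qed
  have "uz.psd (M *\<^sub>R 1 - lip x x)"
    by (rule uz.psd_norm_minus) (auto simp: M_def norm_square uz.psd_sa psd_lip)
  then have "uz.psd (adj b * (M *\<^sub>R 1 - lip x x) * b)" using uz.psd_conj bC by blast
  then have "uz.psd ((t * t) *\<^sub>R (adj b * (M *\<^sub>R 1 - lip x x) * b))" using t by (intro uz.psd_scaleR) auto
  also have "(t * t) *\<^sub>R (adj b * (M *\<^sub>R 1 - lip x x) * b) = t *\<^sub>R (adj b * b) - (t * t) *\<^sub>R (adj b * lip x x * b)"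
    using t(2) by (simp add: algebra_simps)
  finally have "uz.psd (lip z z + (t *\<^sub>R (adj b * b) - (t * t) *\<^sub>R (adj b * lip x x * b)))"
    by (intro uz.psd_add psd_lip)
  then have "uz.psd (lip y y - t *\<^sub>R (adj b * b))" by (simp add: lz)
  moreover have "uz.psd ((norm (lip y y)) *\<^sub>R 1 - lip y y)"
    by (rule uz.psd_norm_minus) (auto simp: uz.psd_sa psd_lip)
  ultimately have "uz.psd (lip y y - t *\<^sub>R (adj b * b) + ((norm (lip y y)) *\<^sub>R 1 - lip y y))" by (rule uz.psd_add)
  then have "uz.psd ((norm (lip y y)) *\<^sub>R 1 - t *\<^sub>R (adj b * b))" by simp
  moreover have "uz.psd (t *\<^sub>R (adj b * b))" using t bC by (intro uz.psd_scaleR uz.psd_star_mult) auto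
  ultimately have "norm (t *\<^sub>R (adj b * b)) \<le> norm (lip y y)" by (intro uz.norm_le_of_psd_diff) auto
  then have "t * (norm b)\<^sup>2 \<le> (norm y)\<^sup>2" using t bC by (simp add: uz.cstar_eq norm_square)
  then have "(norm b)\<^sup>2 \<le> (norm x * norm y)\<^sup>2" using M by (simp add: t_def M_def power_mult_distrib field_simps)
  then show ?thesis unfolding b_def by (rule power2_le_imp_le) simp
qed

lemma norm_uact: assumes w: "w \<in> Atilde" shows "norm (uact x w) \<le> norm x * norm w"
proof -
  have "(norm (uact x w))\<^sup>2 = norm (adj w * lip x x * w)" by (simp add: norm_square lip_uact lip_uact_left w mult.assoc)
  also have "\<dots> \<le> norm (adj w) * norm (lip x x) * norm w"
    by (meson norm_mult_ineq order_trans mult_right_mono norm_ge_zero)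
  also have "\<dots> = (norm x * norm w)\<^sup>2" by (simp add: uz.norm_st w power2_eq_square flip: norm_square)
  finally show ?thesis by (rule power2_le_imp_le) simp
qed

lemma bounded_linear_lip: "bounded_linear (lip x)"
proof (rule bounded_linear_intro[where K="norm x"])
  show "norm (lip x y) \<le> norm y * norm x" for y by (subst mult.commute) (rule norm_lip)
  show "lip x (r *\<^sub>R y) = r *\<^sub>R lip x y" for r y by (simp only: scaleR_scaleC lip_simps)
qed (rule lip_simps)

lemma bounded_linear_uact: "w \<in> Atilde \<Longrightarrow> bounded_linear (\<lambda>x. uact x w)"
  by (rule bounded_linear_intro[where K="norm w"]) (simp_all only: uact_simps scaleR_scaleC norm_uact)

end

section \<open>The algebra of adjointable maps\<close>

text \<open>By the Baire category theorem one of the closed sets \<open>A n\<close> on which all maps are bounded by \<open>n\<close>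
  contains a ball.\<close>

lemma uniform_boundedness:
  fixes T :: "'i \<Rightarrow> 'x::banach \<Rightarrow> 'y::real_normed_vector"
  assumes bl: "\<And>i. i \<in> I \<Longrightarrow> bounded_linear (T i)"
    and pw: "\<And>x. \<exists>M. \<forall>i\<in>I. norm (T i x) \<le> M"
  obtains K where "K \<ge> 0" "\<And>i x. i \<in> I \<Longrightarrow> norm (T i x) \<le> K * norm x"
proof -
  define A where "A n = {x. \<forall>i\<in>I. norm (T i x) \<le> real n}" for n
  have cl: "closed (A n)" for n
  proof -
    have "A n = (\<Inter>i\<in>I. {x. norm (T i x) \<le> real n})" by (auto simp: A_def)
    moreover have "closed {x. norm (T i x) \<le> real n}" if "i \<in> I" for i
      by (intro closed_Collect_le continuous_intros linear_continuous_on bl that)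
    ultimately show ?thesis by (simp add: closed_INT)
  qed
  have "(\<Union>n. A n) = UNIV"
  proof -
    have "\<exists>n. x \<in> A n" for x
    proof -
      obtain M where M: "\<forall>i\<in>I. norm (T i x) \<le> M" using pw by blast
      obtain n where "M \<le> real n" using real_arch_simple by blast
      then show ?thesis using M by (auto simp: A_def intro!: exI[of _ n] intro: order_trans)
    qed
    then show ?thesis by blast
  qed
  moreover have "euclidean interior_of \<Union>(range A) = {}" if "\<And>n. interior (A n) = {}"
    using that cl by (intro Baire_category_alt) (auto simp: completely_metrizable_space_euclidean)
  ultimately obtain n where "interior (A n) \<noteq> {}" by auto
  then obtain x0 where "x0 \<in> interior (A n)" by blast
  then obtain r where r: "r > 0" "ball x0 r \<subseteq> A n" by (auto simp: mem_interior)
  show ?thesis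
  proof (rule that[of "4 * real n / r"])
    show "0 \<le> 4 * real n / r" using r by simp
    fix i x assume i: "i \<in> I"
    interpret bounded_linear "T i" by (rule bl[OF i])
    show "norm (T i x) \<le> 4 * real n / r * norm x"
    proof (cases "x = 0")
      case False
      \<comment> \<open>The scaling puts \<open>x\<^sub>0 + u\<close> inside the ball on which \<open>T i\<close> is bounded by \<open>n\<close>.\<close>
      define u where "u = (r / (2 * norm x)) *\<^sub>R x"
      have "norm u = r / 2" using False r by (simp add: u_def)
      then have "x0 + u \<in> A n" "x0 \<in> A n" using r by (auto simp: dist_norm subset_iff)
      then have "norm (T i (x0 + u)) \<le> n" "norm (T i x0) \<le> n" using i by (auto simp: A_def)
      moreover have "T i u = T i (x0 + u) - T i x0" by (simp add: add)
      ultimately have "norm (T i u) \<le> 2 * n" using norm_triangle_ineq4[of "T i (x0 + u)" "T i x0"] by simp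
      moreover have "T i u = (r / (2 * norm x)) *\<^sub>R T i x" by (simp add: u_def scaleR)
      ultimately have "r / (2 * norm x) * norm (T i x) \<le> 2 * n" using r by simp
      then show ?thesis using r False by (simp add: field_simps)
    qed (simp add: zero)
  qed
qed

context hilbert_module
begin

lemma ip_eq_iff_lip: "ip x y = ip z w \<longleftrightarrow> lip x y = lip z w"
  by (simp add: lip_def inj_left_mult)

lemma lip_diff_left: "lip (x - y) z = lip x z - lip y z"
  using lip_simps(4)[of "x - y" y z] by simp

text \<open>A map that has an adjoint with respect to the inner product is automatically linear over \<open>\<complex>\<close> and
  over \<open>A\<close>.\<close>

lemma is_adjointI:
  assumes "\<And>x y. lip (f x) y = lip x (g y)"
  shows "is_adjoint act ip f g"
proof -
  have m: "module_linear act g"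
    unfolding module_linear_def complex_linear_def
  proof (intro conjI allI)
    show "g (x + y) = g x + g y" for x y by (rule lip_eqI) (simp add: lip_simps flip: assms)
    show "g (k *\<^sub>C x) = k *\<^sub>C g x" for k x by (rule lip_eqI) (simp add: lip_simps flip: assms)
    show "g (act x a) = act (g x) a" for x a
      by (rule lip_eqI) (simp add: act_uact lip_uact left_mult_mem flip: assms)
  qed
  then show ?thesis using assms by (simp add: is_adjoint_def ip_eq_iff_lip)
qed

lemma is_adjoint_sym: assumes "\<And>x y. lip (f x) y = lip x (g y)" shows "lip (g x) y = lip x (f y)"
  by (metis assms adj_lip)

lemma adjointableI:
  assumes "\<And>x y. lip (f x) y = lip x (g y)" shows "adjointable act ip f"
  using is_adjointI[of f g] is_adjointI[of g f] is_adjoint_sym[of f g] assms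
  by (auto simp: adjointable_def is_adjoint_def)

lemma adjointableE:
  assumes "adjointable act ip f"
  obtains g where "\<And>x y. lip (f x) y = lip x (g y)" "\<And>x y. lip (g x) y = lip x (f y)"
proof -
  obtain g where "\<And>x y. lip (f x) y = lip x (g y)"
    using assms by (auto simp: adjointable_def is_adjoint_def ip_eq_iff_lip)
  then show ?thesis using that is_adjoint_sym by blast
qed

lemma the_adjoint:
  assumes "\<And>x y. lip (f x) y = lip x (g y)" shows "(THE g. is_adjoint act ip f g) = g"
proof (rule the_equality)
  show "is_adjoint act ip f g" using assms by (rule is_adjointI)
  fix h assume "is_adjoint act ip f h"
  then have "lip x (h y) = lip x (g y)" for x y using assms by (metis is_adjoint_def lip_def)
  then show "h = g" by (intro ext lip_eqI)
qed

text \<open>The maps \<open>x \<mapsto> \<langle>f\<^sup>* z, x\<rangle> = \<langle>z, f x\<rangle>\<close> with \<open>norm z \<le> 1\<close> are bounded and pointwise bounded by \<open>norm (f x)\<close>, so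
  the uniform boundedness principle applies to them.\<close>

lemma adjointable_bounded:
  assumes "adjointable act ip f" shows "bounded_linear f"
proof -
  obtain g where g: "\<And>x y. lip (f x) y = lip x (g y)" "\<And>x y. lip (g x) y = lip x (f y)"
    using adjointableE[OF assms] by blast
  have lin: "complex_linear f" using assms by (simp add: adjointable_def module_linear_def)
  have pw: "\<exists>M. \<forall>z\<in>{z. norm z \<le> 1}. norm (lip (g z) x) \<le> M" for x
  proof (intro exI ballI)
    fix z :: 'e assume "z \<in> {z. norm z \<le> 1}"
    then show "norm (lip (g z) x) \<le> norm (f x)"
      using norm_lip[of z "f x"] by (simp add: g) (meson mult_left_le_one_le norm_ge_zero order_trans)
  qed
  obtain K where K: "K \<ge> 0" "\<And>z x. z \<in> {z. norm z \<le> 1} \<Longrightarrow> norm (lip (g z) x) \<le> K * norm x"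
    using uniform_boundedness[of "{z. norm z \<le> 1}" "\<lambda>z. lip (g z)", OF bounded_linear_lip pw] by blast
  have "norm (f x) \<le> norm x * K" for x
  proof (cases "f x = 0")
    case False
    define z where "z = (1 / norm (f x)) *\<^sub>R f x"
    have z: "norm z = 1" using False by (simp add: z_def)
    have "lip (g z) x = (1 / norm (f x)) *\<^sub>R lip (f x) (f x)" by (simp add: g z_def scaleR_scaleC lip_simps)
    then have "norm (lip (g z) x) = norm (f x)"
      using False by (simp add: power2_eq_square flip: norm_square)
    then show ?thesis using K(2)[of z x] z by (simp add: mult.commute)
  qed (use K in auto)
  then show ?thesis
    by (intro bounded_linear_intro[where K=K]) (use lin in \<open>auto simp: complex_linear_def scaleR_scaleC\<close>)
qed

definition op_rep :: "('e \<Rightarrow> 'e) \<Rightarrow> 'e bop" where "op_rep f = Abs_bop (Blinfun f)"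

lemma op_rep_apply: "adjointable act ip f \<Longrightarrow> bop_apply (op_rep f) x = f x"
  unfolding op_rep_def
  by (subst bop_apply_Abs)
    (auto simp: adjointable_bounded adjointable_def module_linear_def complex_linear_def)

abbreviation "Adj \<equiv> adjointable_algebra act ip"

lemma Adj_simps:
  "carrier Adj = {f. adjointable act ip f}" "mult Adj = (\<circ>)" "one Adj = id" "zero Adj = (\<lambda>x. 0)"
  "add Adj = (\<lambda>f g x. f x + g x)" "smult Adj = (\<lambda>k f x. k *\<^sub>C f x)" "invol Adj = (\<lambda>f. THE g. is_adjoint act ip f g)"
  by (simp_all add: adjointable_algebra_def)

lemma lip_invol:
  assumes "adjointable act ip f"
  shows "lip (f x) y = lip x (invol Adj f y)" "lip (invol Adj f x) y = lip x (f y)" "adjointable act ip (invol Adj f)"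
proof -
  obtain g where g: "\<And>x y. lip (f x) y = lip x (g y)" "\<And>x y. lip (g x) y = lip x (f y)"
    using adjointableE[OF assms] by blast
  then have "invol Adj f = g" by (simp add: Adj_simps the_adjoint)
  then show "lip (f x) y = lip x (invol Adj f y)" "lip (invol Adj f x) y = lip x (f y)" "adjointable act ip (invol Adj f)"
    using g adjointableI[of g f] by auto
qed

lemma invol_eqI: assumes "\<And>x y. lip (f x) y = lip x (g y)" shows "invol Adj f = g"
  by (simp add: Adj_simps the_adjoint assms)

lemma norm_adjoint_le:
  assumes "\<And>x y. lip (bop_apply F x) y = lip x (bop_apply G y)"
  shows "norm G \<le> norm F"
proof (rule norm_bop_le)
  fix x
  have "(norm (bop_apply G x))\<^sup>2 = norm (lip (bop_apply F (bop_apply G x)) x)" by (simp add: norm_square assms)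
  also have "\<dots> \<le> norm F * norm (bop_apply G x) * norm x"
    by (rule order_trans[OF norm_lip]) (intro mult_right_mono norm_bop_apply_le norm_ge_zero)
  finally show "norm (bop_apply G x) \<le> norm F * norm x"
    by (cases "norm (bop_apply G x) = 0") (auto simp: power2_eq_square mult_ac)
qed simp

lemma norm_square_adjoint_le:
  assumes "\<And>x y. lip (bop_apply F x) y = lip x (bop_apply G y)"
  shows "(norm F)\<^sup>2 \<le> norm (G * F)"
proof -
  have "norm F \<le> sqrt (norm (G * F))"
  proof (rule norm_bop_le)
    fix x
    have "(norm (bop_apply F x))\<^sup>2 = norm (lip x (bop_apply (G * F) x))" by (simp add: norm_square assms bop_apply_simps)
    also have "\<dots> \<le> norm x * (norm (G * F) * norm x)"
      by (rule order_trans[OF norm_lip]) (intro mult_left_mono norm_bop_apply_le norm_ge_zero)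
    also have "\<dots> = (sqrt (norm (G * F)) * norm x)\<^sup>2" by (simp add: power_mult_distrib power2_eq_square)
    finally show "norm (bop_apply F x) \<le> sqrt (norm (G * F)) * norm x" by (rule power2_le_imp_le) simp
  qed simp
  then have "(norm F)\<^sup>2 \<le> (sqrt (norm (G * F)))\<^sup>2" by (rule power_mono) simp
  then show ?thesis by simp
qed

text \<open>Adjoints of a Cauchy sequence form a Cauchy sequence by \<open>norm_adjoint_le\<close>, and the adjoint relation
  passes to the limit.\<close>

lemma closed_op_rep: "closed (op_rep ` {f. adjointable act ip f})"
  unfolding closed_sequential_limits
proof (intro allI impI, elim conjE)
  fix X L assume X: "\<forall>n::nat. X n \<in> op_rep ` {f. adjointable act ip f}" and L: "X \<longlonglongrightarrow> L"
  have "\<exists>G. \<forall>x y. lip (bop_apply (X n) x) y = lip x (bop_apply G y)" for n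
  proof -
    obtain f where f: "adjointable act ip f" "X n = op_rep f" using X by blast
    then show ?thesis using lip_invol[OF f(1)] by (intro exI[of _ "op_rep (invol Adj f)"]) (simp add: op_rep_apply)
  qed
  then obtain G where G: "\<And>n x y. lip (bop_apply (X n) x) y = lip x (bop_apply (G n) y)" by metis
  have le: "norm (G m - G n) \<le> norm (X m - X n)" for m n
    by (rule norm_adjoint_le) (simp add: bop_apply_simps G lip_simps lip_diff_left)
  have "Cauchy X" using L LIMSEQ_imp_Cauchy by blast
  then have "Cauchy G" unfolding Cauchy_def dist_norm using le le_less_trans by meson
  then obtain M where M: "G \<longlonglongrightarrow> M" using Cauchy_convergent convergent_def by blast
  have *: "lip (bop_apply L x) y = lip x (bop_apply M y)" for x y
  proof (rule LIMSEQ_unique)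
    show "(\<lambda>n. lip x (bop_apply (G n) y)) \<longlonglongrightarrow> lip x (bop_apply M y)"
      by (intro bounded_linear.tendsto[OF bounded_linear_lip] tendsto_bop_apply M)
    have "(\<lambda>n. bop_apply (X n) x - bop_apply L x) \<longlonglongrightarrow> 0" using tendsto_bop_apply[OF L] LIM_zero by blast
    then have "(\<lambda>n. norm (bop_apply (X n) x - bop_apply L x) * norm y) \<longlonglongrightarrow> 0"
      by (intro tendsto_mult_left_zero tendsto_norm_zero)
    then have "(\<lambda>n. lip (bop_apply (X n) x) y - lip (bop_apply L x) y) \<longlonglongrightarrow> 0"
      by (rule Lim_null_comparison[rotated]) (simp add: norm_lip flip: lip_diff_left)
    then have "(\<lambda>n. lip (bop_apply (X n) x) y) \<longlonglongrightarrow> lip (bop_apply L x) y" by (rule LIM_zero_cancel)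
    then show "(\<lambda>n. lip x (bop_apply (G n) y)) \<longlonglongrightarrow> lip (bop_apply L x) y" by (simp only: G)
  qed
  then have "adjointable act ip (bop_apply L)" by (rule adjointableI)
  moreover have "op_rep (bop_apply L) = L"
    by (rule bop_eqI) (simp add: op_rep_apply calculation)
  ultimately show "L \<in> op_rep ` {f. adjointable act ip f}" by (metis imageI mem_Collect_eq)
qed

sublocale op: cstar_rep Adj op_rep
proof
  show "inj_on op_rep (carrier Adj)"
  proof (rule inj_onI, simp add: Adj_simps)
    fix f g assume "adjointable act ip f" "adjointable act ip g" "op_rep f = op_rep g"
    then show "f = g" using op_rep_apply by (metis ext)
  qed
  show "closed (op_rep ` carrier Adj)" using closed_op_rep by (simp add: Adj_simps)
  have zero: "adjointable act ip (\<lambda>x. 0)" and one: "adjointable act ip id"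
    using lip_simps(2)[of _ 0] lip_simps(5)[of 0]
    by (auto intro: adjointableI[of "\<lambda>x. 0" "\<lambda>x. 0"] adjointableI[of id id])
  show "\<zero>\<^bsub>Adj\<^esub> \<in> carrier Adj" "\<one>\<^bsub>Adj\<^esub> \<in> carrier Adj" using zero one by (simp_all add: Adj_simps)
  show "op_rep \<zero>\<^bsub>Adj\<^esub> = 0" "op_rep \<one>\<^bsub>Adj\<^esub> = 1"
    by (rule bop_eqI; simp add: Adj_simps op_rep_apply zero one bop_apply_simps)+
  fix f g and k :: complex
  assume "f \<in> carrier Adj"
  then have f: "adjointable act ip f" by (simp add: Adj_simps)
  note f' = lip_invol[OF f]
  have kf: "lip (k *\<^sub>C f x) y = lip x (cnj k *\<^sub>C invol Adj f y)" for x y by (simp add: lip_simps f')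
  have akf: "adjointable act ip (\<lambda>x. k *\<^sub>C f x)" by (rule adjointableI[OF kf])
  show "k \<odot>\<^bsub>Adj\<^esub> f \<in> carrier Adj" using akf by (simp add: Adj_simps)
  show "op_rep (k \<odot>\<^bsub>Adj\<^esub> f) = k *\<^sub>C op_rep f"
    by (rule bop_eqI) (simp add: Adj_simps(6) op_rep_apply akf f bop_apply_simps)
  show "invol Adj (k \<odot>\<^bsub>Adj\<^esub> f) = cnj k \<odot>\<^bsub>Adj\<^esub> invol Adj f"
    using kf by (intro invol_eqI) (simp add: Adj_simps(6))
  show "invol Adj f \<in> carrier Adj" using f' by (simp add: Adj_simps(1))
  show "invol Adj (invol Adj f) = f" by (rule invol_eqI) (rule f')
  show "(norm (op_rep f))\<^sup>2 \<le> norm (op_rep (invol Adj f) * op_rep f)"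
    by (rule norm_square_adjoint_le) (simp add: op_rep_apply f f')
  assume "g \<in> carrier Adj"
  then have g: "adjointable act ip g" by (simp add: Adj_simps)
  note g' = lip_invol[OF g]
  have pl: "lip (f x + g x) y = lip x (invol Adj f y + invol Adj g y)" for x y by (simp add: lip_simps f' g')
  have apl: "adjointable act ip (\<lambda>x. f x + g x)" by (rule adjointableI[OF pl])
  have mu: "lip (f (g x)) y = lip x (invol Adj g (invol Adj f y))" for x y by (simp add: f' g')
  have amu: "adjointable act ip (f \<circ> g)" using adjointableI[of "f \<circ> g"] mu by auto
  show "f \<oplus>\<^bsub>Adj\<^esub> g \<in> carrier Adj" "f \<otimes>\<^bsub>Adj\<^esub> g \<in> carrier Adj" using apl amu by (simp_all add: Adj_simps)
  show "op_rep (f \<oplus>\<^bsub>Adj\<^esub> g) = op_rep f + op_rep g" "op_rep (f \<otimes>\<^bsub>Adj\<^esub> g) = op_rep f * op_rep g"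
    by (rule bop_eqI; simp add: Adj_simps(2,5) op_rep_apply apl amu f g bop_apply_simps)+
  show "invol Adj (f \<oplus>\<^bsub>Adj\<^esub> g) = invol Adj f \<oplus>\<^bsub>Adj\<^esub> invol Adj g"
    using pl by (intro invol_eqI) (simp add: Adj_simps(5))
  show "invol Adj (f \<otimes>\<^bsub>Adj\<^esub> g) = invol Adj g \<otimes>\<^bsub>Adj\<^esub> invol Adj f"
    using mu by (intro invol_eqI) (simp add: Adj_simps(2))
qed

text \<open>The operator \<open>k Id + c w c\<^sup>*\<close>.  For fixed \<open>c\<close> these operators are closed under adjoints and composition, by
  explicit formulas for \<open>k\<close> and \<open>w\<close>.\<close>

definition rank_one_pert :: "'e \<Rightarrow> complex \<Rightarrow> 'a bop \<Rightarrow> 'e \<Rightarrow> 'e" where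
  "rank_one_pert c k w z = k *\<^sub>C z + uact c (w * lip c z)"

lemma lip_rank_one_pert:
  assumes "w \<in> Atilde"
  shows "lip y (rank_one_pert c k w z) = k *\<^sub>C lip y z + lip y c * w * lip c z"
  by (simp add: rank_one_pert_def lip_simps lip_uact Atilde_intros lip_mem assms mult.assoc)

lemma rank_one_pert_adjoint:
  assumes "w \<in> Atilde"
  shows "lip (rank_one_pert c k w x) y = lip x (rank_one_pert c (cnj k) (adj w) y)"
proof -
  have "lip (rank_one_pert c k w x) y = adj (lip y (rank_one_pert c k w x))" by (simp add: adj_lip)
  also have "\<dots> = cnj k *\<^sub>C lip x y + lip x c * adj w * lip c y"
    using assms by (simp add: lip_rank_one_pert uz.st_add uz.st_scaleC uz.st_mult Atilde_intros lip_mem adj_lip mult.assoc)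
  finally show ?thesis using assms by (simp add: lip_rank_one_pert Atilde_intros)
qed

lemma rank_one_pert_adjointable: "w \<in> Atilde \<Longrightarrow> adjointable act ip (rank_one_pert c k w)"
  by (rule adjointableI[OF rank_one_pert_adjoint])

lemma rank_one_pert_compose:
  assumes "w \<in> Atilde" "v \<in> Atilde"
  shows "rank_one_pert c k w (rank_one_pert c l v z)
    = rank_one_pert c (k * l) (k *\<^sub>C v + l *\<^sub>C w + w * lip c c * v) z"
  by (rule lip_eqI)
    (simp add: lip_rank_one_pert assms Atilde_intros lip_mem algebra_simps scaleC_add_right scaleC_scaleC
      scaleC_mult_left scaleC_mult_right)

lemma rank_one_pert_one: "rank_one_pert c 1 0 = id"
  by (rule ext, rule lip_eqI) (simp add: lip_rank_one_pert Atilde_intros)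

end

section \<open>The maps \<open>g\<^sub>c\<close>\<close>

definition inv_in :: "'u::monoid_mult set \<Rightarrow> 'u \<Rightarrow> 'u" where
  "inv_in C x = (SOME y. y \<in> C \<and> x * y = 1 \<and> y * x = 1)"

lemma inv_in:
  assumes "invertible_in C x"
  shows "inv_in C x \<in> C" "x * inv_in C x = 1" "inv_in C x * x = 1"
proof -
  have "\<exists>y. y \<in> C \<and> x * y = 1 \<and> y * x = 1" using assms by (auto simp: invertible_in_def)
  from someI_ex[OF this, folded inv_in_def]
  show "inv_in C x \<in> C" "x * inv_in C x = 1" "inv_in C x * x = 1" by auto
qed

lemma inv_in_eq: "y \<in> C \<Longrightarrow> x * y = 1 \<Longrightarrow> y * x = 1 \<Longrightarrow> inv_in C x = y"
proof -
  assume y: "y \<in> C" "x * y = 1" "y * x = 1"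
  then have "invertible_in C x" by (auto simp: invertible_in_def)
  from inv_in[OF this] y show ?thesis by (metis mult.assoc mult_1_left mult_1_right)
qed

lemma has_derivative_of_quadratic_remainder:
  fixes f :: "'a::real_normed_vector \<Rightarrow> 'b::real_normed_vector"
  assumes D: "bounded_linear D" and U: "open U" "x \<in> U"
    and rem: "\<And>y. y \<in> U \<Longrightarrow> norm (f y - f x - D (y - x)) \<le> K * (norm (y - x))\<^sup>2"
  shows "(f has_derivative D) (at x)"
  unfolding has_derivative_at_alt
proof (intro conjI allI impI D)
  fix e :: real assume e: "e > 0"
  obtain r where r: "r > 0" "ball x r \<subseteq> U" using U open_contains_ball by blast
  \<comment> \<open>The summand \<open>1\<close> covers the case \<open>K = 0\<close>.\<close>
  define d where "d = min r (e / (\<bar>K\<bar> + 1))"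
  have K: "\<bar>K\<bar> + 1 > 0" by simp
  have "d \<le> e / (\<bar>K\<bar> + 1)" by (simp add: d_def)
  then have d: "d > 0" "d \<le> r" "d * (\<bar>K\<bar> + 1) \<le> e"
    using r e K by (simp_all only: pos_le_divide_eq) (simp_all add: d_def)
  show "\<exists>d>0. \<forall>y. norm (y - x) < d \<longrightarrow> norm (f y - f x - D (y - x)) \<le> e * norm (y - x)"
  proof (intro exI conjI allI impI)
    fix y assume y: "norm (y - x) < d"
    then have "y \<in> U" using d r by (auto simp: dist_norm norm_minus_commute subset_iff)
    then have "norm (f y - f x - D (y - x)) \<le> K * norm (y - x) * norm (y - x)" using rem by (simp add: power2_eq_square mult.assoc)
    also have "\<dots> \<le> e * norm (y - x)"
    proof (rule mult_right_mono)
      have "K * norm (y - x) \<le> (\<bar>K\<bar> + 1) * d" using y by (intro mult_mono) auto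
      then show "K * norm (y - x) \<le> e" using d by (simp add: mult.commute)
    qed simp
    finally show "norm (f y - f x - D (y - x)) \<le> e * norm (y - x)" .
  qed (rule d)
qed

lemma holomorphic_map_on_cong:
  assumes "open U" "\<And>x. x \<in> U \<Longrightarrow> f x = g x" "holomorphic_map_on f U" shows "holomorphic_map_on g U"
  unfolding holomorphic_map_on_def
proof
  fix x assume x: "x \<in> U"
  then obtain D where D: "(f has_derivative D) (at x)" "complex_linear D"
    using assms(3) by (auto simp: holomorphic_map_on_def)
  have "(g has_derivative D) (at x)"
    by (rule has_derivative_transform_within_open[OF D(1) assms(1) x assms(2)])
  then show "\<exists>D. (g has_derivative D) (at x) \<and> complex_linear D" using D by blast
qed

lemma holomorphic_automorphismI:
  assumes U: "open U" and f: "holomorphic_map_on f U" "f ` U \<subseteq> U" and g: "holomorphic_map_on g U" "g ` U \<subseteq> U"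
    and inv: "\<And>x. x \<in> U \<Longrightarrow> g (f x) = x" "\<And>x. x \<in> U \<Longrightarrow> f (g x) = x"
  shows "holomorphic_automorphism U f"
  unfolding holomorphic_automorphism_def
proof (intro conjI f)
  show bij: "bij_betw f U U" using assms by (intro bij_betw_byWitness[where f'=g]) auto
  have "inv_into U f y = g y" if "y \<in> U" for y
    using that g inv bij by (metis bij_betw_inv_into_left image_subset_iff)
  then show "holomorphic_map_on (inv_into U f) U"
    using holomorphic_map_on_cong[OF U _ g(1)] by metis
qed

context hilbert_module
begin

text \<open>\<open>s = (\<one> - |c|\<^sup>2)\<^sup>1\<^sup>/\<^sup>2\<close>, as an operator on \<open>A\<close>.\<close>

definition defect :: "'e \<Rightarrow> 'a bop" where
  "defect c = unitization_rep (pos_sqrt unitization (\<one>\<^bsub>unitization\<^esub> \<ominus>\<^bsub>unitization\<^esub> modulus ip c [^]\<^bsub>unitization\<^esub> (2::nat)))"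

lemma modulus_square: "modulus ip c [^]\<^bsub>unitization\<^esub> (2::nat) = emb (ip c c)"
proof -
  let ?m = "modulus ip c"
  have m: "?m \<in> carrier unitization" "?m \<otimes>\<^bsub>unitization\<^esub> ?m = emb (ip c c)"
    using uz.pos_sqrt_rep[OF emb_carrier[of "ip c c"]] psd_lip[of c] by (auto simp: modulus_def lip_def)
  have "\<one>\<^bsub>unitization\<^esub> \<otimes>\<^bsub>unitization\<^esub> ?m = ?m"
    using m(1) by (subst uz.rep_eq_iff[symmetric]) (auto simp: uz.carrier_intros uz.rep_hom)
  then show ?thesis using m by (simp add: numeral_2_eq_2 nat_pow_def)
qed

lemma defect_props:
  assumes c: "norm c < 1"
  shows "pos_sqrt unitization (\<one>\<^bsub>unitization\<^esub> \<ominus>\<^bsub>unitization\<^esub> modulus ip c [^]\<^bsub>unitization\<^esub> (2::nat)) \<in> carrier unitization"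
    "defect c \<in> Atilde" "uz.psd (defect c)" "adj (defect c) = defect c" "defect c * defect c = 1 - lip c c"
    "invertible_in Atilde (defect c)" "invertible_in Atilde (1 + defect c)"
proof -
  let ?a = "\<one>\<^bsub>unitization\<^esub> \<ominus>\<^bsub>unitization\<^esub> emb (ip c c)"
  have a: "?a \<in> carrier unitization" "unitization_rep ?a = 1 - lip c c"
    by (simp_all add: uz.minus_closed uz.rep_minus uz.carrier_intros emb_carrier uz.rep_hom lip_def)
  have n: "norm (lip c c) < 1" using c by (simp add: power_less_one_iff flip: norm_square)
  have "uz.psd (1 - lip c c)" using uz.psd_norm_minus[of "lip c c" 1] n uz.psd_sa[OF psd_lip] by simp
  then have p: "uz.psd (unitization_rep ?a)" by (simp add: a)
  note pr = uz.pos_sqrt_rep[OF a(1) p]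
  show "pos_sqrt unitization (\<one>\<^bsub>unitization\<^esub> \<ominus>\<^bsub>unitization\<^esub> modulus ip c [^]\<^bsub>unitization\<^esub> (2::nat)) \<in> carrier unitization"
    using pr(1) by (simp add: modulus_square)
  show psd: "uz.psd (defect c)" and sq: "defect c * defect c = 1 - lip c c"
    using pr by (auto simp: defect_def modulus_square a)
  then show m: "defect c \<in> Atilde" and "adj (defect c) = defect c" using uz.psd_sa[OF psd] by (auto simp: uz.sa_def)
  have "invertible_in Atilde (1 - lip c c)" by (rule uz.invertible_one_minus[OF lip_mem n])
  then show "invertible_in Atilde (defect c)" by (metis m sq uz.invertible_factor)
  show "invertible_in Atilde (1 + defect c)" using uz.psd_shift_invertible[OF psd, of 1] by (simp add: add.commute)
qed

definition one_plus_defect_inv :: "'e \<Rightarrow> 'a bop" where "one_plus_defect_inv c = inv_in Atilde (1 + defect c)"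

lemma one_plus_defect_inv_props:
  assumes c: "norm c < 1"
  shows "one_plus_defect_inv c \<in> Atilde" "adj (one_plus_defect_inv c) = one_plus_defect_inv c" "one_plus_defect_inv c * defect c = defect c * one_plus_defect_inv c"
    "one_plus_defect_inv c * lip c c = 1 - defect c" "lip c c * one_plus_defect_inv c = 1 - defect c"
    "one_plus_defect_inv c + one_plus_defect_inv c = 1 + one_plus_defect_inv c * lip c c * one_plus_defect_inv c"
proof -
  note d = defect_props[OF c]
  let ?s = "defect c" and ?k = "one_plus_defect_inv c"
  note k = inv_in[OF d(7), folded one_plus_defect_inv_def]
  show m: "?k \<in> Atilde" by (rule k)
  have "uz.sa (1 + ?s)" using d(3) by (intro uz.sa_intros uz.psd_sa)
  then have "uz.sa ?k" using k uz.sa_inverse by blast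
  then show "adj ?k = ?k" by (simp add: uz.sa_def)
  have e: "?k + ?k * ?s = 1" "?k + ?s * ?k = 1" using k by (simp_all add: algebra_simps)
  then show ks: "?k * ?s = ?s * ?k" by (metis add_left_cancel)
  have p: "lip c c = (1 + ?s) * (1 - ?s)" "lip c c = (1 - ?s) * (1 + ?s)" using d(5) by (simp_all add: algebra_simps)
  show kp: "?k * lip c c = 1 - ?s" unfolding p(1) by (simp add: mult.assoc[symmetric] k)
  show "lip c c * ?k = 1 - ?s" unfolding p(2) by (simp add: mult.assoc k)
  show "?k + ?k = 1 + ?k * lip c c * ?k" unfolding kp using e(2) by (simp add: algebra_simps)
qed

text \<open>A closed form of \<open>(Id - c c\<^sup>*)\<^sup>1\<^sup>/\<^sup>2\<close>.  Formally, the power series of the root gives \<open>Id - c f(p) c\<^sup>*\<close> with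
  \<open>p = |c|\<^sup>2\<close> and \<open>f(p) = (1 - (1 - p)\<^sup>1\<^sup>/\<^sup>2) / p = 1 / (1 + s)\<close>.\<close>

definition defect_op :: "'e \<Rightarrow> 'e \<Rightarrow> 'e" where "defect_op c = rank_one_pert c 1 (- one_plus_defect_inv c)"

lemma rank_one_eq: "rank_one act ip c z = uact c (lip c z)"
  by (simp add: rank_one_def act_uact lip_def)

lemma rank_one_pert_linear: "rank_one_pert c k w (x + y) = rank_one_pert c k w x + rank_one_pert c k w y"
  "rank_one_pert c k w (l *\<^sub>C x) = l *\<^sub>C rank_one_pert c k w x"
  "v \<in> Atilde \<Longrightarrow> rank_one_pert c k w (uact x v) = uact (rank_one_pert c k w x) v" if "w \<in> Atilde"
  by (rule lip_eqI; simp add: lip_rank_one_pert that lip_uact lip_simps algebra_simps scaleC_add_right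
      scaleC_scaleC scaleC_mult_left scaleC_mult_right)+

text \<open>Self-adjointness, the square, and the intertwining relation \<open>S c = c.s\<close> are the only properties of
  \<open>S = (Id - c c\<^sup>*)\<^sup>1\<^sup>/\<^sup>2\<close> on which the computations with \<open>g\<^sub>c\<close> rest.\<close>

lemma defect_op_props:
  assumes c: "norm c < 1"
  shows "lip (defect_op c x) y = lip x (defect_op c y)"
    "defect_op c (defect_op c x) = x - uact c (lip c x)"
    "defect_op c c = uact c (defect c)"
    "defect_op c (x + y) = defect_op c x + defect_op c y"
    "defect_op c (k *\<^sub>C x) = k *\<^sub>C defect_op c x"
    "v \<in> Atilde \<Longrightarrow> defect_op c (uact x v) = uact (defect_op c x) v"
    "adjointable act ip (defect_op c)"
proof -
  note k = one_plus_defect_inv_props[OF c] and d = defect_props[OF c]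
  have km: "- one_plus_defect_inv c \<in> Atilde" using k by (intro uz.C_intros)
  show "adjointable act ip (defect_op c)" unfolding defect_op_def by (rule rank_one_pert_adjointable[OF km])
  show "lip (defect_op c x) y = lip x (defect_op c y)"
    unfolding defect_op_def rank_one_pert_adjoint[OF km] using k by (simp add: uz.st_minus)
  show "defect_op c (x + y) = defect_op c x + defect_op c y"
    "defect_op c (k *\<^sub>C x) = k *\<^sub>C defect_op c x"
    "v \<in> Atilde \<Longrightarrow> defect_op c (uact x v) = uact (defect_op c x) v"
    unfolding defect_op_def by (simp_all add: rank_one_pert_linear km)
  have "defect_op c (defect_op c x) = rank_one_pert c 1 (- one_plus_defect_inv c - one_plus_defect_inv c + one_plus_defect_inv c * lip c c * one_plus_defect_inv c) x"
    unfolding defect_op_def by (subst rank_one_pert_compose[OF km km]) simp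
  also have "- one_plus_defect_inv c - one_plus_defect_inv c + one_plus_defect_inv c * lip c c * one_plus_defect_inv c = - 1" using k(6) by (simp add: algebra_simps)
  also have "rank_one_pert c 1 (- 1) x = x - uact c (lip c x)"
    by (rule lip_eqI) (simp add: lip_rank_one_pert Atilde_intros lip_simps lip_uact lip_mem)
  finally show "defect_op c (defect_op c x) = x - uact c (lip c x)" .
  show "defect_op c c = uact c (defect c)"
    by (rule lip_eqI) (simp add: defect_op_def lip_rank_one_pert km lip_uact d mult.assoc k algebra_simps)
qed

text \<open>The closed form determines the spectrum: for \<open>a\<close> outside \<open>[0, \<infinity>)\<close> and \<open>b = a - 1\<close> the operator
  \<open>a - S = b Id + c (1 + s)\<^sup>-\<^sup>1 c\<^sup>*\<close> has an inverse of the same shape, built from the inverse of \<open>a - s\<close>.  That \<open>S\<close> is the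
  only positive root follows from uniqueness of roots in the algebra of adjointable maps.\<close>

lemma defect_op_eq_pos_sqrt:
  assumes c: "norm c < 1"
  shows "pos_sqrt Adj (\<one>\<^bsub>Adj\<^esub> \<ominus>\<^bsub>Adj\<^esub> rank_one act ip c) = defect_op c"
proof (rule op.pos_sqrt_eqI)
  note k = one_plus_defect_inv_props[OF c] and d = defect_props[OF c] and D = defect_op_props[OF c]
  have minus: "(f \<ominus>\<^bsub>Adj\<^esub> g) = (\<lambda>z. f z - g z)" if "adjointable act ip g" for f g
    using that by (simp add: a_minus_def op.a_inv_eq Adj_simps scaleC_minus_left)
  have r: "rank_one act ip c = rank_one_pert c 0 1" by (rule ext) (simp add: rank_one_pert_def rank_one_eq)
  have ra: "adjointable act ip (rank_one act ip c)"
    unfolding r by (rule rank_one_pert_adjointable[OF uz.one_C])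
  show "defect_op c \<otimes>\<^bsub>Adj\<^esub> defect_op c = \<one>\<^bsub>Adj\<^esub> \<ominus>\<^bsub>Adj\<^esub> rank_one act ip c"
    unfolding minus[OF ra] by (simp add: Adj_simps(2,3) fun_eq_iff D rank_one_eq)
  show "positive Adj (defect_op c)"
    unfolding positive_def
  proof (intro conjI subsetI)
    show "defect_op c \<in> carrier Adj" using D by (simp add: Adj_simps(1))
    show "invol Adj (defect_op c) = defect_op c" by (rule invol_eqI) (rule D)
    fix a assume a: "a \<in> spectrum Adj (defect_op c)"
    show "a \<in> \<real>\<^sub>\<ge>\<^sub>0"
    proof (rule ccontr)
      assume na: "a \<notin> \<real>\<^sub>\<ge>\<^sub>0"
      let ?s = "defect c" and ?k = "one_plus_defect_inv c"
      define b where "b = a - 1"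
      have b: "b \<noteq> 0" using na by (auto simp: b_def)
      obtain n where n: "n \<in> Atilde" "(a *\<^sub>C 1 - ?s) * n = 1" "n * (a *\<^sub>C 1 - ?s) = 1"
        using uz.psd_resolvent[OF d(3) na] by (auto simp: invertible_in_def)
      \<comment> \<open>The solution of \<open>b v + b\<^sup>-\<^sup>1 w + w p v = 0\<close> with \<open>w = (1 + s)\<^sup>-\<^sup>1\<close>, since \<open>w p = 1 - s\<close> and \<open>b + 1 - s = a - s\<close>.\<close>
      define v where "v = (- inverse b) *\<^sub>C (?k * n)"
      have v: "v \<in> Atilde" by (simp add: v_def Atilde_intros k n)
      have kk: "(a *\<^sub>C 1 - ?s) * ?k = ?k * (a *\<^sub>C 1 - ?s)"
        using k(3) by (simp add: algebra_simps scaleC_mult_left scaleC_mult_right)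
      have 1: "(a *\<^sub>C 1 - ?s) * v = - (inverse b *\<^sub>C ?k)"
        unfolding v_def scaleC_mult_right mult.assoc[symmetric] kk using n by (simp add: mult.assoc scaleC_minus_left)
      have 2: "v * (a *\<^sub>C 1 - ?s) = - (inverse b *\<^sub>C ?k)"
        unfolding v_def scaleC_mult_left using n by (simp add: mult.assoc scaleC_minus_left)
      have x: "a \<odot>\<^bsub>Adj\<^esub> \<one>\<^bsub>Adj\<^esub> \<ominus>\<^bsub>Adj\<^esub> defect_op c = rank_one_pert c b ?k"
        by (subst minus[OF D(7)], rule ext, rule lip_eqI)
          (simp add: Adj_simps(3,6) lip_simps lip_rank_one_pert k defect_op_def Atilde_intros b_def scaleC_diff_left)
      have 3: "b *\<^sub>C v + inverse b *\<^sub>C ?k + ?k * lip c c * v = 0"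
        using 1 unfolding k(4) by (simp add: b_def algebra_simps scaleC_diff_left scaleC_mult_left)
      have 4: "inverse b *\<^sub>C ?k + b *\<^sub>C v + v * lip c c * ?k = 0"
        using 2 unfolding mult.assoc k(5) by (simp add: b_def algebra_simps scaleC_diff_left scaleC_mult_right)
      have "rank_one_pert c b ?k \<circ> rank_one_pert c (inverse b) v = id"
        "rank_one_pert c (inverse b) v \<circ> rank_one_pert c b ?k = id"
        using b rank_one_pert_one[of c] 3 4
        by (auto simp: fun_eq_iff rank_one_pert_compose k v)
      moreover have "adjointable act ip (rank_one_pert c b ?k)" "adjointable act ip (rank_one_pert c (inverse b) v)"
        by (intro rank_one_pert_adjointable k v)+
      ultimately have "rank_one_pert c b ?k \<in> Units Adj"
        unfolding Units_def Adj_simps(1-3) by blast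
      then show False using a by (simp add: spectrum_def x)
    qed
  qed
qed

lemma one_plus_lip:
  assumes c: "norm c < 1" and x: "norm x < 1"
  shows "invertible_in Atilde (1 + lip c x)" "norm (inv_in Atilde (1 + lip c x)) \<le> 1 / (1 - norm c)"
proof -
  have "norm (lip c x) \<le> norm c * norm x" by (rule norm_lip)
  also have "\<dots> \<le> norm c" using x by (simp add: mult_left_le)
  finally have n: "norm (lip c x) \<le> norm c" .
  show i: "invertible_in Atilde (1 + lip c x)"
    using uz.invertible_one_minus[of "- lip c x"] n c by (simp add: uz.uminus_C lip_mem)
  let ?q = "inv_in Atilde (1 + lip c x)"
  have "?q = 1 - lip c x * ?q" using inv_in(2)[OF i] by (simp add: algebra_simps)
  then have "norm ?q \<le> norm (1::'a bop) + norm (lip c x * ?q)" by (metis norm_triangle_ineq4)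
  also have "\<dots> \<le> 1 + norm c * norm ?q"
    by (intro add_mono norm_one_le order_trans[OF norm_mult_ineq mult_right_mono[OF n]]) simp
  finally show "norm ?q \<le> 1 / (1 - norm c)" using c by (simp add: field_simps)
qed

lemma one_plus_emb_Units:
  assumes "norm c < 1" "norm x < 1"
  shows "\<one>\<^bsub>unitization\<^esub> \<oplus>\<^bsub>unitization\<^esub> emb (ip c x) \<in> Units unitization"
  using one_plus_lip(1)[OF assms]
  by (simp add: uz.Units_iff uz.carrier_intros emb_carrier uz.rep_hom lip_def)

lemma moebius_map_eq:
  assumes c: "norm c < 1" and x: "norm x < 1"
  shows "moebius_map act ip c x = c + defect_op c (uact x (inv_in Atilde (1 + lip c x) * defect c))"
proof -
  let ?u = "\<one>\<^bsub>unitization\<^esub> \<oplus>\<^bsub>unitization\<^esub> emb (ip c x)"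
  have u: "?u \<in> Units unitization" by (rule one_plus_emb_Units[OF c x])
  have ru: "unitization_rep ?u = 1 + lip c x" by (simp add: uz.carrier_intros emb_carrier uz.rep_hom lip_def)
  note iu = uz.inv_rep[OF u, unfolded ru]
  have ri: "unitization_rep (inv\<^bsub>unitization\<^esub> ?u) = inv_in Atilde (1 + lip c x)"
    using iu by (intro inv_in_eq[symmetric]) (auto simp: mult.commute)
  show ?thesis
    unfolding moebius_map_def Let_def defect_op_eq_pos_sqrt[OF c]
    using iu(1) defect_props(1)[OF c]
    by (simp add: unitized_act_uact uz.carrier_intros uz.rep_hom ri defect_def)
qed

lemma defect_uminus: "defect (- c) = defect c"
proof -
  have "ip (- c) (- c) = ip c c" using ip_scaleC_left[of "-1" c "- c"] ip_scaleC_right[of c "-1" c]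
    by (simp add: scaleC_minus_left scaleC_minus_right)
  then show ?thesis by (simp add: defect_def modulus_def)
qed

lemma lip_uminus: "lip (- c) x = - lip c x" "lip x (- c) = - lip x c"
  using lip_diff_left[of 0 c x] lip_simps(3)[of x 0 c] lip_diff_left[of c c x] lip_simps(3)[of x c c] by auto

lemma defect_op_uminus: "norm c < 1 \<Longrightarrow> defect_op (- c) = defect_op c"
  using one_plus_defect_inv_props(1)[of c] one_plus_defect_inv_props(1)[of "- c"]
  by (intro ext lip_eqI) (simp add: defect_op_def lip_rank_one_pert one_plus_defect_inv_def defect_uminus lip_uminus uz.uminus_C)

text \<open>Both identities follow from \<open>\<langle>c, S y\<rangle> = s \<langle>c, y\<rangle>\<close>, \<open>\<langle>S y, S y\<rangle> = \<langle>y, y\<rangle> - \<langle>y, c\<rangle>\<langle>c, y\<rangle>\<close> and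
  \<open>1 - \<langle>c, x\<rangle> q = q\<close> by expanding the inner products of \<open>g = c + S y\<close>, where \<open>y = x.(q s)\<close>.\<close>

lemma moebius_defect_identities:
  assumes c: "norm c < 1" and x: "norm x < 1"
  defines "q \<equiv> inv_in Atilde (1 + lip c x)" and "g \<equiv> moebius_map act ip c x"
  shows "1 - lip g g = adj (q * defect c) * (1 - lip x x) * (q * defect c)"
    and "1 - lip c g = defect c * q * defect c"
proof -
  note d = defect_props[OF c] and D = defect_op_props[OF c]
  let ?s = "defect c"
  define t where "t = lip c x"
  define y where "y = uact x (q * ?s)"
  note qq = inv_in[OF one_plus_lip(1)[OF c x], folded q_def t_def]
  have qs: "q * ?s \<in> Atilde" using d qq by (intro uz.mult_C)
  have tm: "t \<in> Atilde" by (simp add: t_def lip_mem)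
  have g: "g = c + defect_op c y" unfolding g_def moebius_map_eq[OF c x] y_def q_def ..
  have tq: "1 - t * q = q" using qq(2) by (simp add: algebra_simps)
  have "adj (1 - t * q) = adj q" by (simp add: tq)
  then have tq': "1 - adj q * adj t = adj q" using qq tm by (simp add: uz.st_diff uz.st_mult uz.st_one Atilde_intros)
  have cy: "lip c (defect_op c y) = ?s * (t * q) * ?s"
    by (simp add: D(3) lip_uact_left d y_def lip_uact qs t_def mult.assoc flip: D(1))
  have yc: "lip (defect_op c y) c = ?s * (adj q * adj t) * ?s"
  proof -
    have "lip (defect_op c y) c = adj (lip c (defect_op c y))" by (simp add: adj_lip)
    also have "\<dots> = ?s * (adj q * adj t) * ?s" unfolding cy using d tm qq
      by (simp add: uz.st_mult Atilde_intros mult.assoc)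
    finally show ?thesis .
  qed
  have yy: "lip (defect_op c y) (defect_op c y) = ?s * (adj q * lip x x * q) * ?s - ?s * (adj q * adj t * (t * q)) * ?s"
  proof -
    have "lip (defect_op c y) (defect_op c y) = lip y y - lip y c * lip c y"
      by (simp add: D(1,2) lip_simps lip_uact lip_mem)
    also have "lip y y = ?s * (adj q * lip x x * q) * ?s"
      by (simp add: y_def lip_uact lip_uact_left qs uz.st_mult qq d mult.assoc)
    also have "lip c y = t * q * ?s" by (simp add: y_def lip_uact qs t_def mult.assoc)
    also have "lip y c = ?s * adj q * adj t" by (simp add: y_def lip_uact_left qs t_def adj_lip uz.st_mult qq d)
    finally show ?thesis by (simp add: mult.assoc)
  qed
  have p: "lip c c = 1 - ?s * ?s" using d(5) by simp
  have "1 - lip g g = ?s * ((1 - adj q * adj t) * (1 - t * q) - adj q * lip x x * q) * ?s"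
    unfolding g by (simp add: lip_simps cy yc yy p algebra_simps)
  also have "\<dots> = adj (q * ?s) * (1 - lip x x) * (q * ?s)"
    unfolding tq tq' by (simp add: uz.st_mult qq d algebra_simps)
  finally show "1 - lip g g = adj (q * ?s) * (1 - lip x x) * (q * ?s)" .
  have "1 - lip c g = ?s * (1 - t * q) * ?s" unfolding g by (simp add: lip_simps cy p algebra_simps)
  then show "1 - lip c g = ?s * q * ?s" by (simp only: tq)
qed

text \<open>By the first identity \<open>1 - \<langle>g, g\<rangle>\<close> is positive and invertible, hence bounded below by some \<open>r > 0\<close>.\<close>

lemma norm_moebius:
  assumes c: "norm c < 1" and x: "norm x < 1"
  shows "norm (moebius_map act ip c x) < 1"
proof -
  define q where "q = inv_in Atilde (1 + lip c x)"
  define g where "g = moebius_map act ip c x"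
  note d = defect_props[OF c]
  note qq = inv_in[OF one_plus_lip(1)[OF c x], folded q_def]
  have b: "q * defect c \<in> Atilde" using d qq by (intro uz.mult_C)
  have "invertible_in Atilde q" unfolding invertible_in_def
    using qq by (intro bexI[of _ "1 + lip c x"] conjI Atilde_intros lip_mem)
  then have bi: "invertible_in Atilde (q * defect c)" by (rule uz.invertible_mult) (rule d)
  have abi: "invertible_in Atilde (adj (q * defect c))"
  proof -
    obtain n where n: "n \<in> Atilde" "(q * defect c) * n = 1" "n * (q * defect c) = 1" using bi by (auto simp: invertible_in_def)
    then have "adj n * adj (q * defect c) = 1" "adj (q * defect c) * adj n = 1"
      using b by (metis uz.st_mult uz.st_one)+
    then show ?thesis unfolding invertible_in_def using uz.st_C[OF n(1)] by blast
  qed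
  have nx: "norm (lip x x) < 1" using x by (simp add: power_less_one_iff flip: norm_square)
  have "uz.psd (1 - lip x x)" using uz.psd_norm_minus[of "lip x x" 1] nx uz.psd_sa[OF psd_lip] by simp
  then have psd: "uz.psd (1 - lip g g)"
    unfolding g_def moebius_defect_identities(1)[OF c x] q_def[symmetric] by (rule uz.psd_conj[OF _ b])
  have "invertible_in Atilde (1 - lip g g)"
    unfolding g_def moebius_defect_identities(1)[OF c x] q_def[symmetric]
    by (intro uz.invertible_mult abi bi uz.invertible_one_minus lip_mem nx)
  then obtain e where e: "e > 0" "uz.psd (1 - lip g g - e *\<^sub>R 1)" using uz.psd_invertible_lower_bound[OF psd] by blast
  \<comment> \<open>The bound is kept below \<open>1\<close>, so that \<open>1 - r\<close> is an admissible bound for a norm even if \<open>A = 0\<close>.\<close>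
  define r where "r = min e (1/2)"
  have r: "r > 0" "r \<le> e" "r < 1" using e by (auto simp: r_def)
  have "uz.psd ((1 - lip g g - e *\<^sub>R 1) + (e - r) *\<^sub>R 1)" using r e(2) by (intro uz.psd_add uz.psd_scaleR_one) auto
  then have "uz.psd ((1 - r) *\<^sub>R 1 - lip g g)" by (simp add: algebra_simps)
  then have "norm (lip g g) \<le> 1 - r" using r by (intro uz.norm_le_of_psd_diff psd_lip) auto
  then have "(norm g)\<^sup>2 < 1" using r by (simp add: norm_square)
  then show ?thesis unfolding g_def by (simp add: power_less_one_iff)
qed

text \<open>By the second identity the factor \<open>(\<one> - \<langle>c, g\<rangle>)\<^sup>-\<^sup>1 s\<close> in \<open>g\<^sub>-\<^sub>c(g)\<close> is \<open>s\<^sup>-\<^sup>1(\<one> + \<langle>c, x\<rangle>)\<close>, which undoes the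
  factor \<open>q s\<close> in \<open>g\<close>; the rest is \<open>S c = c.s\<close> and \<open>S\<^sup>2 = Id - c c\<^sup>*\<close>.\<close>

lemma moebius_inverse:
  assumes c: "norm c < 1" and x: "norm x < 1"
  shows "moebius_map act ip (- c) (moebius_map act ip c x) = x"
proof -
  define q where "q = inv_in Atilde (1 + lip c x)"
  define g where "g = moebius_map act ip c x"
  define t where "t = lip c x"
  note d = defect_props[OF c] and D = defect_op_props[OF c]
  let ?s = "defect c"
  note qq = inv_in[OF one_plus_lip(1)[OF c x], folded q_def t_def]
  define r where "r = inv_in Atilde ?s"
  note rr = inv_in[OF d(6), folded r_def]
  have tm: "t \<in> Atilde" by (simp add: t_def lip_mem)
  have g1: "norm g < 1" unfolding g_def by (rule norm_moebius[OF c x])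
  have i: "inv_in Atilde (1 + lip (- c) g) = r * (1 + t) * r"
  proof (rule inv_in_eq)
    have e: "1 + lip (- c) g = ?s * q * ?s" using moebius_defect_identities(2)[OF c x] by (simp add: lip_uminus g_def q_def)
    show "r * (1 + t) * r \<in> Atilde" using rr tm by (intro Atilde_intros)
    have "?s * q * ?s * (r * (1 + t) * r) = ?s * (q * ((?s * r) * (1 + t))) * r" by (simp only: mult.assoc)
    then show "(1 + lip (- c) g) * (r * (1 + t) * r) = 1" unfolding e by (simp add: rr qq)
    have "r * (1 + t) * r * (?s * q * ?s) = r * ((1 + t) * ((r * ?s) * q)) * ?s" by (simp only: mult.assoc)
    then show "r * (1 + t) * r * (1 + lip (- c) g) = 1" unfolding e by (simp add: rr qq)
  qed
  have m: "r * (1 + t) \<in> Atilde" "q * ?s \<in> Atilde" by (simp_all add: Atilde_intros rr tm qq d)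
  have w: "r * (1 + t) * r * ?s = r * (1 + t)" by (simp add: mult.assoc rr)
  have g: "g = c + defect_op c (uact x (q * ?s))" unfolding g_def moebius_map_eq[OF c x] q_def ..
  have "(q * ?s) * (r * (1 + t)) = q * ((?s * r) * (1 + t))" by (simp only: mult.assoc)
  then have z: "(q * ?s) * (r * (1 + t)) = 1" by (simp add: rr qq)
  have "?s * (r * (1 + t)) = (?s * r) * (1 + t)" by (simp only: mult.assoc)
  then have z2: "?s * (r * (1 + t)) = 1 + t" by (simp add: rr)
  have "uact g (r * (1 + t)) = uact c (r * (1 + t)) + defect_op c (uact (uact x (q * ?s)) (r * (1 + t)))"
    unfolding g by (simp only: uact_simps(4)[OF m(1)] D(6)[OF m(1)])
  also have "uact (uact x (q * ?s)) (r * (1 + t)) = x"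
    using uact_simps(1)[OF m(2,1), of x] by (simp only: z uact_simps(8))
  finally have u: "uact g (r * (1 + t)) = uact c (r * (1 + t)) + defect_op c x" .
  have "defect_op c (uact c (r * (1 + t))) = uact (uact c ?s) (r * (1 + t))" by (simp only: D(6)[OF m(1)] D(3))
  also have "\<dots> = uact c (1 + t)" using uact_simps(1)[OF d(2) m(1), of c] by (simp only: z2)
  finally have v: "defect_op c (uact c (r * (1 + t))) = c + uact c t"
    using uact_simps(2)[OF uz.one_C tm, of c] by (simp only: uact_simps(8))
  have "moebius_map act ip (- c) g = - c + defect_op c (uact g (r * (1 + t)))"
    using c g1 by (subst moebius_map_eq) (simp_all add: i defect_uminus defect_op_uminus w)
  also have "defect_op c (uact g (r * (1 + t))) = c + x"
    unfolding u D(4) v D(2) by (simp add: t_def)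
  finally show ?thesis by (simp add: g_def)
qed

text \<open>With \<open>q x = (\<one> + \<langle>c, x\<rangle>)\<^sup>-\<^sup>1\<close>, the resolvent identity \<open>q (x + h) - q x = - q (x + h) \<langle>c, h\<rangle> q x\<close> gives
  the derivative of \<open>x.q x\<close> with a quadratic remainder.\<close>

lemma moebius_holomorphic:
  assumes c: "norm c < 1" shows "holomorphic_map_on (moebius_map act ip c) (ball 0 1)"
proof -
  note d = defect_props[OF c] and D = defect_op_props[OF c]
  define q where "q x = inv_in Atilde (1 + lip c x)" for x
  define N where "N = 1 / (1 - norm c)"
  have N: "N \<ge> 0" using c by (simp add: N_def)
  have qm: "q x \<in> Atilde" "(1 + lip c x) * q x = 1" "q x * (1 + lip c x) = 1" "norm (q x) \<le> N" if "norm x < 1" for x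
    using inv_in[OF one_plus_lip(1)[OF c that]] one_plus_lip(2)[OF c that] by (auto simp: q_def N_def)
  define F where "F x = uact x (q x)" for x
  define dF where "dF x h = uact h (q x) - uact x (q x * lip c h * q x)" for x h
  have dm: "q x * lip c h * q x \<in> Atilde" if "norm x < 1" for x h
    using qm(1)[OF that] lip_mem by (intro uz.mult_C)
  have bl: "bounded_linear (dF x)" if x: "norm x < 1" for x
    unfolding dF_def
  proof (rule bounded_linear_sub[OF bounded_linear_uact[OF qm(1)[OF x]]])
    show "bounded_linear (\<lambda>h. uact x (q x * lip c h * q x))"
    proof (rule bounded_linear_intro[where K="norm x * (norm (q x) * norm c * norm (q x))"])
      note m = dm[OF x]
      show "uact x (q x * lip c (h + h') * q x) = uact x (q x * lip c h * q x) + uact x (q x * lip c h' * q x)" for h h'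
        by (simp only: uact_simps(2)[OF m m, symmetric] lip_simps distrib_left distrib_right)
      show "uact x (q x * lip c (r *\<^sub>R h) * q x) = r *\<^sub>R uact x (q x * lip c h * q x)" for r h
        by (simp only: uact_simps(7)[OF m, symmetric] scaleR_scaleC lip_simps scaleC_mult_left scaleC_mult_right)
      fix h
      have "norm (q x * lip c h * q x) \<le> norm (q x) * (norm c * norm h) * norm (q x)"
        by (intro order_trans[OF norm_mult_ineq] mult_mono order_refl norm_lip) auto
      then have "norm (uact x (q x * lip c h * q x)) \<le> norm x * (norm (q x) * (norm c * norm h) * norm (q x))"
        by (intro order_trans[OF norm_uact[OF m]] mult_left_mono) auto
      then show "norm (uact x (q x * lip c h * q x)) \<le> norm h * (norm x * (norm (q x) * norm c * norm (q x)))"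
        by (simp add: mult_ac)
    qed
  qed
  have dF: "(F has_derivative dF x) (at x)" if x: "norm x < 1" for x
  proof (rule has_derivative_of_quadratic_remainder[where U="ball 0 1" and K="N * N + N * N * N"])
    show "bounded_linear (dF x)" by (rule bl[OF x])
    fix y :: 'e assume "y \<in> ball 0 1"
    then have y: "norm y < 1" by simp
    define h where "h = y - x"
    define l where "l = lip c h"
    have yh: "y = x + h" by (simp add: h_def)
    have lm: "l \<in> Atilde" by (simp add: l_def lip_mem)
    have ly: "1 + lip c y = 1 + lip c x + l" by (simp add: yh l_def lip_simps)
    have nl: "norm l \<le> norm h"
      unfolding l_def using norm_lip[of c h] c by (meson less_imp_le mult_left_le_one_le norm_ge_zero order_trans)
    have dq: "q y - q x = - (q y * l * q x)"
    proof -
      have "q y * (1 + lip c y) * q x = q x" by (simp add: qm y)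
      moreover have "q y * (1 + lip c x) * q x = q y" by (simp add: qm x mult.assoc)
      moreover have "q y * (1 + lip c y) * q x = q y * (1 + lip c x) * q x + q y * l * q x"
        unfolding ly by (simp only: distrib_left distrib_right)
      ultimately have "q x = q y + q y * l * q x" by simp
      then show ?thesis by (simp add: algebra_simps)
    qed
    have dq2: "q y - q x + q x * l * q x = q y * l * q x * l * q x"
    proof -
      have "q y - q x + q x * l * q x = (q x - q y) * l * q x" unfolding dq by (simp add: algebra_simps)
      also have "q x - q y = q y * l * q x" by (metis dq minus_diff_eq minus_minus)
      finally show ?thesis .
    qed
    note m = qm(1)[OF x] qm(1)[OF y] dm[OF x, of h, folded l_def] lm
    have "F y - F x - dF x (y - x) = uact x (q y) + uact h (q y) - uact x (q x) - uact h (q x) + uact x (q x * l * q x)"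
      unfolding F_def dF_def h_def[symmetric] yh by (simp add: l_def uact_simps(4) m(2)[unfolded yh])
    also have "\<dots> = uact x (q y - q x + q x * l * q x) + uact h (q y - q x)"
      using m by (simp add: uact_simps uz.diff_C)
    also have "\<dots> = uact x (q y * l * q x * l * q x) + uact h (- (q y * l * q x))" unfolding dq2 by (simp only: dq)
    finally have e: "F y - F x - dF x (y - x) = uact x (q y * l * q x * l * q x) + uact h (- (q y * l * q x))" .
    have n1: "norm (q y * l * q x) \<le> N * norm h * N"
      by (intro order_trans[OF norm_mult_ineq] mult_mono qm x y nl) (auto simp: N)
    have n2: "norm (q y * l * q x * l * q x) \<le> N * norm h * N * norm h * N"
      by (intro order_trans[OF norm_mult_ineq] mult_mono qm x y nl n1) (auto simp: N)
    have m1: "q y * l * q x \<in> Atilde" "q y * l * q x * l * q x \<in> Atilde" by (intro uz.mult_C m; fail)+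
    have "norm (uact x (q y * l * q x * l * q x)) \<le> 1 * (N * norm h * N * norm h * N)"
      by (intro order_trans[OF norm_uact[OF m1(2)]] mult_mono n2) (use x in auto)
    moreover have "norm (uact h (- (q y * l * q x))) \<le> norm h * (N * norm h * N)"
      by (intro order_trans[OF norm_uact[OF uz.uminus_C[OF m1(1)]]] mult_left_mono) (use n1 in auto)
    ultimately have "norm (F y - F x - dF x (y - x)) \<le> 1 * (N * norm h * N * norm h * N) + norm h * (N * norm h * N)"
      unfolding e by (rule norm_triangle_mono)
    also have "\<dots> = (N * N + N * N * N) * (norm h)\<^sup>2" by (simp add: power2_eq_square algebra_simps)
    finally show "norm (F y - F x - dF x (y - x)) \<le> (N * N + N * N * N) * (norm (y - x))\<^sup>2" by (simp add: h_def)
  qed (use x in auto)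
  define G where "G x = c + defect_op c (uact (F x) (defect c))" for x
  have bS: "bounded_linear (\<lambda>z. defect_op c (uact z (defect c)))"
    by (intro bounded_linear_compose[OF adjointable_bounded[OF D(7)]] bounded_linear_uact d)
  have "holomorphic_map_on G (ball 0 1)"
    unfolding holomorphic_map_on_def
  proof
    fix x :: 'e assume "x \<in> ball 0 1"
    then have x: "norm x < 1" by simp
    have "(G has_derivative (\<lambda>h. 0 + defect_op c (uact (dF x h) (defect c)))) (at x)"
      unfolding G_def by (intro has_derivative_add has_derivative_const bounded_linear.has_derivative[OF bS] dF x)
    moreover have "complex_linear (\<lambda>h. 0 + defect_op c (uact (dF x h) (defect c)))"
    proof -
      note m = dm[OF x] qm(1)[OF x] d(2)
      have "dF x (h + h') = dF x h + dF x h'" for h h'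
        using linear_add[OF bounded_linear.linear[OF bl[OF x]]] .
      moreover have "dF x (k *\<^sub>C h) = k *\<^sub>C dF x h" for k h
        unfolding dF_def using m by (simp add: uact_simps lip_simps scaleC_mult_left scaleC_mult_right scaleC_diff_right)
      ultimately show ?thesis unfolding complex_linear_def using m by (simp add: uact_simps D)
    qed
    ultimately show "\<exists>D. (G has_derivative D) (at x) \<and> complex_linear D" by blast
  qed
  then show ?thesis
  proof (rule holomorphic_map_on_cong[rotated 2])
    fix x :: 'e assume "x \<in> ball 0 1"
    then have x: "norm x < 1" by simp
    show "G x = moebius_map act ip c x"
      unfolding G_def F_def moebius_map_eq[OF c x] using uact_simps(1)[OF qm(1)[OF x] d(2), of x] by (simp add: q_def)
  qed simp
qed

lemma moebius_automorphism:
  assumes c: "norm c < 1" shows "holomorphic_automorphism (ball 0 1) (moebius_map act ip c)"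
proof (rule holomorphic_automorphismI[where g="moebius_map act ip (- c)"])
  have c': "norm (- c) < 1" using c by simp
  show "holomorphic_map_on (moebius_map act ip c) (ball 0 1)" "holomorphic_map_on (moebius_map act ip (- c)) (ball 0 1)"
    by (intro moebius_holomorphic c c')+
  show "moebius_map act ip c ` ball 0 1 \<subseteq> ball 0 1" "moebius_map act ip (- c) ` ball 0 1 \<subseteq> ball 0 1"
    using norm_moebius c c' by auto
  show "moebius_map act ip (- c) (moebius_map act ip c x) = x" if "x \<in> ball 0 1" for x
    using moebius_inverse[OF c] that by simp
  show "moebius_map act ip c (moebius_map act ip (- c) x) = x" if "x \<in> ball 0 1" for x
    using moebius_inverse[OF c'] that by simp
qed simp

lemma moebius_zero: assumes c: "norm c < 1" shows "moebius_map act ip c 0 = c"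
proof -
  have "inv_in Atilde (1 + lip c 0) * defect c \<in> Atilde"
    using inv_in(1)[OF one_plus_lip(1)[OF c, of 0]] defect_props(2)[OF c] by (simp add: uz.mult_C)
  then have "uact 0 (inv_in Atilde (1 + lip c 0) * defect c) = 0"
    using linear_0[OF bounded_linear.linear[OF bounded_linear_uact]] by blast
  moreover have "defect_op c 0 = 0" using defect_op_props(5)[OF c, of 0 0] by simp
  ultimately show ?thesis by (simp add: moebius_map_eq[OF c, of 0])
qed

end

section \<open>Norming functionals\<close>

definition sublinear :: "('a::real_normed_vector \<Rightarrow> real) \<Rightarrow> bool" where
  "sublinear q \<longleftrightarrow> (\<forall>x y. q (x + y) \<le> q x + q y) \<and> (\<forall>t>0. \<forall>x. q (t *\<^sub>R x) \<le> t * q x) \<and> (\<forall>x. q x \<le> norm x)"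

lemma sublinearD:
  assumes "sublinear q"
  shows "q (x + y) \<le> q x + q y" "t > 0 \<Longrightarrow> q (t *\<^sub>R x) = t * q x" "q x \<le> norm x" "q 0 = 0" "- q (- x) \<le> q x"
proof -
  show add: "q (x + y) \<le> q x + q y" for x y using assms by (simp add: sublinear_def)
  have le: "t > 0 \<Longrightarrow> q (t *\<^sub>R x) \<le> t * q x" for t x using assms by (simp add: sublinear_def)
  show eq: "t > 0 \<Longrightarrow> q (t *\<^sub>R x) = t * q x" for t x
    using le[of t x] le[of "1/t" "t *\<^sub>R x"] by (simp add: field_simps)
  show "q x \<le> norm x" using assms by (simp add: sublinear_def)
  show z: "q 0 = 0" using eq[of 2 0] by simp
  show "- q (- x) \<le> q x" using add[of x "-x"] z by simp
qed

lemma sublinear_norm: "sublinear norm"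
  by (simp add: sublinear_def norm_triangle_ineq)

text \<open>The largest sublinear functional below \<open>q\<close> whose value at \<open>- z\<close> is at most \<open>- q z\<close>.  A
  functional that does not change under any of these operations is additive.\<close>

definition shifted :: "('a::real_normed_vector \<Rightarrow> real) \<Rightarrow> 'a \<Rightarrow> 'a \<Rightarrow> real" where
  "shifted q z x = (INF t\<in>{0..}. q (x + t *\<^sub>R z) - t * q z)"

lemma shifted_le:
  assumes q: "sublinear q" and t: "t \<ge> 0" shows "shifted q z x \<le> q (x + t *\<^sub>R z) - t * q z"
  unfolding shifted_def
proof (rule cINF_lower)
  show "bdd_below ((\<lambda>t. q (x + t *\<^sub>R z) - t * q z) ` {0..})"
  proof (rule bdd_belowI2)
    fix t :: real assume "t \<in> {0..}"
    then have "q (t *\<^sub>R z) = t * q z" using sublinearD[OF q] by (cases "t = 0") auto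
    moreover have "q (t *\<^sub>R z) \<le> q (x + t *\<^sub>R z) + q (- x)" using sublinearD(1)[OF q, of "x + t *\<^sub>R z" "- x"] by simp
    ultimately show "- q (- x) \<le> q (x + t *\<^sub>R z) - t * q z" by simp
  qed
qed (use t in auto)

lemma shifted_greatest:
  assumes "\<And>t. t \<ge> 0 \<Longrightarrow> b \<le> q (x + t *\<^sub>R z) - t * q z" shows "b \<le> shifted q z x"
  unfolding shifted_def using assms by (intro cINF_greatest) auto

lemma shifted_le_self: "sublinear q \<Longrightarrow> shifted q z x \<le> q x"
  using shifted_le[of q 0 z x] by simp

lemma sublinear_shifted: assumes q: "sublinear q" shows "sublinear (shifted q z)"
  unfolding sublinear_def
proof (intro conjI allI impI)
  fix x y
  have 1: "shifted q z (x + y) \<le> (q (x + s *\<^sub>R z) - s * q z) + (q (y + t *\<^sub>R z) - t * q z)" if "s \<ge> 0" "t \<ge> 0" for s t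
    using shifted_le[OF q, of "s + t" z "x + y"] that sublinearD(1)[OF q, of "x + s *\<^sub>R z" "y + t *\<^sub>R z"]
    by (simp add: algebra_simps)
  have "shifted q z (x + y) - shifted q z y \<le> q (x + s *\<^sub>R z) - s * q z" if s: "s \<ge> 0" for s
  proof -
    have "shifted q z (x + y) - (q (x + s *\<^sub>R z) - s * q z) \<le> shifted q z y"
      by (rule shifted_greatest) (use 1[OF s] in \<open>simp add: algebra_simps\<close>)
    then show ?thesis by simp
  qed
  then have "shifted q z (x + y) - shifted q z y \<le> shifted q z x" by (rule shifted_greatest)
  then show "shifted q z (x + y) \<le> shifted q z x + shifted q z y" by simp
next
  fix r :: real and x assume r: "r > 0"
  have "shifted q z (r *\<^sub>R x) / r \<le> shifted q z x"
  proof (rule shifted_greatest)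
    fix t :: real assume t: "t \<ge> 0"
    have "shifted q z (r *\<^sub>R x) \<le> q (r *\<^sub>R x + (r * t) *\<^sub>R z) - (r * t) * q z"
      using r t by (intro shifted_le q) auto
    also have "r *\<^sub>R x + (r * t) *\<^sub>R z = r *\<^sub>R (x + t *\<^sub>R z)" by (simp add: algebra_simps)
    also have "q (r *\<^sub>R (x + t *\<^sub>R z)) = r * q (x + t *\<^sub>R z)" by (rule sublinearD(2)[OF q r])
    finally show "shifted q z (r *\<^sub>R x) / r \<le> q (x + t *\<^sub>R z) - t * q z" using r by (simp add: field_simps)
  qed
  then show "shifted q z (r *\<^sub>R x) \<le> r * shifted q z x" using r by (simp add: field_simps)
next
  show "shifted q z x \<le> norm x" for x using shifted_le_self[OF q] sublinearD(3)[OF q] order_trans by blast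
qed

text \<open>Zorn's lemma yields a minimal sublinear functional \<open>m\<close> below \<open>shifted norm y\<close>.  By minimality
  \<open>shifted m z = m\<close> for all \<open>z\<close>, so \<open>m\<close> is linear, and \<open>m (- y) \<le> shifted norm y (- y) \<le> - norm y\<close>.\<close>

lemma real_norming_functional:
  fixes y :: "'a::real_normed_vector"
  obtains f :: "'a \<Rightarrow> real" where "linear f" "\<And>x. f x \<le> norm x" "norm y \<le> f y"
proof -
  define A where "A = {q :: 'a \<Rightarrow> real. sublinear q \<and> q \<le> shifted norm y}"
  define P where "P = (\<lambda>a u :: 'a \<Rightarrow> real. u \<le> a)"
  have "\<exists>m\<in>A. \<forall>a\<in>A. P m a \<longrightarrow> a = m"
  proof (rule predicate_Zorn)
    show "partial_order_on A (relation_of P A)"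
      by (rule partial_order_on_relation_ofI) (auto simp: P_def)
    fix C assume C: "C \<in> Chains (relation_of P A)"
    then have CA: "C \<subseteq> A" by (auto simp: Chains_def relation_of_def)
    have tot: "a \<le> b \<or> b \<le> a" if "a \<in> C" "b \<in> C" for a b
      using that C by (auto simp: Chains_def relation_of_def P_def)
    show "\<exists>u\<in>A. \<forall>a\<in>C. P a u"
    proof (cases "C = {}")
      case True
      then show ?thesis using sublinear_shifted[OF sublinear_norm] by (auto simp: A_def)
    next
      case False
      define u where "u x = (INF q\<in>C. q x)" for x
      have sub: "sublinear q" if "q \<in> C" for q using CA that by (auto simp: A_def)
      have low: "u x \<le> q x" if "q \<in> C" for q x
        unfolding u_def
      proof (rule cINF_lower)
        show "bdd_below ((\<lambda>q. q x) ` C)"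
        proof (rule bdd_belowI2)
          fix q assume "q \<in> C"
          then show "- norm x \<le> q x" using sublinearD(3,5)[OF sub, of q "- x"] sublinearD(5)[OF sub, of q x] by simp
        qed
      qed (use that in auto)
      have great: "b \<le> u x" if "\<And>q. q \<in> C \<Longrightarrow> b \<le> q x" for b x
        unfolding u_def using that False by (intro cINF_greatest) auto
      have "sublinear u"
        unfolding sublinear_def
      proof (intro conjI allI impI)
        fix x x'
        have 1: "u (x + x') \<le> q x + q' x'" if q: "q \<in> C" "q' \<in> C" for q q'
        proof -
          obtain p where p: "p \<in> C" "p \<le> q" "p \<le> q'" using tot[OF q] q by auto
          have "u (x + x') \<le> p x + p x'" using low[OF p(1)] sublinearD(1)[OF sub[OF p(1)]] order_trans by blast
          also have "\<dots> \<le> q x + q' x'" using p by (intro add_mono) (auto simp: le_fun_def)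
          finally show ?thesis .
        qed
        have "u (x + x') - u x' \<le> q x" if q: "q \<in> C" for q
        proof -
          have "u (x + x') - q x \<le> u x'" by (rule great) (use 1[OF q] in \<open>simp add: algebra_simps\<close>)
          then show ?thesis by simp
        qed
        then have "u (x + x') - u x' \<le> u x" by (rule great)
        then show "u (x + x') \<le> u x + u x'" by simp
      next
        fix t :: real and x assume t: "t > 0"
        have "u (t *\<^sub>R x) / t \<le> u x"
        proof (rule great)
          fix q assume "q \<in> C"
          then have "u (t *\<^sub>R x) \<le> t * q x" using low[of q "t *\<^sub>R x"] sublinearD(2)[OF sub t] by simp
          then show "u (t *\<^sub>R x) / t \<le> q x" using t by (simp add: field_simps)
        qed
        then show "u (t *\<^sub>R x) \<le> t * u x" using t by (simp add: field_simps)
      next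
        fix x
        obtain q where "q \<in> C" using False by blast
        then show "u x \<le> norm x" using low[of q x] sublinearD(3)[OF sub, of q x] by simp
      qed
      moreover have "u \<le> shifted norm y"
      proof -
        obtain q where q: "q \<in> C" using False by blast
        then have "u \<le> q" using low by (simp add: le_fun_def)
        also have "q \<le> shifted norm y" using CA q by (auto simp: A_def)
        finally show ?thesis .
      qed
      ultimately show ?thesis using low by (auto simp: A_def P_def le_fun_def)
    qed
  qed
  then obtain m where m: "m \<in> A" "\<And>a. a \<in> A \<Longrightarrow> a \<le> m \<Longrightarrow> a = m" by (auto simp: P_def)
  have sm: "sublinear m" and mp: "m \<le> shifted norm y" using m(1) by (auto simp: A_def)
  have sh: "shifted m z = m" for z
  proof (rule m(2))
    show le: "shifted m z \<le> m" using shifted_le_self[OF sm] by (simp add: le_fun_def)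
    then show "shifted m z \<in> A" using mp sublinear_shifted[OF sm] by (auto simp: A_def)
  qed
  have add: "m (x + z) = m x + m z" for x z
    using shifted_le[OF sm, of 1 z x] sublinearD(1)[OF sm, of x z] by (simp add: sh)
  have neg: "m (- x) = - m x" for x using add[of x "-x"] sublinearD(4)[OF sm] by simp
  show ?thesis
  proof (rule that)
    show "linear m"
    proof (rule linearI)
      fix r :: real and x
      consider "r > 0" | "r = 0" | "- r > 0" by linarith
      then show "m (r *\<^sub>R x) = r *\<^sub>R m x"
      proof cases
        case 3
        then have "m ((- r) *\<^sub>R x) = (- r) * m x" by (rule sublinearD(2)[OF sm])
        then show ?thesis by (simp add: neg)
      qed (use sublinearD(2,4)[OF sm] in auto)
    qed (rule add)
    show "m x \<le> norm x" for x by (rule sublinearD(3)[OF sm])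
    have "m (- y) \<le> norm (- y + 1 *\<^sub>R y) - 1 * norm y"
      using mp shifted_le[OF sublinear_norm, of 1 y "- y"] by (simp add: le_fun_def) (meson order_trans)
    then show "norm y \<le> m y" by (simp add: neg)
  qed
qed

text \<open>The complexification \<open>f x = g x - \<i> g (\<i> x)\<close> of a real norming functional.  Such functionals reduce
  estimates for Banach space valued holomorphic maps to functions of one complex variable.\<close>

lemma norming_functional:
  fixes y :: "'a::complex_banach"
  obtains f :: "'a \<Rightarrow> complex" where "bounded_linear f" "\<And>k x. f (k *\<^sub>C x) = k * f x"
    "\<And>x. cmod (f x) \<le> norm x" "norm y \<le> cmod (f y)"
proof -
  obtain g :: "'a \<Rightarrow> real" where g: "linear g" "\<And>x. g x \<le> norm x" "norm y \<le> g y" using real_norming_functional by blast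
  have gadd: "g (x + z) = g x + g z" for x z by (rule linear_add[OF g(1)])
  have gR: "g (r *\<^sub>R x) = r * g x" for r x using linear_scale[OF g(1)] by simp
  define f where "f x = Complex (g x) (- g (\<i> *\<^sub>C x))" for x
  have fadd: "f (x + z) = f x + f z" for x z by (simp add: f_def complex_eq_iff gadd scaleC_add_right)
  have fC: "f (k *\<^sub>C x) = k * f x" for k x
  proof -
    have kx: "k *\<^sub>C x = Re k *\<^sub>R x + Im k *\<^sub>R \<i> *\<^sub>C x"
      by (subst (1) complex_eq) (simp add: scaleC_add_left scaleR_scaleC scaleC_scaleC mult.commute)
    have ikx: "\<i> *\<^sub>C k *\<^sub>C x = Re k *\<^sub>R \<i> *\<^sub>C x - Im k *\<^sub>R x"
      unfolding kx by (simp add: scaleC_add_right scaleC_scaleR_commute scaleC_scaleC scaleC_minus_left)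
    have gd: "g (u - v) = g u - g v" for u v by (rule linear_diff[OF g(1)])
    show ?thesis by (simp add: f_def complex_eq_iff ikx gd gR) (simp add: kx gadd gR)
  qed
  have fR: "f (r *\<^sub>R x) = r *\<^sub>R f x" for r x by (simp add: scaleR_scaleC fC scaleR_conv_of_real)
  have fle: "cmod (f x) \<le> norm x" for x
  proof (cases "f x = 0")
    case False
    define k where "k = cnj (f x) / cmod (f x)"
    have "f (k *\<^sub>C x) = cmod (f x)" using False by (simp add: fC k_def complex_norm_square[symmetric] power2_eq_square mult.commute)
    then have "g (k *\<^sub>C x) = cmod (f x)" by (simp add: f_def complex_eq_iff)
    moreover have "norm (k *\<^sub>C x) = norm x" using False by (simp add: norm_scaleC k_def norm_divide)
    ultimately show ?thesis using g(2)[of "k *\<^sub>C x"] by simp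
  qed simp
  show ?thesis
  proof (rule that)
    show "bounded_linear f" by (rule bounded_linear_intro[where K=1]) (simp_all add: fadd fR fle)
    have "g y = Re (f y)" by (simp add: f_def)
    then show "norm y \<le> cmod (f y)" using g(3) complex_Re_le_cmod[of "f y"] by simp
  qed (fact fC fle)+
qed

section \<open>The Schwarz lemma along complex lines\<close>

lemma holomorphic_on_line:
  assumes f: "holomorphic_map_on f U" and S: "\<And>l. l \<in> S \<Longrightarrow> x + l *\<^sub>C u \<in> U"
    and p: "bounded_linear p" "\<And>k z. p (k *\<^sub>C z) = k * p z"
  shows "(\<lambda>l. p (f (x + l *\<^sub>C u))) holomorphic_on S"
  unfolding holomorphic_on_def
proof
  fix l assume "l \<in> S"
  then obtain D where D: "(f has_derivative D) (at (x + l *\<^sub>C u))" "complex_linear D"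
    using f S by (auto simp: holomorphic_map_on_def)
  have "((\<lambda>l. x + l *\<^sub>C u) has_derivative (\<lambda>h. 0 + h *\<^sub>C u)) (at l within S)"
    by (intro has_derivative_add has_derivative_const bounded_linear.has_derivative[OF bounded_linear_scaleC_left] has_derivative_ident)
  then have "((\<lambda>l. p (f (x + l *\<^sub>C u))) has_derivative (\<lambda>h. p (D (0 + h *\<^sub>C u)))) (at l within S)"
    by (intro bounded_linear.has_derivative[OF p(1)] has_derivative_compose[where f="\<lambda>l. x + l *\<^sub>C u" and g=f] D(1))
  also have "(\<lambda>h. p (D (0 + h *\<^sub>C u))) = (*) (p (D u))"
    using D(2) by (auto simp: complex_linear_def p(2) mult.commute)
  finally show "(\<lambda>l. p (f (x + l *\<^sub>C u))) field_differentiable at l within S"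
    unfolding field_differentiable_def has_field_derivative_def by blast
qed

text \<open>The classical lemma needs values of modulus less than \<open>1\<close>; under a non-strict bound \<open>M\<close>, possibly
  \<open>0\<close>, it is applied with every \<open>K > M\<close>.\<close>

lemma scaled_Schwarz:
  assumes hol: "g holomorphic_on ball 0 R" and g0: "g 0 = 0" and R: "R > 0"
    and M: "\<And>z. cmod z < R \<Longrightarrow> cmod (g z) \<le> M" and z: "cmod z < R"
  shows "cmod (g z) \<le> M * (cmod z / R)"
proof -
  have M0: "M \<ge> 0" using order_trans[OF norm_ge_zero M[of 0]] R by simp
  have *: "cmod (g z) \<le> K * (cmod z / R)" if K: "K > M" for K
  proof -
    have K0: "K > 0" using K M0 by simp
    define G where "G w = g (of_real R * w) / of_real K" for w
    have in_ball: "cmod (of_real R * w) < R" if "cmod w < 1" for w :: complex using that R by (simp add: norm_mult)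
    have "(g \<circ> (\<lambda>w. of_real R * w)) holomorphic_on ball 0 1"
      by (rule holomorphic_on_compose_gen[OF _ hol]) (auto simp: in_ball intro: holomorphic_intros)
    then have hG: "G holomorphic_on ball 0 1"
      unfolding G_def o_def using K0 by (intro holomorphic_on_divide holomorphic_on_const) auto
    have nG: "cmod (G w) < 1" if "cmod w < 1" for w
    proof -
      have "cmod (g (of_real R * w)) \<le> M" by (rule M[OF in_ball[OF that]])
      then have "cmod (g (of_real R * w)) < K" using K by simp
      then show ?thesis using K0 by (simp add: G_def norm_divide)
    qed
    have "cmod (G (z / of_real R)) \<le> cmod (z / of_real R)"
      by (rule Schwarz_Lemma(1)[OF hG _ nG]) (use z R g0 in \<open>auto simp: G_def norm_divide\<close>)
    then show ?thesis using R K0 by (simp add: G_def norm_divide field_simps)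
  qed
  show ?thesis
  proof (rule field_le_epsilon)
    fix e :: real assume e: "e > 0"
    have "cmod (g z) \<le> (M + e) * (cmod z / R)" using e by (intro *) simp
    also have "\<dots> \<le> M * (cmod z / R) + e * 1"
      unfolding distrib_right using e z R by (intro add_left_mono mult_left_mono) auto
    finally show "cmod (g z) \<le> M * (cmod z / R) + e" by simp
  qed
qed

lemma scaled_Schwarz_second_order:
  assumes hol: "g holomorphic_on ball 0 R" and g0: "g 0 = 0" "deriv g 0 = 0" and R: "R > 0"
    and M: "\<And>z. cmod z < R \<Longrightarrow> cmod (g z) \<le> M" and z: "cmod z < R"
  shows "cmod (g z) \<le> M * (cmod z / R)\<^sup>2"
proof -
  have M0: "M \<ge> 0" using order_trans[OF norm_ge_zero M[of 0]] R by simp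
  obtain h where h: "h holomorphic_on ball 0 R" "\<And>z. cmod z < R \<Longrightarrow> g z = z * h z" "deriv g 0 = h 0"
    using Schwarz3[OF hol g0(1)] by blast
  have "cmod (h w) \<le> M / R" if w: "cmod w < R" for w
  proof (cases "w = 0")
    case False
    have "cmod w * cmod (h w) \<le> cmod w * (M / R)"
      using scaled_Schwarz[OF hol g0(1) R M w] h(2)[OF w] by (simp add: norm_mult mult_ac)
    then show ?thesis by (rule mult_left_le_imp_le) (use False in simp)
  qed (use h g0 M0 R in simp)
  then have "cmod (h z) \<le> M / R * (cmod z / R)"
    using h g0 by (intro scaled_Schwarz[OF _ _ R _ z]) auto
  then have "cmod z * cmod (h z) \<le> cmod z * (M / R * (cmod z / R))" by (intro mult_left_mono) auto
  then show ?thesis using h(2)[OF z] by (simp add: norm_mult power2_eq_square mult_ac)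
qed

lemma Schwarz_along_line:
  fixes f :: "'a::complex_banach \<Rightarrow> 'a"
  assumes f: "holomorphic_map_on f U" and R: "R > 0"
    and U: "\<And>l. cmod l < R \<Longrightarrow> x + l *\<^sub>C u \<in> U"
    and M: "\<And>l. cmod l < R \<Longrightarrow> norm (f (x + l *\<^sub>C u) - f x) \<le> M" and l: "cmod l < R"
  shows "norm (f (x + l *\<^sub>C u) - f x) \<le> M * (cmod l / R)"
proof -
  obtain p :: "'a \<Rightarrow> complex" where p: "bounded_linear p" "\<And>k z. p (k *\<^sub>C z) = k * p z"
    "\<And>z. cmod (p z) \<le> norm z" "norm (f (x + l *\<^sub>C u) - f x) \<le> cmod (p (f (x + l *\<^sub>C u) - f x))"
    using norming_functional by blast
  have pd: "p (z - w) = p z - p w" for z w by (rule linear_diff[OF bounded_linear.linear[OF p(1)]])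
  have "cmod (p (f (x + l *\<^sub>C u)) - p (f x)) \<le> M * (cmod l / R)"
  proof (rule scaled_Schwarz[OF _ _ R _ l, of "\<lambda>l. p (f (x + l *\<^sub>C u)) - p (f x)"])
    show "(\<lambda>l. p (f (x + l *\<^sub>C u)) - p (f x)) holomorphic_on ball 0 R"
      by (intro holomorphic_intros holomorphic_on_line[OF f _ p(1,2)] U) simp
    show "cmod (p (f (x + k *\<^sub>C u)) - p (f x)) \<le> M" if "cmod k < R" for k
      using p(3)[of "f (x + k *\<^sub>C u) - f x"] M[OF that] by (simp add: pd)
  qed simp
  then show ?thesis using p(4) by (simp add: pd)
qed

lemma ball_line: 
  fixes x :: "'a::complex_banach"
  assumes "x \<noteq> 0" "cmod l < 1 / norm x" shows "0 + l *\<^sub>C x \<in> ball 0 1"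
  using assms by (simp add: norm_scaleC field_simps)

lemma Schwarz_ball:
  fixes f :: "'a::complex_banach \<Rightarrow> 'a"
  assumes f: "holomorphic_map_on f (ball 0 1)" "f ` ball 0 1 \<subseteq> ball 0 1" "f 0 = 0" and x: "norm x < 1"
  shows "norm (f x) \<le> norm x"
proof (cases "x = 0")
  case False
  have "norm (f (0 + 1 *\<^sub>C x) - f 0) \<le> 1 * (cmod 1 / (1 / norm x))"
  proof (rule Schwarz_along_line[OF f(1)])
    show "norm (f (0 + l *\<^sub>C x) - f 0) \<le> 1" if "cmod l < 1 / norm x" for l
      using ball_line[OF False that] f(2,3) by (auto simp: image_subset_iff less_imp_le)
    show "0 + l *\<^sub>C x \<in> ball 0 1" if "cmod l < 1 / norm x" for l
      by (rule ball_line[OF False that])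
  qed (use False x in \<open>auto simp: field_simps\<close>)
  then show ?thesis using f(3) by simp
qed (use f in simp)

lemma derivative_at_zero_contraction:
  fixes f :: "'a::complex_banach \<Rightarrow> 'a"
  assumes f: "holomorphic_map_on f (ball 0 1)" "f ` ball 0 1 \<subseteq> ball 0 1" "f 0 = 0"
    and D: "(f has_derivative D) (at 0)"
  shows "norm (D x) \<le> norm x"
proof (cases "x = 0")
  case True
  then show ?thesis using linear_0[OF bounded_linear.linear[OF has_derivative_bounded_linear[OF D]]] by simp
next
  case False
  show ?thesis
  proof (rule field_le_epsilon)
    fix e :: real assume e: "e > 0"
    define e' where "e' = e / norm x"
    have e': "e' > 0" "e' * norm x = e" using e False by (auto simp: e'_def)
    obtain d where d: "d > 0" "\<And>y. norm (y - 0) < d \<Longrightarrow> norm (f y - f 0 - D (y - 0)) \<le> e' * norm (y - 0)"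
      using D e' unfolding has_derivative_at_alt by blast
    define t where "t = min d 1 / (2 * norm x)"
    have t: "t > 0" "t * norm x < d" "t * norm x < 1" using d False by (auto simp: t_def min_def)
    have n: "norm (t *\<^sub>R x) = t * norm x" using t by simp
    have "norm (D (t *\<^sub>R x)) \<le> norm (f (t *\<^sub>R x)) + norm (f (t *\<^sub>R x) - D (t *\<^sub>R x))"
      using norm_triangle_ineq4[of "f (t *\<^sub>R x)" "f (t *\<^sub>R x) - D (t *\<^sub>R x)"] by simp
    also have "\<dots> \<le> t * norm x + e' * (t * norm x)"
      using Schwarz_ball[OF f, of "t *\<^sub>R x"] d(2)[of "t *\<^sub>R x"] t f(3) by (intro add_mono) (auto simp: n)
    also have "D (t *\<^sub>R x) = t *\<^sub>R D x" by (rule linear_scale[OF bounded_linear.linear[OF has_derivative_bounded_linear[OF D]]])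
    finally have "t * norm (D x) \<le> t * (norm x + e' * norm x)" using t by (simp add: algebra_simps)
    then show "norm (D x) \<le> norm x + e" using t e' by simp
  qed
qed

lemma holomorphic_map_on_compose:
  assumes f: "holomorphic_map_on f U" "f ` U \<subseteq> V" and g: "holomorphic_map_on g V"
  shows "holomorphic_map_on (\<lambda>x. g (f x)) U"
  unfolding holomorphic_map_on_def
proof
  fix x assume x: "x \<in> U"
  obtain D where D: "(f has_derivative D) (at x)" "complex_linear D" using f x by (auto simp: holomorphic_map_on_def)
  obtain D' where D': "(g has_derivative D') (at (f x))" "complex_linear D'"
  proof -
    have "f x \<in> V" using f(2) x by blast
    then show ?thesis using that g unfolding holomorphic_map_on_def by blast
  qed
  show "\<exists>D. ((\<lambda>x. g (f x)) has_derivative D) (at x) \<and> complex_linear D"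
    using has_derivative_compose[OF D(1) D'(1)] D(2) D'(2) by (intro exI[of _ "\<lambda>h. D' (D h)"]) (simp add: complex_linear_def)
qed

lemma holomorphic_map_on_add_scaleR:
  assumes f: "holomorphic_map_on f U" and g: "holomorphic_map_on g U"
  shows "holomorphic_map_on (\<lambda>x. f x + r *\<^sub>R g x) U"
  unfolding holomorphic_map_on_def
proof
  fix x assume x: "x \<in> U"
  obtain D where D: "(f has_derivative D) (at x)" "complex_linear D" using f x by (auto simp: holomorphic_map_on_def)
  obtain D' where D': "(g has_derivative D') (at x)" "complex_linear D'" using g x by (auto simp: holomorphic_map_on_def)
  have "((\<lambda>x. f x + r *\<^sub>R g x) has_derivative (\<lambda>h. D h + r *\<^sub>R D' h)) (at x)"
    by (intro derivative_intros D D')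
  moreover have "complex_linear (\<lambda>h. D h + r *\<^sub>R D' h)"
    using D(2) D'(2) by (simp add: complex_linear_def algebra_simps scaleC_add_right scaleC_scaleR_commute)
  ultimately show "\<exists>D. ((\<lambda>x. f x + r *\<^sub>R g x) has_derivative D) (at x) \<and> complex_linear D" by blast
qed

lemma holomorphic_map_on_linear:
  assumes "bounded_linear L" "complex_linear L" shows "holomorphic_map_on L U"
  unfolding holomorphic_map_on_def using bounded_linear_imp_has_derivative[OF assms(1)] assms(2) by blast

lemma holomorphic_map_on_id: "holomorphic_map_on (\<lambda>x. x) U"
  by (rule holomorphic_map_on_linear) (auto simp: bounded_linear_ident complex_linear_def)

lemma holomorphic_map_on_zero: "holomorphic_map_on (\<lambda>x. 0) U"
  by (rule holomorphic_map_on_linear) (auto simp: complex_linear_def)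

section \<open>Cartan's uniqueness theorem\<close>

text \<open>By the second order Schwarz lemma \<open>Q = f - id\<close> satisfies \<open>norm (Q z) \<le> 2 (norm z)\<^sup>2\<close>, and the Schwarz lemma
  along the line through \<open>x\<close> and \<open>y\<close> then makes \<open>Q\<close> Lipschitz with constant \<open>1/2\<close> near \<open>0\<close>.  The point is that
  radius and constant do not depend on \<open>f\<close>.\<close>

lemma lower_Lipschitz_near_zero:
  fixes f :: "'a::complex_banach \<Rightarrow> 'a"
  assumes f: "holomorphic_map_on f (ball 0 1)" "f ` ball 0 1 \<subseteq> ball 0 1" "f 0 = 0"
    and D: "(f has_derivative (\<lambda>x. x)) (at 0)"
    and x: "norm x \<le> 1/50" and y: "norm y \<le> 1/50"
  shows "norm (x - y) \<le> 2 * norm (f x - f y)"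
proof (cases "x = y")
  case False
  define Q where "Q z = f z + (-1) *\<^sub>R z" for z
  have Q: "holomorphic_map_on Q (ball 0 1)"
    unfolding Q_def by (rule holomorphic_map_on_add_scaleR[OF f(1) holomorphic_map_on_id])
  have Q0: "Q 0 = 0" using f(3) by (simp add: Q_def)
  have Q2: "norm (Q z) \<le> 2" if "norm z < 1" for z
  proof -
    have "norm (f z) < 1" using f(2) that by (auto simp: image_subset_iff)
    then show ?thesis using norm_triangle_ineq4[of "f z" z] that by (simp add: Q_def)
  qed
  have quad: "norm (Q z) \<le> 2 * (norm z)\<^sup>2" if z: "norm z < 1" for z
  proof (cases "z = 0")
    case nz: False
    obtain p :: "'a \<Rightarrow> complex" where p: "bounded_linear p" "\<And>k z. p (k *\<^sub>C z) = k * p z"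
      "\<And>z. cmod (p z) \<le> norm z" "norm (Q z) \<le> cmod (p (Q z))"
      using norming_functional by blast
    let ?g = "\<lambda>l. p (Q (0 + l *\<^sub>C z))"
    have "(Q has_derivative (\<lambda>h. h + (-1) *\<^sub>R h)) (at 0)"
      unfolding Q_def by (intro derivative_intros D)
    then have "(Q has_derivative (\<lambda>h. 0)) (at (0 + 0 *\<^sub>C z))" by simp
    moreover have "((\<lambda>l. 0 + l *\<^sub>C z) has_derivative (\<lambda>h. 0 + h *\<^sub>C z)) (at 0)"
      by (intro has_derivative_add has_derivative_const bounded_linear.has_derivative[OF bounded_linear_scaleC_left] has_derivative_ident)
    ultimately have "(?g has_derivative (\<lambda>h. p 0)) (at 0)"
      by (intro bounded_linear.has_derivative[OF p(1)] has_derivative_compose[where f="\<lambda>l. 0 + l *\<^sub>C z" and g=Q])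
    moreover have "(\<lambda>h. p 0) = (*) 0" using linear_0[OF bounded_linear.linear[OF p(1)]] by auto
    ultimately have "(?g has_field_derivative 0) (at 0)" by (simp add: has_field_derivative_def)
    then have "deriv ?g 0 = 0" by (rule DERIV_imp_deriv)
    then have "cmod (?g 1) \<le> 2 * (cmod 1 / (1 / norm z))\<^sup>2"
    proof (rule scaled_Schwarz_second_order[rotated 2])
      show "?g holomorphic_on ball 0 (1 / norm z)"
        by (intro holomorphic_on_line[OF Q _ p(1,2)] ball_line nz) simp
      show "?g 0 = 0" using linear_0[OF bounded_linear.linear[OF p(1)]] Q0 by simp
      show "cmod (?g l) \<le> 2" if "cmod l < 1 / norm z" for l
        using p(3)[of "Q (0 + l *\<^sub>C z)"] Q2[of "0 + l *\<^sub>C z"] ball_line[OF nz that] by simp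
    qed (use nz z in \<open>auto simp: field_simps\<close>)
    then show ?thesis using p(4) by simp
  qed (use Q0 in simp)
  define u where "u = y - x"
  have u: "u \<noteq> 0" using False by (simp add: u_def)
  have nu: "norm u \<le> 2/50" using norm_triangle_ineq4[of y x] x y by (simp add: u_def)
  \<comment> \<open>For \<open>cmod l < R\<close> the points \<open>x + l u\<close> have norm at most \<open>1/50 + 4/50\<close>, where the quadratic
    estimate bounds the oscillation of \<open>Q\<close> by \<open>2 (5/50)\<^sup>2 + 2 (1/50)\<^sup>2 \<le> 100/2500\<close>; dividing by \<open>R\<close> leaves \<open>norm u / 2\<close>.\<close>
  define R where "R = (4/50) / norm u"
  have in_small: "norm (x + l *\<^sub>C u) \<le> 5/50" if "cmod l < R" for l
  proof -
    have "cmod l * norm u \<le> 4/50" using that u by (simp add: R_def field_simps)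
    then show ?thesis using norm_triangle_ineq[of x "l *\<^sub>C u"] x by (simp add: norm_scaleC)
  qed
  have "norm (Q (x + 1 *\<^sub>C u) - Q x) \<le> (100/2500) * (cmod 1 / R)"
  proof (rule Schwarz_along_line[OF Q])
    show "R > 0" using u by (simp add: R_def)
    show "x + l *\<^sub>C u \<in> ball 0 1" if "cmod l < R" for l using in_small[OF that] by simp
    show "cmod 1 < R" using u nu by (simp add: R_def field_simps)
    fix l assume l: "cmod l < R"
    have "(norm (x + l *\<^sub>C u))\<^sup>2 \<le> (5/50)\<^sup>2" using in_small[OF l] by (intro power_mono) auto
    moreover have "(norm x)\<^sup>2 \<le> (1/50)\<^sup>2" using x by (intro power_mono) auto
    ultimately show "norm (Q (x + l *\<^sub>C u) - Q x) \<le> 100/2500"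
      using quad[of "x + l *\<^sub>C u"] quad[of x] in_small[OF l] x norm_triangle_ineq4[of "Q (x + l *\<^sub>C u)" "Q x"]
      by (simp add: power2_eq_square)
  qed
  then have "norm (Q y - Q x) \<le> norm (y - x) / 2" using u by (simp add: R_def u_def)
  moreover have "x - y = (f x - f y) + (Q y - Q x)" by (simp add: Q_def)
  ultimately show ?thesis using norm_triangle_ineq[of "f x - f y" "Q y - Q x"] by (simp add: norm_minus_commute)
qed simp

text \<open>The averages \<open>F\<^sub>n = (1/n) \<Sum>k<n. f\<^sup>k\<close> map the ball into itself and have derivative \<open>id\<close> at \<open>0\<close>, so near
  \<open>0\<close> they shrink distances at most by a factor of \<open>2\<close>.  On the other hand \<open>F\<^sub>n (f x) - F\<^sub>n x = (f\<^sup>n x - x) / n\<close> tends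
  to \<open>0\<close>.\<close>

lemma identity_near_zero:
  fixes f :: "'a::complex_banach \<Rightarrow> 'a"
  assumes f: "holomorphic_map_on f (ball 0 1)" "f ` ball 0 1 \<subseteq> ball 0 1" "f 0 = 0"
    and D: "(f has_derivative (\<lambda>x. x)) (at 0)" and x: "norm x \<le> 1/50"
  shows "f x = x"
proof -
  have it: "holomorphic_map_on (f ^^ n) (ball 0 1) \<and> (f ^^ n) ` ball 0 1 \<subseteq> ball 0 1 \<and> (f ^^ n) 0 = 0
    \<and> ((f ^^ n) has_derivative (\<lambda>x. x)) (at 0)" for n
  proof (induction n)
    case 0
    then show ?case using holomorphic_map_on_id by (auto simp: id_def has_derivative_ident)
  next
    case (Suc n)
    then have IH: "holomorphic_map_on (f ^^ n) (ball 0 1)" "(f ^^ n) ` ball 0 1 \<subseteq> ball 0 1" "(f ^^ n) 0 = 0"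
      "((f ^^ n) has_derivative (\<lambda>x. x)) (at 0)" by auto
    have "(f has_derivative (\<lambda>x. x)) (at ((f ^^ n) 0))" using D IH(3) by simp
    note has_derivative_compose[OF IH(4) this]
    moreover note holomorphic_map_on_compose[OF IH(1,2) f(1)]
    moreover have "(\<lambda>x. f ((f ^^ n) x)) ` ball 0 1 \<subseteq> ball 0 1" using IH(2) f(2) by (auto simp only: image_subset_iff)
    ultimately show ?case using IH(3) f(3) by (simp add: o_def)
  qed
  have it_ball: "norm ((f ^^ n) z) < 1" if "norm z < 1" for n z
    using it[of n] that by (auto simp only: image_subset_iff mem_ball_0)
  define S where "S n z = (\<Sum>k<n. (f ^^ k) z)" for n z
  have Suc_S: "S (Suc n) = (\<lambda>z. S n z + 1 *\<^sub>R (f ^^ n) z)" for n by (simp add: S_def fun_eq_iff)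
  have Sp: "holomorphic_map_on (S n) (ball 0 1) \<and> (S n has_derivative (\<lambda>x. real n *\<^sub>R x)) (at 0)" for n
  proof (induction n)
    case 0
    show ?case using holomorphic_map_on_zero by (simp add: S_def[abs_def])
  next
    case (Suc n)
    have "(S (Suc n) has_derivative (\<lambda>x. real n *\<^sub>R x + 1 *\<^sub>R x)) (at 0)"
      unfolding Suc_S using Suc it[of n] by (intro derivative_intros) auto
    moreover have "holomorphic_map_on (S (Suc n)) (ball 0 1)"
      unfolding Suc_S using Suc it[of n] by (intro holomorphic_map_on_add_scaleR) auto
    ultimately show ?case by (simp add: algebra_simps)
  qed
  have bound: "norm (f x - x) \<le> 4 * inverse (real (Suc m))" for m
  proof -
    define n where "n = real (Suc m)"
    have n: "n > 0" by (simp add: n_def)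
    define F where "F = (\<lambda>z. (0::'a) + inverse n *\<^sub>R S (Suc m) z)"
    have "holomorphic_map_on F (ball 0 1)"
      unfolding F_def using Sp[of "Suc m"] by (intro holomorphic_map_on_add_scaleR holomorphic_map_on_zero) auto
    moreover have "F ` ball 0 1 \<subseteq> ball 0 1"
    proof
      fix w assume "w \<in> F ` ball 0 1"
      then obtain z :: 'a where z: "norm z < 1" "w = F z" by auto
      have "norm (S (Suc m) z) \<le> (\<Sum>k<Suc m. norm ((f ^^ k) z))" unfolding S_def by (rule norm_sum)
      also have "\<dots> < (\<Sum>k<Suc m. 1)" using it_ball z by (intro sum_strict_mono) auto
      finally have "norm (S (Suc m) z) < n" by (simp add: n_def)
      then show "w \<in> ball 0 1" using z n by (simp add: F_def field_simps)
    qed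
    moreover have "(f ^^ k) 0 = 0" for k using it by blast
    then have "F 0 = 0" by (simp add: F_def S_def)
    moreover have "(F has_derivative (\<lambda>x. x)) (at 0)"
    proof -
      have "(F has_derivative (\<lambda>x. 0 + inverse n *\<^sub>R real (Suc m) *\<^sub>R x)) (at 0)"
        unfolding F_def using Sp[of "Suc m"] by (intro derivative_intros) auto
      then show ?thesis using n by (simp add: n_def del: of_nat_Suc)
    qed
    moreover have "norm (f x) \<le> 1/50" using Schwarz_ball[OF f, of x] x by simp
    ultimately have le: "norm (f x - x) \<le> 2 * norm (F (f x) - F x)" using x by (intro lower_Lipschitz_near_zero) auto
    have "S (Suc m) (f x) - S (Suc m) x = (\<Sum>k<Suc m. (f ^^ Suc k) x - (f ^^ k) x)"
      by (simp add: S_def sum_subtractf funpow_swap1)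
    also have "\<dots> = (f ^^ Suc m) x - x" by (subst sum_lessThan_telescope) simp
    finally have "F (f x) - F x = inverse n *\<^sub>R ((f ^^ Suc m) x - x)" by (simp add: F_def flip: scaleR_diff_right)
    moreover have "norm ((f ^^ Suc m) x - x) \<le> 2"
    proof -
      have "norm ((f ^^ Suc m) x) < 1" by (rule it_ball) (use x in simp)
      then show ?thesis using norm_triangle_ineq4[of "(f ^^ Suc m) x" x] x by simp
    qed
    ultimately have "norm (F (f x) - F x) \<le> inverse n * 2" using n by (simp add: mult_left_mono)
    then show ?thesis using le by (simp add: n_def)
  qed
  have "norm (f x - x) \<le> 0"
  proof (rule LIMSEQ_le_const)
    show "(\<lambda>m. 4 * inverse (real (Suc m))) \<longlonglongrightarrow> 0"
      using tendsto_mult[OF tendsto_const LIMSEQ_inverse_real_of_nat, of 4] by simp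
  qed (use bound in auto)
  then show ?thesis by simp
qed

text \<open>Continuation of \<open>identity_near_zero\<close> along complex lines, by the identity theorem.\<close>

lemma Cartan_uniqueness:
  fixes f :: "'a::complex_banach \<Rightarrow> 'a"
  assumes f: "holomorphic_map_on f (ball 0 1)" "f ` ball 0 1 \<subseteq> ball 0 1" "f 0 = 0"
    and D: "(f has_derivative (\<lambda>x. x)) (at 0)" and x: "norm x < 1"
  shows "f x = x"
proof (cases "x = 0")
  case nz: False
  define Q where "Q z = f z + (-1) *\<^sub>R z" for z
  have Q: "holomorphic_map_on Q (ball 0 1)"
    unfolding Q_def by (rule holomorphic_map_on_add_scaleR[OF f(1) holomorphic_map_on_id])
  obtain p :: "'a \<Rightarrow> complex" where p: "bounded_linear p" "\<And>k z. p (k *\<^sub>C z) = k * p z"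
    "\<And>z. cmod (p z) \<le> norm z" "norm (Q x) \<le> cmod (p (Q x))"
    using norming_functional by blast
  let ?g = "\<lambda>l. p (Q (0 + l *\<^sub>C x))"
  have "?g 1 = 0"
  proof (rule analytic_continuation_open[of "ball 0 (1/50)" "ball 0 (1 / norm x)" ?g "\<lambda>_. 0"])
    show "ball 0 (1 / 50) \<subseteq> ball (0::complex) (1 / norm x)"
    proof (rule subset_ball)
      show "1/50 \<le> 1 / norm x" using nz x by (intro frac_le) auto
    qed
    show "?g holomorphic_on ball 0 (1 / norm x)"
      by (intro holomorphic_on_line[OF Q _ p(1,2)] ball_line nz) simp
    show "1 \<in> ball (0::complex) (1 / norm x)" using nz x by (simp add: field_simps)
    fix l :: complex assume l: "l \<in> ball 0 (1/50)"
    then have "norm (l *\<^sub>C x) \<le> 1/50 * 1" unfolding norm_scaleC using x by (intro mult_mono) auto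
    then have "f (l *\<^sub>C x) = l *\<^sub>C x" by (intro identity_near_zero[OF f D]) simp
    then show "?g l = 0" using linear_0[OF bounded_linear.linear[OF p(1)]] by (simp add: Q_def)
  qed auto
  then have "norm (Q x) \<le> 0" using p(4) by simp
  then show ?thesis by (simp add: Q_def)
qed (use f in simp)

text \<open>By the Schwarz lemma the derivatives \<open>L\<close> and \<open>M\<close> of \<open>f\<close> and \<open>g\<close> at \<open>0\<close> are contractions,
  and they are inverse to each other, so that \<open>L\<close> is an isometry.  Cartan's uniqueness theorem applies to \<open>M \<circ> f\<close>.\<close>

lemma automorphism_fixing_zero_is_linear:
  fixes f :: "'a::complex_banach \<Rightarrow> 'a"
  assumes f: "holomorphic_map_on f (ball 0 1)" "f ` ball 0 1 \<subseteq> ball 0 1" "f 0 = 0"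
    and g: "holomorphic_map_on g (ball 0 1)" "g ` ball 0 1 \<subseteq> ball 0 1"
    and inv: "\<And>x. x \<in> ball 0 1 \<Longrightarrow> g (f x) = x" "\<And>x. x \<in> ball 0 1 \<Longrightarrow> f (g x) = x"
  obtains L where "surjective_linear_isometry L" "\<And>x. x \<in> ball 0 1 \<Longrightarrow> f x = L x"
proof -
  have g0: "g 0 = 0" using inv(1)[of 0] f(3) by simp
  obtain L where L: "(f has_derivative L) (at 0)" "complex_linear L" using f(1) by (force simp: holomorphic_map_on_def)
  obtain M where M: "(g has_derivative M) (at 0)" "complex_linear M" using g(1) by (force simp: holomorphic_map_on_def)
  have comp: "D' \<circ> D = id" if D: "(a has_derivative D) (at 0)" and D': "(b has_derivative D') (at 0)" and a0: "a 0 = 0"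
    and ba: "\<And>x. x \<in> ball 0 1 \<Longrightarrow> b (a x) = x" for a b :: "'a \<Rightarrow> 'a" and D D'
  proof -
    have "(b has_derivative D') (at (a 0))" using D' a0 by simp
    note 1 = has_derivative_compose[OF D this]
    have "((\<lambda>x. b (a x)) has_derivative (\<lambda>x. x)) (at 0)"
      by (rule has_derivative_transform_within_open[OF has_derivative_ident, of "ball 0 1"]) (auto simp: ba)
    from has_derivative_unique[OF 1 this] show ?thesis by (simp add: fun_eq_iff)
  qed
  have inverse_LM: "M (L x) = x" "L (M x) = x" for x
    using comp[OF L(1) M(1) f(3) inv(1)] comp[OF M(1) L(1) g0 inv(2)] by (auto simp: fun_eq_iff)
  note cL = derivative_at_zero_contraction[OF f L(1)] and cM = derivative_at_zero_contraction[OF g g0 M(1)]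
  have isoL: "norm (L x) = norm x" for x using cL[of x] cM[of "L x"] by (simp add: inverse_LM)
  show ?thesis
  proof (rule that)
    show "surjective_linear_isometry L"
      unfolding surjective_linear_isometry_def using L(2) isoL inverse_LM(2) by (metis surjI)
    fix x :: 'a assume "x \<in> ball 0 1"
    then have x: "norm x < 1" by simp
    have bM: "bounded_linear M" by (rule has_derivative_bounded_linear[OF M(1)])
    have "M (f x) = x"
    proof (rule Cartan_uniqueness[where f="\<lambda>x. M (f x)", OF _ _ _ _ x])
      show "holomorphic_map_on (\<lambda>x. M (f x)) (ball 0 1)"
        by (rule holomorphic_map_on_compose[OF f(1,2) holomorphic_map_on_linear[OF bM M(2)]])
      have "norm (M (f z)) < 1" if "norm z < 1" for z
      proof -
        have "norm (f z) < 1" using f(2) that by (auto simp: image_subset_iff)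
        then show ?thesis using cM[of "f z"] by simp
      qed
      then show "(\<lambda>x. M (f x)) ` ball 0 1 \<subseteq> ball 0 1" by auto
      show "M (f 0) = 0" using f(3) linear_0[OF bounded_linear.linear[OF bM]] by simp
      have "((\<lambda>x. M (f x)) has_derivative (\<lambda>x. M (L x))) (at 0)" by (rule bounded_linear.has_derivative[OF bM L(1)])
      then show "((\<lambda>x. M (f x)) has_derivative (\<lambda>x. x)) (at 0)" by (simp add: inverse_LM)
    qed
    then show "f x = L x" by (metis inverse_LM(2))
  qed
qed

section \<open>All automorphisms of the unit ball\<close>

theorem mainTheorem2:
  fixes act :: "'e::complex_banach \<Rightarrow> 'a::cstar_algebra \<Rightarrow> 'e"
    and ip :: "'e \<Rightarrow> 'e \<Rightarrow> 'a"
  assumes "hilbert_module act ip"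
  shows "(\<forall>c\<in>ball 0 1.
            (\<forall>x\<in>ball 0 1. \<one>\<^bsub>unitization\<^esub> \<oplus>\<^bsub>unitization\<^esub> emb (ip c x) \<in> Units unitization)
            \<and> holomorphic_automorphism (ball 0 1) (moebius_map act ip c))
       \<and> (\<forall>h. holomorphic_automorphism (ball 0 1) h \<longrightarrow>
            (\<exists>L c. surjective_linear_isometry L \<and> norm c < 1
              \<and> (\<forall>x\<in>ball 0 1. h x = L (moebius_map act ip c x))))"
proof (intro conjI ballI allI impI)
  interpret hilbert_module act ip by (rule assms)
  fix c :: 'e assume "c \<in> ball 0 1"
  then have c: "norm c < 1" by simp
  show "\<one>\<^bsub>unitization\<^esub> \<oplus>\<^bsub>unitization\<^esub> emb (ip c x) \<in> Units unitization" if "x \<in> ball 0 1" for x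
    using one_plus_emb_Units[OF c] that by simp
  show "holomorphic_automorphism (ball 0 1) (moebius_map act ip c)" by (rule moebius_automorphism[OF c])
next
  interpret hilbert_module act ip by (rule assms)
  let ?B = "ball (0::'e) 1"
  fix h assume h: "holomorphic_automorphism ?B h"
  define k where "k = inv_into ?B h"
  have hol: "holomorphic_map_on h ?B" "holomorphic_map_on k ?B" and bij: "bij_betw h ?B ?B"
    using h by (auto simp: holomorphic_automorphism_def k_def)
  have im: "h ` ?B \<subseteq> ?B" "k ` ?B \<subseteq> ?B"
    using bij bij_betw_inv_into[OF bij] by (auto simp: bij_betw_def k_def)
  have kh: "k (h x) = x" "h (k x) = x" if "x \<in> ?B" for x
    using that bij by (auto simp: k_def bij_betw_inv_into_left bij_betw_inv_into_right)
  \<comment> \<open>Since \<open>g\<^sub>-\<^sub>c\<close> maps \<open>0\<close> to \<open>- c\<close>, the map \<open>h \<circ> g\<^sub>-\<^sub>c\<close> fixes \<open>0\<close>.\<close>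
  define c where "c = - k 0"
  have c: "norm c < 1" "norm (- c) < 1" using im(2) by (auto simp: c_def image_subset_iff)
  let ?g = "moebius_map act ip c" and ?g' = "moebius_map act ip (- c)"
  note hol_g = moebius_holomorphic[OF c(1)] moebius_holomorphic[OF c(2)]
  have im_g: "?g ` ?B \<subseteq> ?B" "?g' ` ?B \<subseteq> ?B" using norm_moebius c by auto
  have inv_g: "?g' (?g x) = x" "?g (?g' x) = x" if "x \<in> ?B" for x
    using moebius_inverse[OF c(1), of x] moebius_inverse[OF c(2), of x] that by simp_all
  have "h (?g' 0) = 0" using kh(2)[of 0] by (simp add: moebius_zero[OF c(2)]) (simp add: c_def)
  moreover have "holomorphic_map_on (\<lambda>x. h (?g' x)) ?B"
    by (rule holomorphic_map_on_compose[OF hol_g(2) im_g(2) hol(1)])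
  moreover have "holomorphic_map_on (\<lambda>x. ?g (k x)) ?B"
    by (rule holomorphic_map_on_compose[OF hol(2) im(2) hol_g(1)])
  moreover have "(\<lambda>x. h (?g' x)) ` ?B \<subseteq> ?B" "(\<lambda>x. ?g (k x)) ` ?B \<subseteq> ?B"
    using im im_g by (auto simp only: image_subset_iff)
  moreover have "?g (k (h (?g' x))) = x" "h (?g' (?g (k x))) = x" if "x \<in> ?B" for x
    using that kh inv_g im im_g by (auto simp only: image_subset_iff)
  ultimately obtain L where L: "surjective_linear_isometry L" "\<And>x. x \<in> ?B \<Longrightarrow> h (?g' x) = L x"
    using automorphism_fixing_zero_is_linear[of "\<lambda>x. h (?g' x)" "\<lambda>x. ?g (k x)"] by blast
  have "h x = L (?g x)" if "x \<in> ?B" for x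
    using L(2)[of "?g x"] inv_g(1)[OF that] im_g(1) that by (auto simp only: image_subset_iff)
  then show "\<exists>L c. surjective_linear_isometry L \<and> norm c < 1 \<and> (\<forall>x\<in>?B. h x = L (moebius_map act ip c x))"
    using L(1) c(1) by blast
qed

end
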